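(* Let $(X,\mathcal{O}_X)$ be a ringed space (of commutative rings) with $\Gamma(X,\mathcal{O}_X)=A$, let $B$ be a commutative ring and let $\varphi : B\to A$ be a ring homomorphism. Then there is exactly one morphism of ringed spaces $$(X,\mathcal{O}_X)\to(\mathrm{Filt}\,B,\tilde{B})$$ whose homomorphism on global sections $B=\Gamma(\mathrm{Filt}\,B,\tilde B)\to A$ is the given $\varphi$.
   Context: A filter in a commutative ring $B$ is a subset $F\subseteq B$ with $1\in F$, closed under multiplication, and containing with each element all its divisors ($F=B$ is allowed). $\mathrm{Filt}\,B$ is the set of all filters of $B$ with the topology having as basis the sets $D(g)=\{F: g\in F\}$, $g\in B$. The map $i:\mathrm{Spec}\,B\to\mathrm{Filt}\,B$, $\mathfrak{p}\mapsto B\setminus\mathfrak{p}$, is a topological embedding, and the sheaf $\tilde B$ on $\mathrm{Filt}\,B$ is the direct image under $i$ of the structure sheaf of $\mathrm{Spec}\,B$. It satisfies $\Gamma(D(g),\tilde B)=B_g$ (in particular $\Gamma(\mathrm{Filt}\,B,\tilde B)=B$), and its stalk at a filter $F$ is the localization $B_F$. Convention: a morphism of ringed spaces $(X,\mathcal{O}_X)\to(Y,\mathcal{O}_Y)$ always means a morphism of ringed spaces in the usual sense which in addition is local on stalks, i.e. for every $x\in X$ with image $y$, the stalk homomorphism $\mathcal{O}_{Y,y}\to\mathcal{O}_{X,x}$ maps non-units to non-units. (The stalks are not required to be local rings.) *)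

theory Defs
  imports
    "HOL-Analysis.Abstract_Topology"
    "HOL-Algebra.Ideal"
    "HOL-Algebra.Divisibility"
begin

record ('a, 'c) ring_presheaf =
  sections :: "'a set \<Rightarrow> 'c ring"
  restr :: "'a set \<Rightarrow> 'a set \<Rightarrow> 'c \<Rightarrow> 'c"

text \<open>The restriction from \<open>U\<close> to \<open>V\<close> is \<^term>\<open>restr F U V\<close>. Only the values of a presheaf
  on open sets are meaningful.\<close>

locale ring_presheaf_on =
  fixes X :: "'a topology" and F :: "('a, 'c) ring_presheaf"
  assumes sections_cring: "openin X U \<Longrightarrow> cring (sections F U)"
    and restr_hom: "\<lbrakk>openin X U; openin X V; V \<subseteq> U\<rbrakk>
          \<Longrightarrow> restr F U V \<in> ring_hom (sections F U) (sections F V)"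
    and restr_id: "\<lbrakk>openin X U; s \<in> carrier (sections F U)\<rbrakk> \<Longrightarrow> restr F U U s = s"
    and restr_comp: "\<lbrakk>openin X U; openin X V; openin X W; W \<subseteq> V; V \<subseteq> U;
          s \<in> carrier (sections F U)\<rbrakk> \<Longrightarrow> restr F V W (restr F U V s) = restr F U W s"

text \<open>Covers are given as sets of open sets; the empty cover of the empty set is included.\<close>

locale ringed_space = ring_presheaf_on X F
  for X :: "'a topology" and F :: "('a, 'c) ring_presheaf" +
  assumes locality: "\<lbrakk>\<forall>V\<in>\<U>. openin X V; s \<in> carrier (sections F (\<Union>\<U>));
          t \<in> carrier (sections F (\<Union>\<U>));
          \<forall>V\<in>\<U>. restr F (\<Union>\<U>) V s = restr F (\<Union>\<U>) V t\<rbrakk> \<Longrightarrow> s = t"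
    and gluing: "\<lbrakk>\<forall>V\<in>\<U>. openin X V; \<forall>V\<in>\<U>. \<sigma> V \<in> carrier (sections F V);
          \<forall>V\<in>\<U>. \<forall>W\<in>\<U>. restr F V (V \<inter> W) (\<sigma> V) = restr F W (V \<inter> W) (\<sigma> W)\<rbrakk>
          \<Longrightarrow> \<exists>s\<in>carrier (sections F (\<Union>\<U>)). \<forall>V\<in>\<U>. restr F (\<Union>\<U>) V s = \<sigma> V"

definition direct_image ::
    "('a \<Rightarrow> 'd) \<Rightarrow> 'a topology \<Rightarrow> ('a, 'c) ring_presheaf \<Rightarrow> ('d, 'c) ring_presheaf" where
  "direct_image f X F =
     \<lparr>sections = (\<lambda>V. sections F {x \<in> topspace X. f x \<in> V}),
      restr = (\<lambda>V W. restr F {x \<in> topspace X. f x \<in> V} {x \<in> topspace X. f x \<in> W})\<rparr>"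

definition germ ::
    "'a topology \<Rightarrow> ('a, 'c) ring_presheaf \<Rightarrow> 'a \<Rightarrow> 'a set \<Rightarrow> 'c \<Rightarrow> ('a set \<times> 'c) set" where
  "germ X F x U s = {(V, t). openin X V \<and> x \<in> V \<and> t \<in> carrier (sections F V) \<and>
     (\<exists>W. openin X W \<and> x \<in> W \<and> W \<subseteq> U \<inter> V \<and> restr F U W s = restr F V W t)}"

text \<open>In the ring operations all members of the union coincide, i.e. they do not depend on the
  choice of representatives; the same remark applies to the map on stalks and to
  localizations below.\<close>

definition stalk ::
    "'a topology \<Rightarrow> ('a, 'c) ring_presheaf \<Rightarrow> 'a \<Rightarrow> ('a set \<times> 'c) set ring" where
  "stalk X F x =
     \<lparr>carrier = {germ X F x U s | U s. openin X U \<and> x \<in> U \<and> s \<in> carrier (sections F U)},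
      monoid.mult = (\<lambda>C D. \<Union>(U, s)\<in>C. \<Union>(V, t)\<in>D. germ X F x (U \<inter> V)
        (restr F U (U \<inter> V) s \<otimes>\<^bsub>sections F (U \<inter> V)\<^esub> restr F V (U \<inter> V) t)),
      one = germ X F x (topspace X) \<one>\<^bsub>sections F (topspace X)\<^esub>,
      zero = germ X F x (topspace X) \<zero>\<^bsub>sections F (topspace X)\<^esub>,
      add = (\<lambda>C D. \<Union>(U, s)\<in>C. \<Union>(V, t)\<in>D. germ X F x (U \<inter> V)
        (restr F U (U \<inter> V) s \<oplus>\<^bsub>sections F (U \<inter> V)\<^esub> restr F V (U \<inter> V) t))\<rparr>"

text \<open>The homomorphism from the stalk at \<^term>\<open>f x\<close> to the stalk at \<open>x\<close> induced by
  a family of homomorphisms \<open>\<theta> V\<close> from the sections over \<open>V\<close> to those over the preimage of \<open>V\<close>.\<close>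

definition stalk_hom ::
    "'a topology \<Rightarrow> ('a, 'c) ring_presheaf \<Rightarrow> ('a \<Rightarrow> 'd) \<Rightarrow> ('d set \<Rightarrow> 'e \<Rightarrow> 'c) \<Rightarrow> 'a
       \<Rightarrow> ('d set \<times> 'e) set \<Rightarrow> ('a set \<times> 'c) set" where
  "stalk_hom X F f \<theta> x C = (\<Union>(V, t)\<in>C. germ X F x {y \<in> topspace X. f y \<in> V} (\<theta> V t))"

text \<open>The extensionality assumptions fix the junk values of \<open>f\<close> and \<open>\<theta>\<close> outside of their domains,
  so that equality of morphisms is equality of the pairs \<open>(f, \<theta>)\<close>. The stalks need not be
  local rings; the last assumption is the convention that morphisms are local on stalks.\<close>

locale ringed_space_morphism =
  source: ringed_space X F + target: ringed_space Y G
  for X :: "'a topology" and F :: "('a, 'c) ring_presheaf"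
    and Y :: "'d topology" and G :: "('d, 'e) ring_presheaf" +
  fixes f :: "'a \<Rightarrow> 'd" and \<theta> :: "'d set \<Rightarrow> 'e \<Rightarrow> 'c"
  assumes continuous: "continuous_map X Y f"
    and map_extensional: "f \<in> extensional (topspace X)"
    and comorphism_extensional: "\<theta> \<in> extensional {V. openin Y V}"
      "openin Y V \<Longrightarrow> \<theta> V \<in> extensional (carrier (sections G V))"
    and comorphism_hom: "openin Y V \<Longrightarrow>
          \<theta> V \<in> ring_hom (sections G V) (sections F {x \<in> topspace X. f x \<in> V})"
    and comorphism_natural: "\<lbrakk>openin Y V; openin Y W; W \<subseteq> V; s \<in> carrier (sections G V)\<rbrakk>
          \<Longrightarrow> \<theta> W (restr G V W s)
            = restr F {x \<in> topspace X. f x \<in> V} {x \<in> topspace X. f x \<in> W} (\<theta> V s)"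
    and local_on_stalks: "\<lbrakk>x \<in> topspace X; c \<in> carrier (stalk Y G (f x));
          c \<notin> Units (stalk Y G (f x))\<rbrakk> \<Longrightarrow> stalk_hom X F f \<theta> x c \<notin> Units (stalk X F x)"

text \<open>\<^term>\<open>fraction B S a s\<close> is the fraction \<open>a / s\<close>, for \<open>S\<close> a multiplicative subset of \<open>B\<close>.\<close>

definition fraction :: "('b, 'm) ring_scheme \<Rightarrow> 'b set \<Rightarrow> 'b \<Rightarrow> 'b \<Rightarrow> ('b \<times> 'b) set" where
  "fraction B S a s = {(b, t). b \<in> carrier B \<and> t \<in> S \<and>
     (\<exists>u\<in>S. u \<otimes>\<^bsub>B\<^esub> (a \<otimes>\<^bsub>B\<^esub> t) = u \<otimes>\<^bsub>B\<^esub> (b \<otimes>\<^bsub>B\<^esub> s))}"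

definition localization :: "('b, 'm) ring_scheme \<Rightarrow> 'b set \<Rightarrow> ('b \<times> 'b) set ring" where
  "localization B S =
     \<lparr>carrier = {fraction B S a s | a s. a \<in> carrier B \<and> s \<in> S},
      monoid.mult = (\<lambda>C D. \<Union>(a, s)\<in>C. \<Union>(b, t)\<in>D. fraction B S (a \<otimes>\<^bsub>B\<^esub> b) (s \<otimes>\<^bsub>B\<^esub> t)),
      one = fraction B S \<one>\<^bsub>B\<^esub> \<one>\<^bsub>B\<^esub>,
      zero = fraction B S \<zero>\<^bsub>B\<^esub> \<one>\<^bsub>B\<^esub>,
      add = (\<lambda>C D. \<Union>(a, s)\<in>C. \<Union>(b, t)\<in>D.
        fraction B S (a \<otimes>\<^bsub>B\<^esub> t \<oplus>\<^bsub>B\<^esub> b \<otimes>\<^bsub>B\<^esub> s) (s \<otimes>\<^bsub>B\<^esub> t))\<rparr>"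

definition Spec :: "('b, 'm) ring_scheme \<Rightarrow> 'b set set" where
  "Spec B = {\<pp>. primeideal \<pp> B}"

definition zariski_topology :: "('b, 'm) ring_scheme \<Rightarrow> 'b set topology" where
  "zariski_topology B =
     topology (\<lambda>U. \<exists>E \<subseteq> carrier B. U = Spec B - {\<pp> \<in> Spec B. E \<subseteq> \<pp>})"

abbreviation local_ring_at :: "('b, 'm) ring_scheme \<Rightarrow> 'b set \<Rightarrow> ('b \<times> 'b) set ring" where
  "local_ring_at B \<pp> \<equiv> localization B (carrier B - \<pp>)"

definition spec_sections ::
    "('b, 'm) ring_scheme \<Rightarrow> 'b set set \<Rightarrow> ('b set \<Rightarrow> ('b \<times> 'b) set) set" where
  "spec_sections B U = {\<sigma> \<in> \<Pi>\<^sub>E \<pp>\<in>U. carrier (local_ring_at B \<pp>).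
     \<forall>\<pp>\<in>U. \<exists>V a g. openin (zariski_topology B) V \<and> \<pp> \<in> V \<and> V \<subseteq> U \<and>
       a \<in> carrier B \<and> g \<in> carrier B \<and>
       (\<forall>\<qq>\<in>V. g \<notin> \<qq> \<and> \<sigma> \<qq> = fraction B (carrier B - \<qq>) a g)}"

definition structure_sheaf ::
    "('b, 'm) ring_scheme \<Rightarrow> ('b set, 'b set \<Rightarrow> ('b \<times> 'b) set) ring_presheaf" where
  "structure_sheaf B =
     \<lparr>sections = (\<lambda>U.
        \<lparr>carrier = spec_sections B U,
         monoid.mult = (\<lambda>\<sigma> \<tau>. \<lambda>\<pp>\<in>U. \<sigma> \<pp> \<otimes>\<^bsub>local_ring_at B \<pp>\<^esub> \<tau> \<pp>),
         one = (\<lambda>\<pp>\<in>U. \<one>\<^bsub>local_ring_at B \<pp>\<^esub>),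
         zero = (\<lambda>\<pp>\<in>U. \<zero>\<^bsub>local_ring_at B \<pp>\<^esub>),
         add = (\<lambda>\<sigma> \<tau>. \<lambda>\<pp>\<in>U. \<sigma> \<pp> \<oplus>\<^bsub>local_ring_at B \<pp>\<^esub> \<tau> \<pp>)\<rparr>),
      restr = (\<lambda>U V \<sigma>. restrict \<sigma> V)\<rparr>"

definition Filt :: "('b, 'm) ring_scheme \<Rightarrow> 'b set set" where
  "Filt B = {F. F \<subseteq> carrier B \<and> \<one>\<^bsub>B\<^esub> \<in> F \<and> (\<forall>a\<in>F. \<forall>b\<in>F. a \<otimes>\<^bsub>B\<^esub> b \<in> F) \<and>
     (\<forall>a\<in>F. \<forall>b\<in>carrier B. b divides\<^bsub>B\<^esub> a \<longrightarrow> b \<in> F)}"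

definition basic_open :: "('b, 'm) ring_scheme \<Rightarrow> 'b \<Rightarrow> 'b set set" where
  "basic_open B g = {F \<in> Filt B. g \<in> F}"

definition filt_topology :: "('b, 'm) ring_scheme \<Rightarrow> 'b set topology" where
  "filt_topology B = topology (arbitrary union_of (\<lambda>U. \<exists>g\<in>carrier B. U = basic_open B g))"

definition spec_to_filt :: "('b, 'm) ring_scheme \<Rightarrow> 'b set \<Rightarrow> 'b set" where
  "spec_to_filt B \<pp> = carrier B - \<pp>"

definition filt_sheaf ::
    "('b, 'm) ring_scheme \<Rightarrow> ('b set, 'b set \<Rightarrow> ('b \<times> 'b) set) ring_presheaf" where
  "filt_sheaf B = direct_image (spec_to_filt B) (zariski_topology B) (structure_sheaf B)"

text \<open>The identification of \<open>B\<close> with the ring of global sections of \<^term>\<open>filt_sheaf B\<close>,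
  i.e. of \<^term>\<open>structure_sheaf B\<close>: an element \<open>b\<close> corresponds to the section \<open>b / 1\<close>.\<close>

definition global_section :: "('b, 'm) ring_scheme \<Rightarrow> 'b \<Rightarrow> 'b set \<Rightarrow> ('b \<times> 'b) set" where
  "global_section B b = (\<lambda>\<pp>\<in>Spec B. fraction B (carrier B - \<pp>) b \<one>\<^bsub>B\<^esub>)"

lemma divides_mult_left:
  assumes "cring B" "a \<in> carrier B" "b \<in> carrier B"
  shows "a divides\<^bsub>B\<^esub> (a \<otimes>\<^bsub>B\<^esub> b)" "b divides\<^bsub>B\<^esub> (a \<otimes>\<^bsub>B\<^esub> b)"
proof -
  interpret cring B by fact
  show "a divides\<^bsub>B\<^esub> (a \<otimes>\<^bsub>B\<^esub> b)" "b divides\<^bsub>B\<^esub> (a \<otimes>\<^bsub>B\<^esub> b)"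
    using assms m_comm unfolding factor_def by auto
qed

lemma openin_zariski_topology:
  assumes "cring B"
  shows "openin (zariski_topology B) U \<longleftrightarrow>
    (\<exists>E \<subseteq> carrier B. U = Spec B - {\<pp> \<in> Spec B. E \<subseteq> \<pp>})"
proof -
  interpret cring B by fact
  define D where "D E = Spec B - {\<pp> \<in> Spec B. E \<subseteq> \<pp>}" for E
  define Op where "Op U \<longleftrightarrow> (\<exists>E \<subseteq> carrier B. U = D E)" for U
  have D_iff: "\<pp> \<in> D E \<longleftrightarrow> \<pp> \<in> Spec B \<and> \<not> E \<subseteq> \<pp>" for \<pp> E
    by (auto simp: D_def)
  have "Op (U \<inter> V)" if "Op U" "Op V" for U V
  proof -
    from \<open>Op U\<close> obtain E where E: "E \<subseteq> carrier B" "U = D E" unfolding Op_def by (elim exE conjE)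
    from \<open>Op V\<close> obtain E' where E': "E' \<subseteq> carrier B" "V = D E'" unfolding Op_def by (elim exE conjE)
    let ?P = "{d \<otimes>\<^bsub>B\<^esub> e | d e. d \<in> E \<and> e \<in> E'}"
    have P: "?P \<subseteq> \<pp> \<longleftrightarrow> E \<subseteq> \<pp> \<or> E' \<subseteq> \<pp>" if "\<pp> \<in> Spec B" for \<pp>
    proof -
      interpret primeideal \<pp> B using that by (simp add: Spec_def)
      have "d \<in> \<pp> \<or> e \<in> \<pp>" if "?P \<subseteq> \<pp>" "d \<in> E" "e \<in> E'" for d e
      proof -
        have "d \<otimes>\<^bsub>B\<^esub> e \<in> ?P" using that by blast
        then show ?thesis using that E(1) E'(1) I_prime[of d e] by (meson subsetD)
      qed
      moreover have "d \<otimes>\<^bsub>B\<^esub> e \<in> \<pp>" if "d \<in> E" "e \<in> E'" "E \<subseteq> \<pp> \<or> E' \<subseteq> \<pp>" for d e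
        using that E(1) E'(1) I_l_closed[of e d] I_r_closed[of d e] by (meson subsetD)
      ultimately show ?thesis by blast
    qed
    have "\<pp> \<in> U \<inter> V \<longleftrightarrow> \<pp> \<in> D ?P" for \<pp>
      unfolding E(2) E'(2) D_iff Int_iff using P[of \<pp>] by argo
    then have "U \<inter> V = D ?P" by (rule Set.set_eqI)
    moreover have "?P \<subseteq> carrier B" using E(1) E'(1) by auto
    ultimately show ?thesis unfolding Op_def by (intro exI conjI)
  qed
  moreover have "Op (\<Union>\<K>)" if "\<forall>K\<in>\<K>. Op K" for \<K>
  proof -
    from that have "\<forall>K\<in>\<K>. \<exists>E. E \<subseteq> carrier B \<and> K = D E" unfolding Op_def .
    then obtain E where E: "\<forall>K\<in>\<K>. E K \<subseteq> carrier B \<and> K = D (E K)" by (rule bchoice[THEN exE])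
    have "\<pp> \<in> \<Union>\<K> \<longleftrightarrow> \<pp> \<in> D (\<Union>K\<in>\<K>. E K)" for \<pp>
    proof -
      have "\<pp> \<in> \<Union>\<K> \<longleftrightarrow> (\<exists>K\<in>\<K>. \<pp> \<in> D (E K))" using E by simp
      then show ?thesis unfolding D_iff by blast
    qed
    then have "\<Union>\<K> = D (\<Union>K\<in>\<K>. E K)" by (rule Set.set_eqI)
    moreover have "(\<Union>K\<in>\<K>. E K) \<subseteq> carrier B" using E by (intro UN_least) simp
    ultimately show ?thesis unfolding Op_def by (intro exI conjI)
  qed
  ultimately have "istopology Op" unfolding istopology_def by simp
  then show ?thesis
    unfolding zariski_topology_def Op_def D_def by (simp add: topology_inverse')
qed

lemma topspace_zariski_topology:
  assumes "cring B"
  shows "topspace (zariski_topology B) = Spec B"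
proof -
  interpret cring B by fact
  have "\<one>\<^bsub>B\<^esub> \<notin> \<pp>" if "\<pp> \<in> Spec B" for \<pp>
  proof -
    interpret primeideal \<pp> B using that by (simp add: Spec_def)
    show ?thesis using I_notcarr one_imp_carrier by blast
  qed
  then have "Spec B = Spec B - {\<pp> \<in> Spec B. {\<one>\<^bsub>B\<^esub>} \<subseteq> \<pp>}" by blast
  then have "openin (zariski_topology B) (Spec B)"
    unfolding openin_zariski_topology[OF assms] by blast
  moreover have "U \<subseteq> Spec B" if "openin (zariski_topology B) U" for U
    using that unfolding openin_zariski_topology[OF assms] by blast
  ultimately show ?thesis
    by (intro subset_antisym openin_subset) simp_all
qed

lemma basic_open_Int:
  assumes "cring B" "g \<in> carrier B" "h \<in> carrier B"
  shows "basic_open B g \<inter> basic_open B h = basic_open B (g \<otimes>\<^bsub>B\<^esub> h)"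
proof (intro equalityI subsetI)
  fix F assume "F \<in> basic_open B g \<inter> basic_open B h"
  then show "F \<in> basic_open B (g \<otimes>\<^bsub>B\<^esub> h)" by (simp add: basic_open_def Filt_def)
next
  fix F assume F: "F \<in> basic_open B (g \<otimes>\<^bsub>B\<^esub> h)"
  then have "\<And>b. b \<in> carrier B \<Longrightarrow> b divides\<^bsub>B\<^esub> (g \<otimes>\<^bsub>B\<^esub> h) \<Longrightarrow> b \<in> F"
    by (auto simp: basic_open_def Filt_def)
  then have "g \<in> F" "h \<in> F" using divides_mult_left[OF assms] assms(2,3) by simp_all
  then show "F \<in> basic_open B g \<inter> basic_open B h" using F by (simp add: basic_open_def)
qed

lemma openin_filt_topology:
  assumes "cring B"
  shows "openin (filt_topology B) = arbitrary union_of (\<lambda>U. \<exists>g\<in>carrier B. U = basic_open B g)"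
proof -
  interpret cring B by fact
  have "istopology (arbitrary union_of (\<lambda>U. \<exists>g\<in>carrier B. U = basic_open B g))"
    by (rule istopology_base) (metis assms basic_open_Int m_closed)
  then show ?thesis unfolding filt_topology_def by (simp add: topology_inverse')
qed

lemma topspace_filt_topology:
  assumes "cring B"
  shows "topspace (filt_topology B) = Filt B"
proof -
  interpret cring B by fact
  have "Filt B = basic_open B \<one>\<^bsub>B\<^esub>" unfolding basic_open_def Filt_def by blast
  then have "openin (filt_topology B) (Filt B)"
    unfolding openin_filt_topology[OF assms] by (intro arbitrary_union_of_inc bexI[OF _ one_closed])
  moreover have "U \<subseteq> Filt B" if "openin (filt_topology B) U" for U
    using that unfolding openin_filt_topology[OF assms] union_of_def basic_open_def by blast
  ultimately show ?thesis
    by (intro subset_antisym openin_subset) simp_all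
qed

end

theory Submission
  imports Defs
begin

text \<open>
Write \<open>\<phi>(b)\<close> for the global section of \<open>X\<close> attached to \<open>b\<close>. On the basic open set \<open>D(b)\<close> of filters
containing \<open>b\<close>, the section \<open>b\<close> is invertible; conversely a filter at which the germ of \<open>b\<close> is
invertible contains \<open>b\<close> (\<open>germ_global_section_Unit\<close>). A morphism preserves units, and locality on
stalks says that it also reflects them. Hence the underlying map is forced: \<open>x\<close> is sent to the filter
\<open>unit_filter x\<close> of those \<open>b\<close> whose image is a unit in a neighbourhood of \<open>x\<close>. Filters take the place
of prime ideals because the non-units of a stalk need not form an ideal.

The comorphism is forced as well. Near a filter \<open>F\<close> every section of the sheaf is a fraction \<open>a / g\<close>
with \<open>g \<in> F\<close> (\<open>section_is_fraction\<close>), and then \<open>\<phi>(a) / \<phi>(g)\<close> is the only possible value near a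
point over \<open>F\<close>. That this value does not depend on the fraction is \<open>represents_unique\<close>; the sheaf
axioms of \<open>X\<close> glue the local values (\<open>image_exists\<close>) and show that the result is determined
(\<open>image_unique\<close>). Existence (\<open>morphism\<close>) and uniqueness (\<open>morphism_map_unique\<close>,
\<open>morphism_comorphism_unique\<close>) of the morphism both rest on this local characterization.

The algebraic input is the computation of sections of the structure sheaf over a basic open set
(\<open>section_on_basic_open\<close>), together with the fact that relations holding at all primes avoiding \<open>g\<close>
hold in \<open>B\<close> up to a power of \<open>g\<close>. Both come from the existence of a prime ideal that contains a given
ideal and avoids the powers of \<open>g\<close> (\<open>prime_avoiding_powers\<close>).
\<close>

text \<open>Products and sums in localizations and stalks, and the maps on stalks, are unions over all
representatives of a class; such a union is evaluated by showing that all its members agree.\<close>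

lemma UN_pair_const:
  assumes "p \<in> A" "\<And>a s. (a, s) \<in> A \<Longrightarrow> f a s = C"
  shows "(\<Union>(a, s)\<in>A. f a s) = C"
proof -
  have "(case p of (a, s) \<Rightarrow> f a s) = C" if "p \<in> A" for p
    using assms(2)[of "fst p" "snd p"] that by (simp add: case_prod_beta)
  then show ?thesis using assms(1) by auto
qed

section \<open>Prime ideals\<close>

lemma (in cring) ideal_of_closed:
  assumes "I \<subseteq> carrier R" "\<zero> \<in> I" "\<And>a b. a \<in> I \<Longrightarrow> b \<in> I \<Longrightarrow> a \<oplus> b \<in> I"
    and mult: "\<And>a r. a \<in> I \<Longrightarrow> r \<in> carrier R \<Longrightarrow> r \<otimes> a \<in> I"
  shows "ideal I R"
proof (rule idealI)
  show "ring R" by (rule ring_axioms)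
  have minus: "\<ominus> a \<in> I" if "a \<in> I" for a
    using mult[OF that, of "\<ominus> \<one>"] that assms(1) by (simp add: l_minus subsetD)
  have "subgroup I (add_monoid R)"
    by (rule group.subgroupI[OF a_group]) (use assms minus in \<open>auto simp: a_inv_def\<close>)
  then show "subgroup I (add_monoid R)" .
  fix a x assume "a \<in> I" "x \<in> carrier R"
  then show "x \<otimes> a \<in> I" "a \<otimes> x \<in> I"
    using mult[of a x] assms(1) m_comm[of a x] by auto
qed

lemma (in cring) ideal_adjoin:
  assumes "ideal I R" "a \<in> carrier R"
  shows "ideal {i \<oplus> r \<otimes> a | i r. i \<in> I \<and> r \<in> carrier R} R"
proof (rule ideal_of_closed)
  interpret I: ideal I R by fact
  let ?J = "{i \<oplus> r \<otimes> a | i r. i \<in> I \<and> r \<in> carrier R}"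
  show "?J \<subseteq> carrier R" using assms(2) I.a_subset by auto
  have "\<zero> = \<zero> \<oplus> \<zero> \<otimes> a" using assms(2) by simp
  then show "\<zero> \<in> ?J" using I.zero_closed by blast
next
  interpret I: ideal I R by fact
  fix x y assume "x \<in> {i \<oplus> r \<otimes> a | i r. i \<in> I \<and> r \<in> carrier R}"
    "y \<in> {i \<oplus> r \<otimes> a | i r. i \<in> I \<and> r \<in> carrier R}"
  then obtain i r j s where *: "x = i \<oplus> r \<otimes> a" "y = j \<oplus> s \<otimes> a" "i \<in> I" "j \<in> I"
      "r \<in> carrier R" "s \<in> carrier R" by blast
  have "x \<oplus> y = (i \<oplus> j) \<oplus> (r \<oplus> s) \<otimes> a" unfolding *
    using * assms(2) I.a_Hcarr by algebra
  then show "x \<oplus> y \<in> {i \<oplus> r \<otimes> a | i r. i \<in> I \<and> r \<in> carrier R}"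
    using * I.a_closed by blast
next
  interpret I: ideal I R by fact
  fix x t assume "x \<in> {i \<oplus> r \<otimes> a | i r. i \<in> I \<and> r \<in> carrier R}" "t \<in> carrier R"
  then obtain i r where *: "x = i \<oplus> r \<otimes> a" "i \<in> I" "r \<in> carrier R" "t \<in> carrier R" by blast
  have "t \<otimes> x = t \<otimes> i \<oplus> (t \<otimes> r) \<otimes> a" unfolding *
    using * assms(2) I.a_Hcarr by algebra
  then show "t \<otimes> x \<in> {i \<oplus> r \<otimes> a | i r. i \<in> I \<and> r \<in> carrier R}"
    using * I.I_l_closed by blast
qed

lemma (in cring) ideal_Union_chain:
  assumes "C \<noteq> {}" "\<And>I. I \<in> C \<Longrightarrow> ideal I R" "\<And>I J. I \<in> C \<Longrightarrow> J \<in> C \<Longrightarrow> I \<subseteq> J \<or> J \<subseteq> I"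
  shows "ideal (\<Union>C) R"
proof (rule ideal_of_closed)
  show "\<Union>C \<subseteq> carrier R" using assms(2) additive_subgroup.a_subset ideal.axioms(1) by blast
  show "\<zero> \<in> \<Union>C"
    using assms(1,2) additive_subgroup.zero_closed ideal.axioms(1) by blast
  show "a \<oplus> b \<in> \<Union>C" if ab: "a \<in> \<Union>C" "b \<in> \<Union>C" for a b
  proof -
    obtain I J where "I \<in> C" "a \<in> I" "J \<in> C" "b \<in> J" using ab by blast
    then obtain K where "K \<in> C" "a \<in> K" "b \<in> K" using assms(3)[of I J] by blast
    then show ?thesis
      using additive_subgroup.a_closed[OF ideal.axioms(1)[OF assms(2)]] by blast
  qed
  show "r \<otimes> a \<in> \<Union>C" if ar: "a \<in> \<Union>C" "r \<in> carrier R" for a r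
  proof -
    obtain I where "I \<in> C" "a \<in> I" using ar by blast
    then show ?thesis using ideal.I_l_closed[OF assms(2)] ar(2) by blast
  qed
qed

text \<open>An ideal maximal among those containing \<open>J\<close> and no power of \<open>g\<close> is prime: for \<open>a\<close>, \<open>b\<close> outside
of it, adjoining \<open>a\<close> or \<open>b\<close> produces a power of \<open>g\<close>, and the product of the two powers lies in the
ideal together with \<open>a \<otimes> b\<close>. This is the only source of prime ideals; it is what turns statements
about all primes in a basic open set into equations involving a power of \<open>g\<close>.\<close>

lemma (in cring) prime_avoiding_powers:
  assumes J: "ideal J R" and g: "g \<in> carrier R" and avoid: "\<And>n::nat. g [^] n \<notin> J"
  obtains P where "P \<in> Spec R" "J \<subseteq> P" "g \<notin> P"
proof -
  define \<I> where "\<I> = {I. ideal I R \<and> J \<subseteq> I \<and> (\<forall>n::nat. g [^] n \<notin> I)}"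
  have "\<exists>M\<in>\<I>. \<forall>I\<in>\<I>. M \<subseteq> I \<longrightarrow> I = M"
  proof (rule subset_Zorn_nonempty)
    show "\<I> \<noteq> {}" using J avoid unfolding \<I>_def by blast
    fix C assume C: "C \<noteq> {}" "subset.chain \<I> C"
    then have sub: "C \<subseteq> \<I>" and lin: "\<And>I K. I \<in> C \<Longrightarrow> K \<in> C \<Longrightarrow> I \<subseteq> K \<or> K \<subseteq> I"
      by (auto simp: subset_chain_def)
    have "ideal (\<Union>C) R"
      by (rule ideal_Union_chain) (use C(1) sub lin in \<open>auto simp: \<I>_def\<close>)
    then show "\<Union>C \<in> \<I>" using C(1) sub unfolding \<I>_def by blast
  qed
  then obtain M where M: "M \<in> \<I>" and max: "\<And>I. I \<in> \<I> \<Longrightarrow> M \<subseteq> I \<Longrightarrow> I = M" by blast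
  have idM: "ideal M R" and JM: "J \<subseteq> M" and powM: "\<And>n::nat. g [^] n \<notin> M"
    using M unfolding \<I>_def by blast+
  interpret M: ideal M R by (rule idM)
  have power_in_adjoin: "\<exists>n::nat. \<exists>i\<in>M. \<exists>r\<in>carrier R. g [^] n = i \<oplus> r \<otimes> a"
    if a: "a \<in> carrier R" "a \<notin> M" for a
  proof -
    let ?K = "{i \<oplus> r \<otimes> a | i r. i \<in> M \<and> r \<in> carrier R}"
    have "i = i \<oplus> \<zero> \<otimes> a" if "i \<in> M" for i using that a M.a_Hcarr by simp
    then have 1: "M \<subseteq> ?K" by blast
    have "a = \<zero> \<oplus> \<one> \<otimes> a" using a by simp
    then have "a \<in> ?K" using M.zero_closed by blast
    then have "?K \<noteq> M" using a by blast
    then have "?K \<notin> \<I>" using max 1 by blast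
    then show ?thesis using ideal_adjoin[OF idM a(1)] 1 JM unfolding \<I>_def by blast
  qed
  have "primeideal M R"
  proof (rule primeidealI[OF idM is_cring])
    show "carrier R \<noteq> M" using powM[of 0] by auto
    fix a b assume ab: "a \<in> carrier R" "b \<in> carrier R" "a \<otimes> b \<in> M"
    show "a \<in> M \<or> b \<in> M"
    proof (rule ccontr)
      assume "\<not> (a \<in> M \<or> b \<in> M)"
      then obtain n i r m j s where *: "g [^] (n::nat) = i \<oplus> r \<otimes> a" "i \<in> M" "r \<in> carrier R"
        "g [^] (m::nat) = j \<oplus> s \<otimes> b" "j \<in> M" "s \<in> carrier R"
        using power_in_adjoin[of a] power_in_adjoin[of b] ab by blast
      have ij: "i \<in> carrier R" "j \<in> carrier R" using * M.a_Hcarr by auto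
      have "g [^] (n + m) = g [^] n \<otimes> g [^] m" using g by (simp add: nat_pow_mult)
      also have "\<dots> = (j \<oplus> s \<otimes> b) \<otimes> i \<oplus> ((r \<otimes> a) \<otimes> j \<oplus> (r \<otimes> s) \<otimes> (a \<otimes> b))"
        unfolding *(1,4) using ab ij * by algebra
      also have "\<dots> \<in> M"
      proof (intro M.a_closed)
        show "(j \<oplus> s \<otimes> b) \<otimes> i \<in> M" "(r \<otimes> a) \<otimes> j \<in> M" "(r \<otimes> s) \<otimes> (a \<otimes> b) \<in> M"
          using ab * ij by (simp_all add: M.I_l_closed)
      qed
      finally show False using powM by blast
    qed
  qed
  then show ?thesis using that[of M] JM powM[of 1] g by (auto simp: Spec_def)
qed

text \<open>The annihilator of \<open>c\<close> is contained in no prime avoiding \<open>g\<close>, so it contains a power of \<open>g\<close>: an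
element that vanishes in all local rings over \<open>D(g)\<close> vanishes after inverting \<open>g\<close>.\<close>

lemma (in cring) annihilated_by_power:
  assumes "g \<in> carrier R" "c \<in> carrier R"
    and loc: "\<And>P. P \<in> Spec R \<Longrightarrow> g \<notin> P \<Longrightarrow> \<exists>u\<in>carrier R - P. u \<otimes> c = \<zero>"
  obtains n :: nat where "g [^] n \<otimes> c = \<zero>"
proof -
  let ?J = "{u \<in> carrier R. u \<otimes> c = \<zero>}"
  have "ideal ?J R"
    by (rule ideal_of_closed) (use assms(1,2) in \<open>auto simp: r_distr l_distr m_assoc\<close>)
  have "\<exists>n :: nat. g [^] n \<in> ?J"
  proof (rule ccontr)
    assume "\<not> ?thesis"
    then obtain P where "P \<in> Spec R" "?J \<subseteq> P" "g \<notin> P"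
      using prime_avoiding_powers[OF \<open>ideal ?J R\<close> assms(1)] by metis
    with loc[of P] show False by auto
  qed
  then show ?thesis using that by auto
qed

text \<open>The same argument for the principal ideal of \<open>b\<close>. In terms of filters: if \<open>b\<close> is invertible on the
part of the spectrum over \<open>D(g)\<close>, then every filter that contains \<open>g\<close> also contains \<open>b\<close>. This is
why the spectrum sees enough of the space of filters.\<close>

lemma (in cring) divides_power:
  assumes "g \<in> carrier R" "b \<in> carrier R" and "\<And>P. P \<in> Spec R \<Longrightarrow> g \<notin> P \<Longrightarrow> b \<notin> P"
  obtains n :: nat where "b divides g [^] n"
proof -
  have "b \<in> PIdl b" using assms(2) by (rule cgenideal_self)
  have "\<exists>n :: nat. g [^] n \<in> PIdl b"
  proof (rule ccontr)
    assume "\<not> ?thesis"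
    then obtain P where "P \<in> Spec R" "PIdl b \<subseteq> P" "g \<notin> P"
      using prime_avoiding_powers[OF cgenideal_ideal[OF assms(2)] assms(1)] by metis
    with assms(3)[of P] \<open>b \<in> PIdl b\<close> show False by auto
  qed
  then obtain n :: nat and r where "r \<in> carrier R" "g [^] n = r \<otimes> b"
    unfolding cgenideal_def by auto
  then show ?thesis using that[of n] assms(2) m_comm[of r b] unfolding factor_def by auto
qed

section \<open>Localizations\<close>

context cring begin

context
  fixes S assumes S: "submonoid S R"
begin

interpretation S: submonoid S R by (rule S)

lemma fraction_eq_iff:
  assumes "a \<in> carrier R" "b \<in> carrier R" "s \<in> S" "t \<in> S"
  shows "fraction R S a s = fraction R S b t \<longleftrightarrow> (\<exists>u\<in>S. u \<otimes> (a \<otimes> t) = u \<otimes> (b \<otimes> s))"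
proof -
  have sub: "fraction R S a s \<subseteq> fraction R S b t"
    if ab: "a \<in> carrier R" "b \<in> carrier R" "s \<in> S" "t \<in> S"
      and ex: "\<exists>u\<in>S. u \<otimes> (a \<otimes> t) = u \<otimes> (b \<otimes> s)" for a b s t
  proof
    obtain u where u: "u \<in> S" "u \<otimes> (a \<otimes> t) = u \<otimes> (b \<otimes> s)" using ex by blast
    fix p assume "p \<in> fraction R S a s"
    then obtain c v w where p: "p = (c, v)" "c \<in> carrier R" "v \<in> S" "w \<in> S"
      "w \<otimes> (a \<otimes> v) = w \<otimes> (c \<otimes> s)" unfolding fraction_def by blast
    have car: "u \<in> carrier R" "s \<in> carrier R" "t \<in> carrier R" "v \<in> carrier R" "w \<in> carrier R"
      using u ab p S.subset by auto
    have "(u \<otimes> w \<otimes> s) \<otimes> (b \<otimes> v) = (u \<otimes> (b \<otimes> s)) \<otimes> (w \<otimes> v)" using car ab by algebra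
    also have "\<dots> = (u \<otimes> (a \<otimes> t)) \<otimes> (w \<otimes> v)" using u by simp
    also have "\<dots> = (w \<otimes> (a \<otimes> v)) \<otimes> (u \<otimes> t)" using car ab by algebra
    also have "\<dots> = (w \<otimes> (c \<otimes> s)) \<otimes> (u \<otimes> t)" using p by simp
    also have "\<dots> = (u \<otimes> w \<otimes> s) \<otimes> (c \<otimes> t)" using car p ab by algebra
    finally show "p \<in> fraction R S b t" using p u ab unfolding fraction_def by blast
  qed
  have "(a, s) \<in> fraction R S a s" using assms S.one_closed unfolding fraction_def by blast
  have "\<exists>u\<in>S. u \<otimes> (a \<otimes> t) = u \<otimes> (b \<otimes> s)" if "fraction R S a s = fraction R S b t"
  proof -
    have "(a, s) \<in> fraction R S b t" using \<open>(a, s) \<in> fraction R S a s\<close> that by simp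
    then obtain u where "u \<in> S" "u \<otimes> (b \<otimes> s) = u \<otimes> (a \<otimes> t)" unfolding fraction_def by blast
    then show ?thesis by (intro bexI[of _ u]) simp_all
  qed
  moreover have "fraction R S a s = fraction R S b t" if "\<exists>u\<in>S. u \<otimes> (a \<otimes> t) = u \<otimes> (b \<otimes> s)"
    using sub[OF assms that] sub[of b a t s] assms that by (metis subset_antisym)
  ultimately show ?thesis by blast
qed

lemma fraction_eqI:
  assumes "a \<in> carrier R" "b \<in> carrier R" "s \<in> S" "t \<in> S" "a \<otimes> t = b \<otimes> s"
  shows "fraction R S a s = fraction R S b t"
  unfolding fraction_eq_iff[OF assms(1-4)] using assms(5) by (intro bexI[of _ \<one>]) simp_all

lemma fraction_self: "a \<in> carrier R \<Longrightarrow> s \<in> S \<Longrightarrow> (a, s) \<in> fraction R S a s"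
  using S.one_closed unfolding fraction_def by blast

lemma UN_fraction:
  assumes "a \<in> carrier R" "b \<in> carrier R" "s \<in> S" "t \<in> S"
    and "\<And>a' s' b' t'. \<lbrakk>(a', s') \<in> fraction R S a s; (b', t') \<in> fraction R S b t\<rbrakk>
      \<Longrightarrow> h a' s' b' t' = h a s b t"
  shows "(\<Union>(a, s)\<in>fraction R S a s. \<Union>(b, t)\<in>fraction R S b t. h a s b t) = h a s b t"
  by (rule UN_pair_const[OF fraction_self], rule assms, rule assms,
      rule UN_pair_const[OF fraction_self], rule assms, rule assms, rule assms(5))

lemma fraction_mult:
  assumes "a \<in> carrier R" "b \<in> carrier R" "s \<in> S" "t \<in> S"
  shows "fraction R S a s \<otimes>\<^bsub>localization R S\<^esub> fraction R S b t = fraction R S (a \<otimes> b) (s \<otimes> t)"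
proof -
  have "fraction R S (a' \<otimes> b') (s' \<otimes> t') = fraction R S (a \<otimes> b) (s \<otimes> t)"
    if mem: "(a', s') \<in> fraction R S a s" "(b', t') \<in> fraction R S b t" for a' s' b' t'
  proof -
    obtain u v where uv: "u \<in> S" "u \<otimes> (a \<otimes> s') = u \<otimes> (a' \<otimes> s)"
      "v \<in> S" "v \<otimes> (b \<otimes> t') = v \<otimes> (b' \<otimes> t)"
      and car: "a' \<in> carrier R" "s' \<in> S" "b' \<in> carrier R" "t' \<in> S"
      using mem unfolding fraction_def by blast
    have c: "s \<in> carrier R" "t \<in> carrier R" "s' \<in> carrier R" "t' \<in> carrier R"
      "u \<in> carrier R" "v \<in> carrier R" using assms car uv S.subset by auto
    have "(u \<otimes> v) \<otimes> ((a' \<otimes> b') \<otimes> (s \<otimes> t)) = (u \<otimes> (a' \<otimes> s)) \<otimes> (v \<otimes> (b' \<otimes> t))"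
      using c car assms by algebra
    also have "\<dots> = (u \<otimes> (a \<otimes> s')) \<otimes> (v \<otimes> (b \<otimes> t'))" using uv by simp
    also have "\<dots> = (u \<otimes> v) \<otimes> ((a \<otimes> b) \<otimes> (s' \<otimes> t'))" using c car assms by algebra
    finally show ?thesis
      using assms car uv by (subst fraction_eq_iff) auto
  qed
  then show ?thesis
    using UN_fraction[OF assms, of "\<lambda>a s b t. fraction R S (a \<otimes> b) (s \<otimes> t)"]
    by (simp add: localization_def)
qed

lemma fraction_add:
  assumes "a \<in> carrier R" "b \<in> carrier R" "s \<in> S" "t \<in> S"
  shows "fraction R S a s \<oplus>\<^bsub>localization R S\<^esub> fraction R S b t
    = fraction R S (a \<otimes> t \<oplus> b \<otimes> s) (s \<otimes> t)"
proof -
  have "fraction R S (a' \<otimes> t' \<oplus> b' \<otimes> s') (s' \<otimes> t') = fraction R S (a \<otimes> t \<oplus> b \<otimes> s) (s \<otimes> t)"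
    if mem: "(a', s') \<in> fraction R S a s" "(b', t') \<in> fraction R S b t" for a' s' b' t'
  proof -
    obtain u v where uv: "u \<in> S" "u \<otimes> (a \<otimes> s') = u \<otimes> (a' \<otimes> s)"
      "v \<in> S" "v \<otimes> (b \<otimes> t') = v \<otimes> (b' \<otimes> t)"
      and car: "a' \<in> carrier R" "s' \<in> S" "b' \<in> carrier R" "t' \<in> S"
      using mem unfolding fraction_def by blast
    have c: "s \<in> carrier R" "t \<in> carrier R" "s' \<in> carrier R" "t' \<in> carrier R"
      "u \<in> carrier R" "v \<in> carrier R" using assms car uv S.subset by auto
    have "(u \<otimes> v) \<otimes> ((a' \<otimes> t' \<oplus> b' \<otimes> s') \<otimes> (s \<otimes> t))
        = (u \<otimes> (a' \<otimes> s)) \<otimes> (v \<otimes> (t \<otimes> t')) \<oplus> (v \<otimes> (b' \<otimes> t)) \<otimes> (u \<otimes> (s \<otimes> s'))"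
      using c car assms by algebra
    also have "\<dots> = (u \<otimes> (a \<otimes> s')) \<otimes> (v \<otimes> (t \<otimes> t')) \<oplus> (v \<otimes> (b \<otimes> t')) \<otimes> (u \<otimes> (s \<otimes> s'))"
      using uv by simp
    also have "\<dots> = (u \<otimes> v) \<otimes> ((a \<otimes> t \<oplus> b \<otimes> s) \<otimes> (s' \<otimes> t'))" using c car assms by algebra
    finally show ?thesis
      using assms car uv c by (subst fraction_eq_iff) auto
  qed
  then show ?thesis
    using UN_fraction[OF assms, of "\<lambda>a s b t. fraction R S (a \<otimes> t \<oplus> b \<otimes> s) (s \<otimes> t)"]
    by (simp add: localization_def)
qed

lemma fraction_in_localization [intro]:
  "a \<in> carrier R \<Longrightarrow> s \<in> S \<Longrightarrow> fraction R S a s \<in> carrier (localization R S)"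
  unfolding localization_def by auto

lemma localization_cases:
  assumes "x \<in> carrier (localization R S)"
  obtains a s where "a \<in> carrier R" "s \<in> S" "x = fraction R S a s"
  using assms unfolding localization_def by auto

lemma localization_one: "\<one>\<^bsub>localization R S\<^esub> = fraction R S \<one> \<one>"
  and localization_zero: "\<zero>\<^bsub>localization R S\<^esub> = fraction R S \<zero> \<one>"
  by (simp_all add: localization_def)

lemma localization_cring: "cring (localization R S)" (is "cring ?L")
proof (intro cringI abelian_groupI comm_monoidI)
  note simps = localization_one localization_zero fraction_mult fraction_add
  note [simp] = subsetD[OF S.subset]
  show "x \<otimes>\<^bsub>?L\<^esub> y \<in> carrier ?L" "x \<oplus>\<^bsub>?L\<^esub> y \<in> carrier ?L"
    "x \<otimes>\<^bsub>?L\<^esub> y = y \<otimes>\<^bsub>?L\<^esub> x" "x \<oplus>\<^bsub>?L\<^esub> y = y \<oplus>\<^bsub>?L\<^esub> x"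
    if xy: "x \<in> carrier ?L" "y \<in> carrier ?L" for x y
  proof -
    obtain a s where x: "a \<in> carrier R" "s \<in> S" "x = fraction R S a s"
      using xy(1) by (rule localization_cases)
    obtain b t where y: "b \<in> carrier R" "t \<in> S" "y = fraction R S b t"
      using xy(2) by (rule localization_cases)
    note * = x y
    show "x \<otimes>\<^bsub>?L\<^esub> y \<in> carrier ?L" "x \<oplus>\<^bsub>?L\<^esub> y \<in> carrier ?L"
      using * by (auto simp: simps)
    have c: "s \<in> carrier R" "t \<in> carrier R" using * by auto
    show "x \<otimes>\<^bsub>?L\<^esub> y = y \<otimes>\<^bsub>?L\<^esub> x" "x \<oplus>\<^bsub>?L\<^esub> y = y \<oplus>\<^bsub>?L\<^esub> x"
      using * c by (simp_all add: simps m_comm a_comm)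
  qed
  show "x \<otimes>\<^bsub>?L\<^esub> y \<otimes>\<^bsub>?L\<^esub> z = x \<otimes>\<^bsub>?L\<^esub> (y \<otimes>\<^bsub>?L\<^esub> z)" "x \<oplus>\<^bsub>?L\<^esub> y \<oplus>\<^bsub>?L\<^esub> z = x \<oplus>\<^bsub>?L\<^esub> (y \<oplus>\<^bsub>?L\<^esub> z)"
    "(x \<oplus>\<^bsub>?L\<^esub> y) \<otimes>\<^bsub>?L\<^esub> z = x \<otimes>\<^bsub>?L\<^esub> z \<oplus>\<^bsub>?L\<^esub> y \<otimes>\<^bsub>?L\<^esub> z"
    if xyz: "x \<in> carrier ?L" "y \<in> carrier ?L" "z \<in> carrier ?L" for x y z
  proof -
    obtain a s where x: "a \<in> carrier R" "s \<in> S" "x = fraction R S a s"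
      using xyz(1) by (rule localization_cases)
    obtain b t where y: "b \<in> carrier R" "t \<in> S" "y = fraction R S b t"
      using xyz(2) by (rule localization_cases)
    obtain d w where z: "d \<in> carrier R" "w \<in> S" "z = fraction R S d w"
      using xyz(3) by (rule localization_cases)
    note * = x y z
    have c: "s \<in> carrier R" "t \<in> carrier R" "w \<in> carrier R" using * by auto
    show "x \<otimes>\<^bsub>?L\<^esub> y \<otimes>\<^bsub>?L\<^esub> z = x \<otimes>\<^bsub>?L\<^esub> (y \<otimes>\<^bsub>?L\<^esub> z)"
      using * c by (simp add: simps m_assoc)
    have "((a \<otimes> t \<oplus> b \<otimes> s) \<otimes> w \<oplus> d \<otimes> (s \<otimes> t)) = a \<otimes> (t \<otimes> w) \<oplus> (b \<otimes> w \<oplus> d \<otimes> t) \<otimes> s"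
      using * c by algebra
    then show "x \<oplus>\<^bsub>?L\<^esub> y \<oplus>\<^bsub>?L\<^esub> z = x \<oplus>\<^bsub>?L\<^esub> (y \<oplus>\<^bsub>?L\<^esub> z)"
      using * c by (simp add: simps m_assoc)
    have "(a \<otimes> t \<oplus> b \<otimes> s) \<otimes> d \<otimes> (s \<otimes> w \<otimes> (t \<otimes> w))
        = (a \<otimes> d \<otimes> (t \<otimes> w) \<oplus> b \<otimes> d \<otimes> (s \<otimes> w)) \<otimes> (s \<otimes> t \<otimes> w)"
      using * c by algebra
    then show "(x \<oplus>\<^bsub>?L\<^esub> y) \<otimes>\<^bsub>?L\<^esub> z = x \<otimes>\<^bsub>?L\<^esub> z \<oplus>\<^bsub>?L\<^esub> y \<otimes>\<^bsub>?L\<^esub> z"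
      using * c by (simp add: simps) (rule fraction_eqI; simp)
  qed
  show "\<one>\<^bsub>?L\<^esub> \<in> carrier ?L" "\<zero>\<^bsub>?L\<^esub> \<in> carrier ?L" by (auto simp: simps)
  fix x assume "x \<in> carrier ?L"
  then obtain a s where *: "a \<in> carrier R" "s \<in> S" "x = fraction R S a s"
    by (elim localization_cases)
  show "\<one>\<^bsub>?L\<^esub> \<otimes>\<^bsub>?L\<^esub> x = x" "\<zero>\<^bsub>?L\<^esub> \<oplus>\<^bsub>?L\<^esub> x = x" using * by (simp_all add: simps)
  have "fraction R S (\<ominus> a) s \<oplus>\<^bsub>?L\<^esub> x = \<zero>\<^bsub>?L\<^esub>"
    using * by (simp add: simps l_minus l_neg) (rule fraction_eqI; simp)
  then show "\<exists>y\<in>carrier ?L. y \<oplus>\<^bsub>?L\<^esub> x = \<zero>\<^bsub>?L\<^esub>" using * by blast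
qed

lemma fraction_minus:
  assumes "a \<in> carrier R" "s \<in> S"
  shows "\<ominus>\<^bsub>localization R S\<^esub> fraction R S a s = fraction R S (\<ominus> a) s"
proof -
  interpret L: cring "localization R S" by (rule localization_cring)
  note [simp] = subsetD[OF S.subset]
  have "fraction R S (\<ominus> a) s \<oplus>\<^bsub>localization R S\<^esub> fraction R S a s = \<zero>\<^bsub>localization R S\<^esub>"
    using assms by (simp add: fraction_add localization_zero l_minus l_neg) (rule fraction_eqI; simp)
  then show ?thesis using assms by (intro L.minus_equality) auto
qed

end

end

section \<open>The structure sheaf of the spectrum\<close>

definition spec_basic :: "('b, 'm) ring_scheme \<Rightarrow> 'b \<Rightarrow> 'b set set" where
  "spec_basic B g = {P \<in> Spec B. g \<notin> P}"

abbreviation frac_at :: "('b, 'm) ring_scheme \<Rightarrow> 'b set \<Rightarrow> 'b \<Rightarrow> 'b \<Rightarrow> ('b \<times> 'b) set" where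
  "frac_at B P a s \<equiv> fraction B (carrier B - P) a s"

context cring
begin

lemma prime_mult_iff:
  assumes "P \<in> Spec R" "a \<in> carrier R" "b \<in> carrier R"
  shows "a \<otimes> b \<in> P \<longleftrightarrow> a \<in> P \<or> b \<in> P"
proof -
  interpret primeideal P R using assms(1) by (simp add: Spec_def)
  show ?thesis using I_prime I_l_closed I_r_closed assms by blast
qed

lemma prime_one: "P \<in> Spec R \<Longrightarrow> \<one> \<notin> P"
proof -
  assume "P \<in> Spec R"
  then interpret primeideal P R by (simp add: Spec_def)
  show ?thesis using I_notcarr one_imp_carrier by blast
qed

lemma prime_zero: "P \<in> Spec R \<Longrightarrow> \<zero> \<in> P"
proof -
  assume "P \<in> Spec R"
  then interpret primeideal P R by (simp add: Spec_def)
  show ?thesis by (rule zero_closed)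
qed

lemma prime_add: "P \<in> Spec R \<Longrightarrow> a \<in> P \<Longrightarrow> b \<in> P \<Longrightarrow> a \<oplus> b \<in> P"
proof -
  assume "P \<in> Spec R" "a \<in> P" "b \<in> P"
  then interpret primeideal P R by (simp add: Spec_def)
  show ?thesis by (rule a_closed) fact+
qed

lemma prime_power: "P \<in> Spec R \<Longrightarrow> g \<in> carrier R \<Longrightarrow> g \<notin> P \<Longrightarrow> g [^] (n::nat) \<notin> P"
  by (induction n) (simp_all add: prime_one prime_mult_iff)

lemma submonoid_prime_complement: "P \<in> Spec R \<Longrightarrow> submonoid (carrier R - P) R"
  by (rule submonoid.intro) (auto simp: prime_mult_iff prime_one)

lemma frac_at_eqI:
  assumes "P \<in> Spec R" "a \<in> carrier R" "b \<in> carrier R" "s \<in> carrier R" "t \<in> carrier R"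
    "s \<notin> P" "t \<notin> P" "a \<otimes> t = b \<otimes> s"
  shows "frac_at R P a s = frac_at R P b t"
  using assms by (intro fraction_eqI submonoid_prime_complement) auto

lemma spec_basic_mult:
  "g \<in> carrier R \<Longrightarrow> h \<in> carrier R \<Longrightarrow> spec_basic R (g \<otimes> h) = spec_basic R g \<inter> spec_basic R h"
  by (auto simp: spec_basic_def prime_mult_iff)

lemma openin_spec_basic: "g \<in> carrier R \<Longrightarrow> openin (zariski_topology R) (spec_basic R g)"
  unfolding openin_zariski_topology[OF is_cring] spec_basic_def by (intro exI[of _ "{g}"]) auto

lemma spec_basic_base:
  assumes "openin (zariski_topology R) U" "P \<in> U"
  obtains g where "g \<in> carrier R" "P \<in> spec_basic R g" "spec_basic R g \<subseteq> U"
proof -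
  obtain E where E: "E \<subseteq> carrier R" "U = Spec R - {P \<in> Spec R. E \<subseteq> P}"
    using assms(1) unfolding openin_zariski_topology[OF is_cring] by blast
  then obtain g where "g \<in> E" "g \<notin> P" "P \<in> Spec R" using assms(2) by blast
  then show ?thesis using E that[of g] by (auto simp: spec_basic_def)
qed

lemma spec_sections_local:
  assumes "\<sigma> \<in> spec_sections R U" "P \<in> U"
  obtains g a s where "g \<in> carrier R" "P \<in> spec_basic R g" "spec_basic R g \<subseteq> U"
    "a \<in> carrier R" "s \<in> carrier R"
    "\<And>Q. Q \<in> spec_basic R g \<Longrightarrow> s \<notin> Q \<and> \<sigma> Q = frac_at R Q a s"
proof -
  obtain V a s where V: "openin (zariski_topology R) V" "P \<in> V" "V \<subseteq> U"
      "a \<in> carrier R" "s \<in> carrier R" "\<forall>Q\<in>V. s \<notin> Q \<and> \<sigma> Q = frac_at R Q a s"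
    using assms unfolding spec_sections_def mem_Collect_eq by (elim conjE) (drule bspec, assumption, elim exE conjE, simp)
  obtain g where "g \<in> carrier R" "P \<in> spec_basic R g" "spec_basic R g \<subseteq> V"
    using spec_basic_base[OF V(1,2)] .
  then show ?thesis using V that[of g a s] by auto
qed

text \<open>Sections are easier to handle when the neighbourhoods on which they are fractions are basic: basic
sets are closed under intersection, with \<open>D(g) \<inter> D(h) = D(gh)\<close>.\<close>

lemma spec_sectionsI:
  assumes "U \<subseteq> Spec R" "\<sigma> \<in> extensional U"
    and loc: "\<And>P. P \<in> U \<Longrightarrow> \<exists>g a s. g \<in> carrier R \<and> P \<in> spec_basic R g \<and> spec_basic R g \<subseteq> U \<and>
      a \<in> carrier R \<and> s \<in> carrier R \<and> (\<forall>Q\<in>spec_basic R g. s \<notin> Q \<and> \<sigma> Q = frac_at R Q a s)"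
  shows "\<sigma> \<in> spec_sections R U"
proof -
  have "\<sigma> P \<in> carrier (local_ring_at R P)" if P: "P \<in> U" for P
  proof -
    obtain g a s where "P \<in> spec_basic R g" "a \<in> carrier R" "s \<in> carrier R"
      "\<forall>Q\<in>spec_basic R g. s \<notin> Q \<and> \<sigma> Q = frac_at R Q a s" using loc[OF P] by auto
    then show ?thesis using P assms(1)
      fraction_in_localization[OF submonoid_prime_complement, of P a s] by auto
  qed
  moreover have "\<exists>V a s. openin (zariski_topology R) V \<and> P \<in> V \<and> V \<subseteq> U \<and> a \<in> carrier R \<and>
      s \<in> carrier R \<and> (\<forall>Q\<in>V. s \<notin> Q \<and> \<sigma> Q = frac_at R Q a s)" if P: "P \<in> U" for P
    using loc[OF P] openin_spec_basic by metis
  ultimately show ?thesis using assms(2) unfolding spec_sections_def by (simp add: PiE_iff)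
qed

text \<open>Equality in each localization at a prime provides a multiplier depending on the prime; the
annihilator argument replaces all of them by one power of \<open>g\<close>.\<close>

lemma fractions_agree:
  assumes car: "a \<in> carrier R" "b \<in> carrier R" "s \<in> carrier R" "t \<in> carrier R" "g \<in> carrier R"
    and eq: "\<And>P. P \<in> spec_basic R g \<Longrightarrow> s \<notin> P \<and> t \<notin> P \<and> frac_at R P a s = frac_at R P b t"
  obtains n :: nat where "g [^] n \<otimes> (a \<otimes> t) = g [^] n \<otimes> (b \<otimes> s)"
proof -
  have "\<exists>u\<in>carrier R - P. u \<otimes> (a \<otimes> t \<ominus> b \<otimes> s) = \<zero>" if prime: "P \<in> Spec R" "g \<notin> P" for P
  proof -
    have P: "s \<in> carrier R - P" "t \<in> carrier R - P" "frac_at R P a s = frac_at R P b t"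
      using eq[of P] that car by (auto simp: spec_basic_def)
    then obtain u where u: "u \<in> carrier R - P" "u \<otimes> (a \<otimes> t) = u \<otimes> (b \<otimes> s)"
      using fraction_eq_iff[OF submonoid_prime_complement[OF prime(1)] car(1,2) P(1,2)] by auto
    have "u \<otimes> (a \<otimes> t \<ominus> b \<otimes> s) = u \<otimes> (a \<otimes> t) \<ominus> u \<otimes> (b \<otimes> s)"
      using car u(1) by (simp add: minus_eq r_distr r_minus)
    also have "\<dots> = \<zero>" using car u by (simp add: minus_eq r_neg)
    finally show ?thesis using u(1) by blast
  qed
  then obtain n :: nat where n: "g [^] n \<otimes> (a \<otimes> t \<ominus> b \<otimes> s) = \<zero>"
    using annihilated_by_power[of g "a \<otimes> t \<ominus> b \<otimes> s"] car by auto
  have "g [^] n \<otimes> (a \<otimes> t) = g [^] n \<otimes> (a \<otimes> t \<ominus> b \<otimes> s) \<oplus> g [^] n \<otimes> (b \<otimes> s)"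
    using car by (simp add: minus_eq r_distr[symmetric] a_assoc l_neg)
  then show ?thesis using that[of n] car n by simp
qed

text \<open>A partition of unity for two elements: some power of \<open>h \<oplus> k\<close> lies in the ideal generated by
\<open>h ^ p\<close> and \<open>k ^ q\<close>. A double induction avoids binomial coefficients.\<close>

lemma power_sum_split:
  assumes h: "h \<in> carrier R" and k: "k \<in> carrier R"
  shows "\<exists>c\<in>carrier R. \<exists>d\<in>carrier R. (h \<oplus> k) [^] (p + q :: nat) = c \<otimes> h [^] p \<oplus> d \<otimes> k [^] q"
proof (induction p arbitrary: q)
  case 0
  have "(h \<oplus> k) [^] (0 + q) = (h \<oplus> k) [^] q \<otimes> h [^] (0::nat) \<oplus> \<zero> \<otimes> k [^] q" using h k by simp
  then show ?case using h k by (intro bexI[of _ "(h \<oplus> k) [^] q"] bexI[of _ \<zero>]) auto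
next
  case (Suc p)
  note IHp = Suc.IH
  show ?case
  proof (induction q)
    case 0
    have "(h \<oplus> k) [^] (Suc p + 0) = \<zero> \<otimes> h [^] Suc p \<oplus> (h \<oplus> k) [^] Suc p \<otimes> k [^] (0::nat)"
      using h k by simp
    then show ?case using h k by (intro bexI[of _ \<zero>] bexI[of _ "(h \<oplus> k) [^] Suc p"]) auto
  next
    case (Suc q)
    obtain c d where cd: "c \<in> carrier R" "d \<in> carrier R"
      "(h \<oplus> k) [^] (p + Suc q) = c \<otimes> h [^] p \<oplus> d \<otimes> k [^] Suc q"
      using IHp[of "Suc q"] by blast
    obtain c' d' where cd': "c' \<in> carrier R" "d' \<in> carrier R"
      "(h \<oplus> k) [^] (Suc p + q) = c' \<otimes> h [^] Suc p \<oplus> d' \<otimes> k [^] q" using Suc.IH by blast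
    have [simp]: "h [^] p \<in> carrier R" "k [^] q \<in> carrier R" using h k by simp_all
    have "(h \<oplus> k) [^] (Suc p + Suc q) = (h \<oplus> k) [^] (p + Suc q) \<otimes> h \<oplus> (h \<oplus> k) [^] (Suc p + q) \<otimes> k"
      using h k by (simp add: r_distr)
    also have "\<dots> = (c \<otimes> h [^] p \<oplus> d \<otimes> (k [^] q \<otimes> k)) \<otimes> h \<oplus> (c' \<otimes> (h [^] p \<otimes> h) \<oplus> d' \<otimes> k [^] q) \<otimes> k"
      unfolding cd(3) cd'(3) by simp
    also have "\<dots> = (c \<oplus> c' \<otimes> k) \<otimes> (h [^] p \<otimes> h) \<oplus> (d \<otimes> h \<oplus> d') \<otimes> (k [^] q \<otimes> k)"
      using h k cd(1,2) cd'(1,2) \<open>h [^] p \<in> carrier R\<close> \<open>k [^] q \<in> carrier R\<close> by algebra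
    finally have "(h \<oplus> k) [^] (Suc p + Suc q) = (c \<oplus> c' \<otimes> k) \<otimes> h [^] Suc p \<oplus> (d \<otimes> h \<oplus> d') \<otimes> k [^] Suc q"
      by simp
    then show ?case using h k cd(1,2) cd'(1,2) by (intro bexI[of _ "c \<oplus> c' \<otimes> k"] bexI[of _ "d \<otimes> h \<oplus> d'"]) auto
  qed
qed

text \<open>The equality \<open>\<Gamma>(D(g)) = B_g\<close>, more precisely its surjectivity part. Instead of extracting a finite
subcover, consider the set \<open>J\<close> of all \<open>h\<close> such that the section is a fraction \<open>a / h ^ n\<close> on
\<open>D(h)\<close>. Gluing over the two sets \<open>D(h)\<close> and \<open>D(k)\<close>, which cover \<open>D(h \<oplus> k)\<close>, shows that \<open>J\<close> is
an ideal. If it contained no power of \<open>g\<close>, a prime in \<open>D(g)\<close> would contain \<open>J\<close>, although the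
section is a fraction in a neighbourhood of that prime.\<close>

lemma section_on_basic_open:
  assumes \<sigma>: "\<sigma> \<in> spec_sections R U" and g: "g \<in> carrier R" "spec_basic R g \<subseteq> U"
  obtains n :: nat and a where "a \<in> carrier R"
    "\<And>P. P \<in> spec_basic R g \<Longrightarrow> \<sigma> P = frac_at R P a (g [^] n)"
proof -
  define J where "J = {h \<in> carrier R. spec_basic R h \<subseteq> U \<and>
    (\<exists>n::nat. \<exists>a\<in>carrier R. \<forall>P\<in>spec_basic R h. \<sigma> P = frac_at R P a (h [^] n))}"
  have "ideal J R"
  proof (rule ideal_of_closed)
    show "J \<subseteq> carrier R" by (auto simp: J_def)
    have "spec_basic R \<zero> = {}" by (auto simp: spec_basic_def prime_zero)
    then show "\<zero> \<in> J" by (auto simp: J_def)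
  next
    fix h r assume "h \<in> J" and r: "r \<in> carrier R"
    then obtain n :: nat and a where h: "h \<in> carrier R" "spec_basic R h \<subseteq> U" and a: "a \<in> carrier R"
      "\<And>P. P \<in> spec_basic R h \<Longrightarrow> \<sigma> P = frac_at R P a (h [^] n)"
      unfolding J_def by blast
    have "\<sigma> P = frac_at R P (r [^] n \<otimes> a) ((r \<otimes> h) [^] n)" if P: "P \<in> spec_basic R (r \<otimes> h)" for P
    proof -
      have P': "P \<in> Spec R" "P \<in> spec_basic R h" "h \<notin> P" "r \<notin> P"
        using P r h spec_basic_mult by (auto simp: spec_basic_def)
      have "a \<otimes> (r \<otimes> h) [^] n = (r [^] n \<otimes> a) \<otimes> h [^] n"
        using r h a by (simp add: nat_pow_distrib m_ac)
      then show ?thesis unfolding a(2)[OF P'(2)]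
        using P' r h a by (intro frac_at_eqI) (auto simp: prime_power prime_mult_iff)
    qed
    then show "r \<otimes> h \<in> J" using r h a spec_basic_mult[of r h] unfolding J_def by blast
  next
    fix h k assume "h \<in> J" "k \<in> J"
    then obtain n m :: nat and a b where h: "h \<in> carrier R" "spec_basic R h \<subseteq> U"
      and k: "k \<in> carrier R" "spec_basic R k \<subseteq> U"
      and a: "a \<in> carrier R" "\<And>P. P \<in> spec_basic R h \<Longrightarrow> \<sigma> P = frac_at R P a (h [^] n)"
      and b: "b \<in> carrier R" "\<And>P. P \<in> spec_basic R k \<Longrightarrow> \<sigma> P = frac_at R P b (k [^] m)"
      unfolding J_def by blast
    have "h [^] n \<notin> P \<and> k [^] m \<notin> P \<and> frac_at R P a (h [^] n) = frac_at R P b (k [^] m)"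
      if "P \<in> spec_basic R (h \<otimes> k)" for P
    proof -
      have "P \<in> spec_basic R h" "P \<in> spec_basic R k" using that h k spec_basic_mult by auto
      then show ?thesis using a(2)[of P] b(2)[of P] h k by (simp add: spec_basic_def prime_power)
    qed
    then obtain N :: nat where N:
      "(h \<otimes> k) [^] N \<otimes> (a \<otimes> k [^] m) = (h \<otimes> k) [^] N \<otimes> (b \<otimes> h [^] n)"
      using fractions_agree[of a b "h [^] n" "k [^] m" "h \<otimes> k"] a b h k by auto
    \<comment> \<open>Enlarging both fractions by \<open>N\<close>-th powers turns \<open>a k ^ m \<sim> b h ^ n\<close> into an exact equation \<open>A K = C H\<close>.\<close>
    define A where "A = a \<otimes> h [^] N"
    define C where "C = b \<otimes> k [^] N"
    define H where "H = h [^] (n + N)"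
    define K where "K = k [^] (m + N)"
    have car: "A \<in> carrier R" "C \<in> carrier R" "H \<in> carrier R" "K \<in> carrier R"
      using a b h k by (simp_all add: A_def C_def H_def K_def)
    have AK: "A \<otimes> K = C \<otimes> H"
    proof -
      have "A \<otimes> K = (h \<otimes> k) [^] N \<otimes> (a \<otimes> k [^] m)"
        using a h k by (simp add: A_def K_def nat_pow_mult[symmetric] nat_pow_distrib m_ac)
      also have "\<dots> = C \<otimes> H" unfolding N
        using b h k by (simp add: C_def H_def nat_pow_mult[symmetric] nat_pow_distrib m_ac)
      finally show ?thesis .
    qed
    obtain c d where cd: "c \<in> carrier R" "d \<in> carrier R"
      "(h \<oplus> k) [^] ((n + N) + (m + N)) = c \<otimes> H \<oplus> d \<otimes> K"
      using power_sum_split[OF h(1) k(1), of "n + N" "m + N"] unfolding H_def K_def by blast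
    \<comment> \<open>With \<open>(h \<oplus> k) ^ M = c H \<oplus> d K\<close>, the fraction \<open>(c A \<oplus> d C) / (h \<oplus> k) ^ M\<close> equals \<open>A / H\<close> and \<open>C / K\<close>.\<close>
    have sub: "spec_basic R (h \<oplus> k) \<subseteq> spec_basic R h \<union> spec_basic R k"
      by (auto simp: spec_basic_def prime_add)
    have "\<sigma> P = frac_at R P (c \<otimes> A \<oplus> d \<otimes> C) ((h \<oplus> k) [^] ((n + N) + (m + N)))"
      if P: "P \<in> spec_basic R (h \<oplus> k)" for P
    proof -
      have P1: "P \<in> Spec R" "(h \<oplus> k) [^] ((n + N) + (m + N)) \<notin> P"
        using P h k prime_power[of P "h \<oplus> k"] by (auto simp: spec_basic_def)
      from P sub consider "P \<in> spec_basic R h" | "P \<in> spec_basic R k" by blast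
      then show ?thesis
      proof cases
        case 1
        then have hP: "h \<notin> P" by (simp add: spec_basic_def)
        have "a \<otimes> H = A \<otimes> h [^] n"
          using a h by (simp add: A_def H_def nat_pow_mult[symmetric] m_ac)
        then have "\<sigma> P = frac_at R P A H" unfolding a(2)[OF 1] using P1 a h car hP
          by (intro frac_at_eqI) (auto simp: H_def prime_power)
        also have "\<dots> = frac_at R P (c \<otimes> A \<oplus> d \<otimes> C) ((h \<oplus> k) [^] ((n + N) + (m + N)))"
        proof (rule frac_at_eqI)
          have "A \<otimes> (h \<oplus> k) [^] ((n + N) + (m + N)) = c \<otimes> A \<otimes> H \<oplus> d \<otimes> (A \<otimes> K)"
            unfolding cd(3) using car cd(1,2) by algebra
          also have "\<dots> = (c \<otimes> A \<oplus> d \<otimes> C) \<otimes> H" unfolding AK using car cd(1,2) by algebra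
          finally show "A \<otimes> (h \<oplus> k) [^] ((n + N) + (m + N)) = (c \<otimes> A \<oplus> d \<otimes> C) \<otimes> H" .
          show "H \<notin> P" using P1 h hP by (simp add: H_def prime_power)
        qed (use P1 car cd(1,2) h k in auto)
        finally show ?thesis .
      next
        case 2
        then have kP: "k \<notin> P" by (simp add: spec_basic_def)
        have "b \<otimes> K = C \<otimes> k [^] m"
          using b k by (simp add: C_def K_def nat_pow_mult[symmetric] m_ac)
        then have "\<sigma> P = frac_at R P C K" unfolding b(2)[OF 2] using P1 b k car kP
          by (intro frac_at_eqI) (auto simp: K_def prime_power)
        also have "\<dots> = frac_at R P (c \<otimes> A \<oplus> d \<otimes> C) ((h \<oplus> k) [^] ((n + N) + (m + N)))"
        proof (rule frac_at_eqI)
          have "C \<otimes> (h \<oplus> k) [^] ((n + N) + (m + N)) = c \<otimes> (C \<otimes> H) \<oplus> d \<otimes> C \<otimes> K"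
            unfolding cd(3) using car cd(1,2) by algebra
          also have "\<dots> = (c \<otimes> A \<oplus> d \<otimes> C) \<otimes> K" unfolding AK[symmetric] using car cd(1,2) by algebra
          finally show "C \<otimes> (h \<oplus> k) [^] ((n + N) + (m + N)) = (c \<otimes> A \<oplus> d \<otimes> C) \<otimes> K" .
          show "K \<notin> P" using P1 k kP by (simp add: K_def prime_power)
        qed (use P1 car cd(1,2) h k in auto)
        finally show ?thesis .
      qed
    qed
    moreover have "c \<otimes> A \<oplus> d \<otimes> C \<in> carrier R" using car cd by simp
    ultimately show "h \<oplus> k \<in> J" using h k sub unfolding J_def by blast
  qed
  have "g \<in> J"
  proof (rule ccontr)
    assume "g \<notin> J"
    have "g [^] n \<notin> J" for n :: nat
    proof
      assume "g [^] n \<in> J"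
      then obtain m :: nat and a where a: "a \<in> carrier R"
        "\<forall>P\<in>spec_basic R (g [^] n). \<sigma> P = frac_at R P a ((g [^] n) [^] m)" unfolding J_def by blast
      then have "\<forall>P\<in>spec_basic R g. \<sigma> P = frac_at R P a (g [^] (n * m))"
        using g(1) by (auto simp: spec_basic_def prime_power nat_pow_pow)
      then show False using \<open>g \<notin> J\<close> g a unfolding J_def by blast
    qed
    then obtain P where P: "P \<in> Spec R" "J \<subseteq> P" "g \<notin> P"
      using prime_avoiding_powers[OF \<open>ideal J R\<close> g(1)] by metis
    then have PU: "P \<in> U" using g(2) by (auto simp: spec_basic_def)
    obtain e a s where e: "e \<in> carrier R" "P \<in> spec_basic R e" "spec_basic R e \<subseteq> U"
      and V: "a \<in> carrier R" "s \<in> carrier R"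
        "\<And>Q. Q \<in> spec_basic R e \<Longrightarrow> s \<notin> Q \<and> \<sigma> Q = frac_at R Q a s"
      by (rule spec_sections_local[OF \<sigma> PU]) (rule that)
    have eP: "e \<notin> P" using e(2) by (simp add: spec_basic_def)
    have "\<sigma> Q = frac_at R Q (a \<otimes> e) ((e \<otimes> s) [^] (1::nat))" if Q: "Q \<in> spec_basic R (e \<otimes> s)" for Q
    proof -
      have Q': "Q \<in> spec_basic R e" "Q \<in> Spec R" "e \<otimes> s \<notin> Q"
        using Q e V spec_basic_mult[of e s] by (auto simp: spec_basic_def)
      have "frac_at R Q a s = frac_at R Q (a \<otimes> e) ((e \<otimes> s) [^] (1::nat))"
        using Q' V e by (intro frac_at_eqI) (auto simp: m_ac)
      then show ?thesis using V(3)[OF Q'(1)] by simp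
    qed
    moreover have "spec_basic R (e \<otimes> s) \<subseteq> U" using e V spec_basic_mult by blast
    moreover have "a \<otimes> e \<in> carrier R" "e \<otimes> s \<in> carrier R" using e V by simp_all
    ultimately have "e \<otimes> s \<in> J" unfolding J_def by blast
    then show False using P(2) prime_mult_iff[OF P(1) e(1) V(2)] eP V(3)[OF e(2)] by blast
  qed
  then show ?thesis using that unfolding J_def by blast
qed

lemma near_fractionI:
  assumes "g \<in> carrier R" "P \<in> spec_basic R g" "spec_basic R g \<subseteq> U" "a \<in> carrier R" "s \<in> carrier R"
    "\<And>Q. Q \<in> spec_basic R g \<Longrightarrow> s \<notin> Q \<and> \<sigma> Q = frac_at R Q a s"
  shows "\<exists>g a s. g \<in> carrier R \<and> P \<in> spec_basic R g \<and> spec_basic R g \<subseteq> U \<and>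
      a \<in> carrier R \<and> s \<in> carrier R \<and> (\<forall>Q\<in>spec_basic R g. s \<notin> Q \<and> \<sigma> Q = frac_at R Q a s)"
  using assms by blast

text \<open>Common form of the closure of sections under addition, multiplication and negation: an operation on
the stalks that acts on fractions by a fixed formula with denominator \<open>s \<otimes> t\<close>, uniformly in the
prime, preserves being locally a fraction.\<close>

lemma spec_sections_pointwise:
  assumes U: "U \<subseteq> Spec R" and \<sigma>: "\<sigma> \<in> spec_sections R U" and \<tau>: "\<tau> \<in> spec_sections R U"
    and closed: "\<And>a s b t. \<lbrakk>a \<in> carrier R; s \<in> carrier R; b \<in> carrier R; t \<in> carrier R\<rbrakk>
      \<Longrightarrow> num a s b t \<in> carrier R"
    and op: "\<And>P a s b t. \<lbrakk>P \<in> Spec R; a \<in> carrier R; s \<in> carrier R - P; b \<in> carrier R; t \<in> carrier R - P\<rbrakk>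
      \<Longrightarrow> op P (frac_at R P a s) (frac_at R P b t) = frac_at R P (num a s b t) (s \<otimes> t)"
  shows "(\<lambda>P\<in>U. op P (\<sigma> P) (\<tau> P)) \<in> spec_sections R U"
proof (rule spec_sectionsI[OF U])
  fix P assume P: "P \<in> U"
  obtain g a s where g: "g \<in> carrier R" "P \<in> spec_basic R g" "spec_basic R g \<subseteq> U"
    "a \<in> carrier R" "s \<in> carrier R" "\<And>Q. Q \<in> spec_basic R g \<Longrightarrow> s \<notin> Q \<and> \<sigma> Q = frac_at R Q a s"
    by (rule spec_sections_local[OF \<sigma> P]) (rule that)
  obtain h b t where h: "h \<in> carrier R" "P \<in> spec_basic R h" "spec_basic R h \<subseteq> U"
    "b \<in> carrier R" "t \<in> carrier R" "\<And>Q. Q \<in> spec_basic R h \<Longrightarrow> t \<notin> Q \<and> \<tau> Q = frac_at R Q b t"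
    by (rule spec_sections_local[OF \<tau> P]) (rule that)
  have gh: "spec_basic R (g \<otimes> h) = spec_basic R g \<inter> spec_basic R h"
    using g h by (simp add: spec_basic_mult)
  have "\<forall>Q\<in>spec_basic R (g \<otimes> h). s \<otimes> t \<notin> Q \<and>
      (\<lambda>P\<in>U. op P (\<sigma> P) (\<tau> P)) Q = frac_at R Q (num a s b t) (s \<otimes> t)"
  proof
    fix Q assume "Q \<in> spec_basic R (g \<otimes> h)"
    then have Q: "Q \<in> spec_basic R g" "Q \<in> spec_basic R h" "Q \<in> U" "Q \<in> Spec R"
      using gh g(3) U by auto
    show "s \<otimes> t \<notin> Q \<and> (\<lambda>P\<in>U. op P (\<sigma> P) (\<tau> P)) Q = frac_at R Q (num a s b t) (s \<otimes> t)"
      using g(4,5) h(4,5) g(6)[OF Q(1)] h(6)[OF Q(2)] Q op[of Q a s b t] by (simp add: prime_mult_iff)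
  qed
  moreover have "P \<in> spec_basic R (g \<otimes> h)" "spec_basic R (g \<otimes> h) \<subseteq> U" using g h gh by auto
  moreover have "num a s b t \<in> carrier R" by (rule closed) fact+
  ultimately show "\<exists>g a s. g \<in> carrier R \<and> P \<in> spec_basic R g \<and> spec_basic R g \<subseteq> U \<and>
      a \<in> carrier R \<and> s \<in> carrier R \<and>
      (\<forall>Q\<in>spec_basic R g. s \<notin> Q \<and> (\<lambda>P\<in>U. op P (\<sigma> P) (\<tau> P)) Q = frac_at R Q a s)"
    using g(1,4,5) h(1,4,5) near_fractionI[of "g \<otimes> h" P U "num a s b t" "s \<otimes> t"] by auto
qed simp

lemma local_ring_cring: "P \<in> Spec R \<Longrightarrow> cring (local_ring_at R P)"
  by (intro localization_cring submonoid_prime_complement)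

lemma spec_sections_value:
  "\<sigma> \<in> spec_sections R U \<Longrightarrow> P \<in> U \<Longrightarrow> \<sigma> P \<in> carrier (local_ring_at R P)"
  unfolding spec_sections_def by auto

lemma fraction_section:
  assumes U: "openin (zariski_topology R) U" and "a \<in> carrier R" "s \<in> carrier R"
    and "\<And>P. P \<in> U \<Longrightarrow> s \<notin> P"
  shows "(\<lambda>P\<in>U. frac_at R P a s) \<in> spec_sections R U"
proof (rule spec_sectionsI)
  show "U \<subseteq> Spec R"
    using openin_subset[OF U] topspace_zariski_topology[OF is_cring] by simp
  fix P assume P: "P \<in> U"
  obtain g where "g \<in> carrier R" "P \<in> spec_basic R g" "spec_basic R g \<subseteq> U"
    using spec_basic_base[OF U P] .
  then show "\<exists>g b t. g \<in> carrier R \<and> P \<in> spec_basic R g \<and> spec_basic R g \<subseteq> U \<and> b \<in> carrier R \<and>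
      t \<in> carrier R \<and> (\<forall>Q\<in>spec_basic R g. t \<notin> Q \<and> (\<lambda>P\<in>U. frac_at R P a s) Q = frac_at R Q b t)"
    using assms by (intro near_fractionI[of g P U a s]) auto
qed simp

lemma structure_sheaf_cring:
  assumes U: "openin (zariski_topology R) U"
  shows "cring (sections (structure_sheaf R) U)" (is "cring ?S")
proof -
  have US: "U \<subseteq> Spec R"
    using openin_subset[OF U] topspace_zariski_topology[OF is_cring] by simp
  have car: "carrier ?S = spec_sections R U"
    and mult: "\<sigma> \<otimes>\<^bsub>?S\<^esub> \<tau> = (\<lambda>P\<in>U. \<sigma> P \<otimes>\<^bsub>local_ring_at R P\<^esub> \<tau> P)"
    and add: "\<sigma> \<oplus>\<^bsub>?S\<^esub> \<tau> = (\<lambda>P\<in>U. \<sigma> P \<oplus>\<^bsub>local_ring_at R P\<^esub> \<tau> P)"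
    and one: "\<one>\<^bsub>?S\<^esub> = (\<lambda>P\<in>U. frac_at R P \<one> \<one>)"
    and zero: "\<zero>\<^bsub>?S\<^esub> = (\<lambda>P\<in>U. frac_at R P \<zero> \<one>)" for \<sigma> \<tau>
    by (simp_all add: structure_sheaf_def localization_def)
  have one': "frac_at R P \<one> \<one> = \<one>\<^bsub>local_ring_at R P\<^esub>"
    and zero': "frac_at R P \<zero> \<one> = \<zero>\<^bsub>local_ring_at R P\<^esub>" for P
    by (simp_all add: localization_def)
  have loc: "cring (local_ring_at R P)" if "P \<in> U" for P
    using that US by (intro local_ring_cring) auto
  note val = spec_sections_value
  have ext: "\<sigma> = \<tau>" if "\<sigma> \<in> extensional U" "\<tau> \<in> extensional U" "\<And>P. P \<in> U \<Longrightarrow> \<sigma> P = \<tau> P"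
    for \<sigma> \<tau> :: "'a set \<Rightarrow> ('a \<times> 'a) set" using that by (rule extensionalityI)
  have sec_ext: "\<sigma> \<in> extensional U" if "\<sigma> \<in> spec_sections R U" for \<sigma>
    using that by (auto simp: spec_sections_def PiE_def)
  show ?thesis
  proof (intro cringI abelian_groupI comm_monoidI; (unfold car)?)
    fix \<sigma> \<tau> assume st: "\<sigma> \<in> spec_sections R U" "\<tau> \<in> spec_sections R U"
    show "\<sigma> \<oplus>\<^bsub>?S\<^esub> \<tau> \<in> spec_sections R U" unfolding add
      by (rule spec_sections_pointwise[OF US st, where num = "\<lambda>a s b t. a \<otimes> t \<oplus> b \<otimes> s"
          and op = "\<lambda>P x y. x \<oplus>\<^bsub>local_ring_at R P\<^esub> y"])
        (simp_all add: fraction_add[OF submonoid_prime_complement])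
    show "\<sigma> \<otimes>\<^bsub>?S\<^esub> \<tau> \<in> spec_sections R U" unfolding mult
      by (rule spec_sections_pointwise[OF US st, where num = "\<lambda>a s b t. a \<otimes> b"
          and op = "\<lambda>P x y. x \<otimes>\<^bsub>local_ring_at R P\<^esub> y"])
        (simp_all add: fraction_mult[OF submonoid_prime_complement])
    show "\<sigma> \<oplus>\<^bsub>?S\<^esub> \<tau> = \<tau> \<oplus>\<^bsub>?S\<^esub> \<sigma>" unfolding add
      by (rule restrict_ext) (simp add: cring.cring_simprules(10)[OF loc] val[OF st(1)] val[OF st(2)])
    show "\<sigma> \<otimes>\<^bsub>?S\<^esub> \<tau> = \<tau> \<otimes>\<^bsub>?S\<^esub> \<sigma>" unfolding mult
      by (rule restrict_ext) (simp add: cring.cring_simprules(14)[OF loc] val[OF st(1)] val[OF st(2)])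
    fix \<upsilon> assume u: "\<upsilon> \<in> spec_sections R U"
    show "\<sigma> \<oplus>\<^bsub>?S\<^esub> \<tau> \<oplus>\<^bsub>?S\<^esub> \<upsilon> = \<sigma> \<oplus>\<^bsub>?S\<^esub> (\<tau> \<oplus>\<^bsub>?S\<^esub> \<upsilon>)" unfolding add
      by (rule restrict_ext) (simp add: cring.cring_simprules(7)[OF loc] val[OF st(1)] val[OF st(2)] val[OF u])
    show "\<sigma> \<otimes>\<^bsub>?S\<^esub> \<tau> \<otimes>\<^bsub>?S\<^esub> \<upsilon> = \<sigma> \<otimes>\<^bsub>?S\<^esub> (\<tau> \<otimes>\<^bsub>?S\<^esub> \<upsilon>)" unfolding mult
      by (rule restrict_ext) (simp add: cring.cring_simprules(11)[OF loc] val[OF st(1)] val[OF st(2)] val[OF u])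
    show "(\<sigma> \<oplus>\<^bsub>?S\<^esub> \<tau>) \<otimes>\<^bsub>?S\<^esub> \<upsilon> = \<sigma> \<otimes>\<^bsub>?S\<^esub> \<upsilon> \<oplus>\<^bsub>?S\<^esub> \<tau> \<otimes>\<^bsub>?S\<^esub> \<upsilon>" unfolding mult add
      by (rule restrict_ext) (simp add: cring.cring_simprules(13)[OF loc] val[OF st(1)] val[OF st(2)] val[OF u])
  next
    show "\<zero>\<^bsub>?S\<^esub> \<in> spec_sections R U" "\<one>\<^bsub>?S\<^esub> \<in> spec_sections R U" unfolding zero one
      using US prime_one by (auto intro!: fraction_section[OF U])
  next
    fix \<sigma> assume s: "\<sigma> \<in> spec_sections R U"
    show "\<zero>\<^bsub>?S\<^esub> \<oplus>\<^bsub>?S\<^esub> \<sigma> = \<sigma>" unfolding add zero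
      by (rule ext[OF _ sec_ext[OF s]]) (simp_all add: zero' cring.cring_simprules(8)[OF loc] val[OF s])
    show "\<one>\<^bsub>?S\<^esub> \<otimes>\<^bsub>?S\<^esub> \<sigma> = \<sigma>" unfolding mult one
      by (rule ext[OF _ sec_ext[OF s]]) (simp_all add: one' cring.cring_simprules(12)[OF loc] val[OF s])
    have minus: "(\<lambda>P\<in>U. \<ominus>\<^bsub>local_ring_at R P\<^esub> \<sigma> P) \<in> spec_sections R U"
    proof (rule spec_sections_pointwise[OF US s s, where num = "\<lambda>a s b t. (\<ominus> a) \<otimes> t"
        and op = "\<lambda>P x y. \<ominus>\<^bsub>local_ring_at R P\<^esub> x"])
      fix P a s b t assume *: "P \<in> Spec R" "a \<in> carrier R" "s \<in> carrier R - P" "b \<in> carrier R" "t \<in> carrier R - P"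
      then have "\<ominus>\<^bsub>local_ring_at R P\<^esub> frac_at R P a s = frac_at R P (\<ominus> a) s"
        by (intro fraction_minus submonoid_prime_complement)
      also have "\<dots> = frac_at R P ((\<ominus> a) \<otimes> t) (s \<otimes> t)"
        using * by (intro frac_at_eqI) (auto simp: m_ac prime_mult_iff)
      finally show "\<ominus>\<^bsub>local_ring_at R P\<^esub> frac_at R P a s = frac_at R P ((\<ominus> a) \<otimes> t) (s \<otimes> t)" .
    qed simp
    show "\<exists>\<tau>\<in>spec_sections R U. \<tau> \<oplus>\<^bsub>?S\<^esub> \<sigma> = \<zero>\<^bsub>?S\<^esub>"
      by (rule bexI[OF _ minus], unfold add zero, rule restrict_ext)
        (simp add: zero' cring.cring_simprules(9)[OF loc] val[OF s])
  qed
qed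

lemma spec_sections_restrict:
  assumes "\<sigma> \<in> spec_sections R U" "openin (zariski_topology R) V" "V \<subseteq> U"
  shows "restrict \<sigma> V \<in> spec_sections R V"
proof (rule spec_sectionsI)
  show "V \<subseteq> Spec R"
    using openin_subset[OF assms(2)] topspace_zariski_topology[OF is_cring] by simp
  fix P assume P: "P \<in> V"
  obtain g a s where g: "g \<in> carrier R" "P \<in> spec_basic R g" "spec_basic R g \<subseteq> U"
    "a \<in> carrier R" "s \<in> carrier R" "\<And>Q. Q \<in> spec_basic R g \<Longrightarrow> s \<notin> Q \<and> \<sigma> Q = frac_at R Q a s"
    by (rule spec_sections_local[OF assms(1), of P]) (use P assms(3) that in auto)
  obtain h where h: "h \<in> carrier R" "P \<in> spec_basic R h" "spec_basic R h \<subseteq> V"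
    using spec_basic_base[OF assms(2) P] .
  show "\<exists>g a s. g \<in> carrier R \<and> P \<in> spec_basic R g \<and> spec_basic R g \<subseteq> V \<and> a \<in> carrier R \<and>
      s \<in> carrier R \<and> (\<forall>Q\<in>spec_basic R g. s \<notin> Q \<and> restrict \<sigma> V Q = frac_at R Q a s)"
    using g h by (intro near_fractionI[of "g \<otimes> h" P V a s]) (auto simp: spec_basic_mult)
qed simp

lemma structure_sheaf_ringed_space: "ringed_space (zariski_topology R) (structure_sheaf R)"
proof -
  let ?Z = "zariski_topology R" and ?O = "structure_sheaf R"
  have car: "carrier (sections ?O U) = spec_sections R U" for U by (simp add: structure_sheaf_def)
  have res: "restr ?O U V \<sigma> = restrict \<sigma> V" for U V \<sigma> by (simp add: structure_sheaf_def)
  have sec_ext: "\<sigma> \<in> extensional U" if "\<sigma> \<in> spec_sections R U" for \<sigma> U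
    using that by (auto simp: spec_sections_def PiE_def)
  have sub: "U \<subseteq> Spec R" if "openin ?Z U" for U
    using openin_subset[OF that] topspace_zariski_topology[OF is_cring] by simp
  show ?thesis
  proof (intro ringed_space.intro ring_presheaf_on.intro ringed_space_axioms.intro)
    show "cring (sections ?O U)" if "openin ?Z U" for U using structure_sheaf_cring[OF that] .
    show "restr ?O U V \<in> ring_hom (sections ?O U) (sections ?O V)"
      if "openin ?Z U" "openin ?Z V" "V \<subseteq> U" for U V
    proof (rule ring_hom_memI)
      fix \<sigma> \<tau> assume "\<sigma> \<in> carrier (sections ?O U)" "\<tau> \<in> carrier (sections ?O U)"
      then show "restr ?O U V \<sigma> \<in> carrier (sections ?O V)"
        using that by (simp add: car res spec_sections_restrict)
      show "restr ?O U V (\<sigma> \<otimes>\<^bsub>sections ?O U\<^esub> \<tau>) = restr ?O U V \<sigma> \<otimes>\<^bsub>sections ?O V\<^esub> restr ?O U V \<tau>"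
        "restr ?O U V (\<sigma> \<oplus>\<^bsub>sections ?O U\<^esub> \<tau>) = restr ?O U V \<sigma> \<oplus>\<^bsub>sections ?O V\<^esub> restr ?O U V \<tau>"
        using that(3) by (auto simp: structure_sheaf_def restrict_def fun_eq_iff)
    next
      show "restr ?O U V \<one>\<^bsub>sections ?O U\<^esub> = \<one>\<^bsub>sections ?O V\<^esub>"
        using that(3) by (auto simp: structure_sheaf_def restrict_def fun_eq_iff)
    qed
    show "restr ?O U U s = s" if "openin ?Z U" "s \<in> carrier (sections ?O U)" for U s
      using that sec_ext[of s U] by (simp add: car res extensional_restrict)
    show "restr ?O V W (restr ?O U V s) = restr ?O U W s" if "W \<subseteq> V" for U V W s
      using that by (simp add: res Int_absorb1)
    fix \<U> :: "'a set set set" assume op: "\<forall>V\<in>\<U>. openin ?Z V"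
    show "s = t" if st: "s \<in> carrier (sections ?O (\<Union>\<U>))" "t \<in> carrier (sections ?O (\<Union>\<U>))"
      and eq: "\<forall>V\<in>\<U>. restr ?O (\<Union>\<U>) V s = restr ?O (\<Union>\<U>) V t" for s t
    proof (rule extensionalityI)
      show "s \<in> extensional (\<Union>\<U>)" "t \<in> extensional (\<Union>\<U>)" using st sec_ext by (simp_all add: car)
      fix P assume "P \<in> \<Union>\<U>"
      then obtain V where V: "V \<in> \<U>" "P \<in> V" by blast
      show "s P = t P" using fun_cong[OF bspec[OF eq V(1)], of P] V(2) by (simp add: res)
    qed
    fix \<sigma> assume sec: "\<forall>V\<in>\<U>. \<sigma> V \<in> carrier (sections ?O V)"
      and compat: "\<forall>V\<in>\<U>. \<forall>W\<in>\<U>. restr ?O V (V \<inter> W) (\<sigma> V) = restr ?O W (V \<inter> W) (\<sigma> W)"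
    define s where "s = (\<lambda>P\<in>\<Union>\<U>. \<sigma> (SOME V. V \<in> \<U> \<and> P \<in> V) P)"
    have s: "s P = \<sigma> V P" if V: "V \<in> \<U>" "P \<in> V" for V P
    proof -
      have *: "(SOME V. V \<in> \<U> \<and> P \<in> V) \<in> \<U>" "P \<in> (SOME V. V \<in> \<U> \<and> P \<in> V)"
        using someI[of "\<lambda>V. V \<in> \<U> \<and> P \<in> V" V] V by auto
      have "\<sigma> (SOME V. V \<in> \<U> \<and> P \<in> V) P = \<sigma> V P"
        using fun_cong[OF bspec[OF bspec[OF compat *(1)] V(1)], of P] *(2) V(2)
        unfolding res by simp
      then show ?thesis using V by (auto simp: s_def)
    qed
    have "s \<in> spec_sections R (\<Union>\<U>)"
    proof (rule spec_sectionsI)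
      show "\<Union>\<U> \<subseteq> Spec R" by (intro Union_least sub) (simp add: op)
      fix P assume "P \<in> \<Union>\<U>"
      then obtain V where V: "V \<in> \<U>" "P \<in> V" by blast
      obtain g a t where g: "g \<in> carrier R" "P \<in> spec_basic R g" "spec_basic R g \<subseteq> V"
        "a \<in> carrier R" "t \<in> carrier R" "\<And>Q. Q \<in> spec_basic R g \<Longrightarrow> t \<notin> Q \<and> \<sigma> V Q = frac_at R Q a t"
        by (rule spec_sections_local[of "\<sigma> V" V P]) (use V sec car that in auto)
      show "\<exists>g a t. g \<in> carrier R \<and> P \<in> spec_basic R g \<and> spec_basic R g \<subseteq> \<Union>\<U> \<and> a \<in> carrier R \<and>
          t \<in> carrier R \<and> (\<forall>Q\<in>spec_basic R g. t \<notin> Q \<and> s Q = frac_at R Q a t)"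
        using g V s[OF V(1)] by (intro near_fractionI[of g P "\<Union>\<U>" a t]) auto
    qed (simp add: s_def)
    moreover have "restrict s V = \<sigma> V" if V: "V \<in> \<U>" for V
      using sec_ext[of "\<sigma> V" V] sec V s[OF V] by (intro extensionalityI[of _ V]) (auto simp: car)
    ultimately show "\<exists>s\<in>carrier (sections ?O (\<Union>\<U>)). \<forall>V\<in>\<U>. restr ?O (\<Union>\<U>) V s = \<sigma> V"
      unfolding car res by blast
  qed
qed

end

section \<open>Direct images and stalks\<close>

lemma direct_image_ringed_space:
  assumes "ringed_space X F" and f: "continuous_map X Y f"
  shows "ringed_space Y (direct_image f X F)"
proof -
  interpret ringed_space X F by fact
  define pre where "pre V = {x \<in> topspace X. f x \<in> V}" for V
  have sec: "sections (direct_image f X F) V = sections F (pre V)"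
    and res: "restr (direct_image f X F) V W = restr F (pre V) (pre W)" for V W
    by (simp_all add: direct_image_def pre_def)
  have op: "openin X (pre V)" if "openin Y V" for V
    using openin_continuous_map_preimage[OF f that] by (simp add: pre_def)
  have mono: "pre W \<subseteq> pre V" if "W \<subseteq> V" for V W using that by (auto simp: pre_def)
  have Int: "pre (V \<inter> W) = pre V \<inter> pre W" for V W by (auto simp: pre_def)
  have Un: "pre (\<Union>\<U>) = \<Union>(pre ` \<U>)" for \<U> by (auto simp: pre_def)
  show ?thesis
  proof (intro ringed_space.intro ring_presheaf_on.intro ringed_space_axioms.intro; unfold sec res)
    fix \<U> assume \<U>: "\<forall>V\<in>\<U>. openin Y V"
    then have op': "\<forall>V\<in>pre ` \<U>. openin X V" using op by blast
    show "s = t" if "s \<in> carrier (sections F (pre (\<Union>\<U>)))" "t \<in> carrier (sections F (pre (\<Union>\<U>)))"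
      "\<forall>V\<in>\<U>. restr F (pre (\<Union>\<U>)) (pre V) s = restr F (pre (\<Union>\<U>)) (pre V) t" for s t
      using locality[OF op', of s t] that unfolding Un by auto
    fix \<sigma> assume \<sigma>: "\<forall>V\<in>\<U>. \<sigma> V \<in> carrier (sections F (pre V))"
      and compat: "\<forall>V\<in>\<U>. \<forall>W\<in>\<U>. restr F (pre V) (pre (V \<inter> W)) (\<sigma> V) = restr F (pre W) (pre (V \<inter> W)) (\<sigma> W)"
    \<comment> \<open>The cover of \<open>X\<close> is indexed by preimages, and distinct members of \<open>\<U>\<close> may have the same preimage.\<close>
    have self: "restr F (pre V) (pre V) (\<sigma> V) = \<sigma> V" if "V \<in> \<U>" for V
      using restr_id[of "pre V" "\<sigma> V"] that \<U> op \<sigma> by blast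
    have same: "\<sigma> V = \<sigma> W" if "V \<in> \<U>" "W \<in> \<U>" "pre V = pre W" for V W
      using bspec[OF bspec[OF compat that(1)] that(2)] that(3) self[OF that(1)] self[OF that(2)]
      by (simp add: Int)
    define \<tau> where "\<tau> P = \<sigma> (SOME V. V \<in> \<U> \<and> pre V = P)" for P
    have \<tau>: "\<tau> (pre V) = \<sigma> V" if V: "V \<in> \<U>" for V
      using someI[of "\<lambda>W. W \<in> \<U> \<and> pre W = pre V" V] V same unfolding \<tau>_def by blast
    have "\<exists>s\<in>carrier (sections F (\<Union>(pre ` \<U>))). \<forall>P\<in>pre ` \<U>. restr F (\<Union>(pre ` \<U>)) P s = \<tau> P"
    proof (rule gluing[OF op'])
      show "\<forall>P\<in>pre ` \<U>. \<tau> P \<in> carrier (sections F P)" using \<sigma> \<tau> by auto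
      show "\<forall>P\<in>pre ` \<U>. \<forall>Q\<in>pre ` \<U>. restr F P (P \<inter> Q) (\<tau> P) = restr F Q (P \<inter> Q) (\<tau> Q)"
        using compat \<tau> by (auto simp: Int)
    qed
    then show "\<exists>s\<in>carrier (sections F (pre (\<Union>\<U>))). \<forall>V\<in>\<U>. restr F (pre (\<Union>\<U>)) (pre V) s = \<sigma> V"
      using \<tau> unfolding Un by auto
  next
    show "cring (sections F (pre U))" if "openin Y U" for U using sections_cring[OF op[OF that]] .
    show "restr F (pre U) (pre V) \<in> ring_hom (sections F (pre U)) (sections F (pre V))"
      if "openin Y U" "openin Y V" "V \<subseteq> U" for U V
      using restr_hom[OF op[OF that(1)] op[OF that(2)] mono[OF that(3)]] .
    show "restr F (pre U) (pre U) s = s" if "openin Y U" "s \<in> carrier (sections F (pre U))" for U s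
      using restr_id[OF op[OF that(1)] that(2)] .
    show "restr F (pre V) (pre W) (restr F (pre U) (pre V) s) = restr F (pre U) (pre W) s"
      if "openin Y U" "openin Y V" "openin Y W" "W \<subseteq> V" "V \<subseteq> U" "s \<in> carrier (sections F (pre U))" for U V W s
      using restr_comp[OF op[OF that(1)] op[OF that(2)] op[OF that(3)] mono[OF that(4)] mono[OF that(5)] that(6)] .
  qed
qed

context ring_presheaf_on
begin

lemma restr_closed:
  "\<lbrakk>openin X U; openin X V; V \<subseteq> U; s \<in> carrier (sections F U)\<rbrakk> \<Longrightarrow> restr F U V s \<in> carrier (sections F V)"
  using ring_hom_closed[OF restr_hom] .

lemma restr_mult:
  "\<lbrakk>openin X U; openin X V; V \<subseteq> U; s \<in> carrier (sections F U); t \<in> carrier (sections F U)\<rbrakk>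
    \<Longrightarrow> restr F U V (s \<otimes>\<^bsub>sections F U\<^esub> t) = restr F U V s \<otimes>\<^bsub>sections F V\<^esub> restr F U V t"
  using ring_hom_mult[OF restr_hom] .

lemma restr_add:
  "\<lbrakk>openin X U; openin X V; V \<subseteq> U; s \<in> carrier (sections F U); t \<in> carrier (sections F U)\<rbrakk>
    \<Longrightarrow> restr F U V (s \<oplus>\<^bsub>sections F U\<^esub> t) = restr F U V s \<oplus>\<^bsub>sections F V\<^esub> restr F U V t"
  using ring_hom_add[OF restr_hom] .

lemma restr_one:
  "\<lbrakk>openin X U; openin X V; V \<subseteq> U\<rbrakk> \<Longrightarrow> restr F U V \<one>\<^bsub>sections F U\<^esub> = \<one>\<^bsub>sections F V\<^esub>"
  using ring_hom_one[OF restr_hom] .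

lemma restr_Units:
  assumes "openin X W" "openin X W'" "W' \<subseteq> W" "s \<in> Units (sections F W)"
  shows "restr F W W' s \<in> Units (sections F W')"
proof -
  obtain t where t: "s \<in> carrier (sections F W)" "t \<in> carrier (sections F W)"
    "s \<otimes>\<^bsub>sections F W\<^esub> t = \<one>\<^bsub>sections F W\<^esub>" "t \<otimes>\<^bsub>sections F W\<^esub> s = \<one>\<^bsub>sections F W\<^esub>"
    using assms(4) unfolding Units_def by blast
  note m = restr_mult[OF assms(1-3) t(1,2)] restr_mult[OF assms(1-3) t(2,1)] restr_one[OF assms(1-3)]
    restr_closed[OF assms(1-3) t(1)] restr_closed[OF assms(1-3) t(2)]
  have "restr F W W' s \<otimes>\<^bsub>sections F W'\<^esub> restr F W W' t = \<one>\<^bsub>sections F W'\<^esub>"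
    "restr F W W' t \<otimes>\<^bsub>sections F W'\<^esub> restr F W W' s = \<one>\<^bsub>sections F W'\<^esub>"
    using m t(3,4) by simp_all
  then show ?thesis unfolding Units_def using m(4,5) by blast
qed

lemma germ_eqI:
  assumes U: "openin X U" "x \<in> U" "s \<in> carrier (sections F U)"
    and V: "openin X V" "x \<in> V" "t \<in> carrier (sections F V)"
    and W: "openin X W" "x \<in> W" "W \<subseteq> U \<inter> V" "restr F U W s = restr F V W t"
  shows "germ X F x U s = germ X F x V t"
proof -
  have sub: "germ X F x U s \<subseteq> germ X F x V t"
    if U: "openin X U" "s \<in> carrier (sections F U)" and V: "openin X V" "t \<in> carrier (sections F V)"
    and W: "openin X W" "x \<in> W" "W \<subseteq> U" "W \<subseteq> V" "restr F U W s = restr F V W t" for U s V t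
  proof
    fix p assume "p \<in> germ X F x U s"
    then obtain A u C where p: "p = (A, u)" "openin X A" "x \<in> A" "u \<in> carrier (sections F A)"
      and C: "openin X C" "x \<in> C" "C \<subseteq> U" "C \<subseteq> A" "restr F U C s = restr F A C u"
      unfolding germ_def by blast
    have o: "openin X (W \<inter> C)" using W C by blast
    have "restr F V (W \<inter> C) t = restr F W (W \<inter> C) (restr F V W t)"
      using restr_comp[OF V(1) W(1) o _ W(4) V(2)] by simp
    also have "\<dots> = restr F C (W \<inter> C) (restr F U C s)" unfolding W(5)[symmetric]
      using restr_comp[OF U(1) W(1) o _ W(3) U(2)] restr_comp[OF U(1) C(1) o _ C(3) U(2)] by simp
    also have "\<dots> = restr F A (W \<inter> C) u" unfolding C(5)
      using restr_comp[OF p(2) C(1) o _ C(4) p(4)] by simp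
    finally show "p \<in> germ X F x V t" unfolding germ_def using p W C o by blast
  qed
  show ?thesis using assms by (intro subset_antisym sub) auto
qed

lemma germ_self:
  "\<lbrakk>openin X U; x \<in> U; s \<in> carrier (sections F U)\<rbrakk> \<Longrightarrow> (U, s) \<in> germ X F x U s"
  unfolding germ_def by blast

lemma germ_eqD:
  assumes "openin X U" "x \<in> U" "s \<in> carrier (sections F U)" "germ X F x U s = germ X F x V t"
  obtains W where "openin X W" "x \<in> W" "W \<subseteq> U \<inter> V" "restr F U W s = restr F V W t"
proof -
  have "(U, s) \<in> germ X F x V t" using germ_self[OF assms(1-3)] assms(4) by simp
  then show ?thesis using that unfolding germ_def by (auto simp: Int_commute)
qed

lemma germ_restr:
  assumes "openin X U" "s \<in> carrier (sections F U)" "openin X W" "x \<in> W" "W \<subseteq> U"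
  shows "germ X F x W (restr F U W s) = germ X F x U s"
  using assms by (intro germ_eqI[of W _ _ U _ W]) (auto simp: restr_id restr_closed)

lemma germ_mult:
  assumes U: "openin X U" "x \<in> U" "s \<in> carrier (sections F U)"
    and V: "openin X V" "x \<in> V" "t \<in> carrier (sections F V)"
  shows "germ X F x U s \<otimes>\<^bsub>stalk X F x\<^esub> germ X F x V t
    = germ X F x (U \<inter> V) (restr F U (U \<inter> V) s \<otimes>\<^bsub>sections F (U \<inter> V)\<^esub> restr F V (U \<inter> V) t)"
    (is "_ = germ X F x _ (?m U s V t)")
proof -
  have "germ X F x (U' \<inter> V') (?m U' s' V' t') = germ X F x (U \<inter> V) (?m U s V t)"
    if mem: "(U', s') \<in> germ X F x U s" "(V', t') \<in> germ X F x V t" for U' s' V' t'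
  proof -
    obtain C D where U': "openin X U'" "x \<in> U'" "s' \<in> carrier (sections F U')"
      and V': "openin X V'" "x \<in> V'" "t' \<in> carrier (sections F V')"
      and C: "openin X C" "x \<in> C" "C \<subseteq> U \<inter> U'" "restr F U C s = restr F U' C s'"
      and D: "openin X D" "x \<in> D" "D \<subseteq> V \<inter> V'" "restr F V D t = restr F V' D t'"
      using mem unfolding germ_def by blast
    have o: "openin X (C \<inter> D)" "openin X (U \<inter> V)" "openin X (U' \<inter> V')" using U U' V V' C D by auto
    have m: "?m U s V t \<in> carrier (sections F (U \<inter> V))"
      if "openin X U" "openin X V" "s \<in> carrier (sections F U)" "t \<in> carrier (sections F V)" for U V s t
    proof -
      interpret cring "sections F (U \<inter> V)" using that by (intro sections_cring) auto
      show ?thesis using that by (intro m_closed restr_closed) auto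
    qed
    have r: "restr F (U \<inter> V) W (?m U s V t) = restr F U W s \<otimes>\<^bsub>sections F W\<^esub> restr F V W t"
      if *: "openin X U" "openin X V" "openin X W" "W \<subseteq> U" "W \<subseteq> V" "s \<in> carrier (sections F U)" "t \<in> carrier (sections F V)" for U V W s t
    proof -
      have UV: "openin X (U \<inter> V)" "W \<subseteq> U \<inter> V" using * by auto
      show ?thesis
        using restr_mult[OF UV(1) *(3) UV(2), of "restr F U (U \<inter> V) s" "restr F V (U \<inter> V) t"]
          restr_comp[OF *(1) UV(1) *(3) UV(2) _ *(6)] restr_comp[OF *(2) UV(1) *(3) UV(2) _ *(7)]
          restr_closed[OF *(1) UV(1) _ *(6)] restr_closed[OF *(2) UV(1) _ *(7)] by simp
    qed
    have 1: "restr F U (C \<inter> D) s = restr F U' (C \<inter> D) s'"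
      using restr_comp[OF U(1) C(1) o(1) _ _ U(3)] restr_comp[OF U'(1) C(1) o(1) _ _ U'(3)] C by auto
    have 2: "restr F V (C \<inter> D) t = restr F V' (C \<inter> D) t'"
      using restr_comp[OF V(1) D(1) o(1) _ _ V(3)] restr_comp[OF V'(1) D(1) o(1) _ _ V'(3)] D by auto
    show ?thesis
    proof (rule germ_eqI[where W = "C \<inter> D"])
      show "restr F (U' \<inter> V') (C \<inter> D) (?m U' s' V' t') = restr F (U \<inter> V) (C \<inter> D) (?m U s V t)"
        using U V U' V' C D o 1 2 by (subst (1 2) r) auto
    qed (use U V U' V' C D o m in auto)
  qed
  then show ?thesis unfolding stalk_def monoid.simps
    by (intro UN_pair_const[OF germ_self[OF U]] UN_pair_const[OF germ_self[OF V]]) auto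
qed

lemma germ_one: "openin X U \<Longrightarrow> x \<in> U \<Longrightarrow> germ X F x U \<one>\<^bsub>sections F U\<^esub> = \<one>\<^bsub>stalk X F x\<^esub>"
proof -
  assume U: "openin X U" "x \<in> U"
  then have *: "openin X (topspace X)" "U \<subseteq> topspace X" using openin_subset by auto
  interpret cring "sections F (topspace X)" using * by (intro sections_cring)
  show ?thesis using germ_restr[OF *(1) one_closed U *(2)] restr_one[OF *(1) U(1) *(2)]
    by (simp add: stalk_def)
qed

text \<open>A germ is a unit iff some restriction of a representative is, because the equation expressing
invertibility already holds on a neighbourhood. Through this lemma the condition on stalks becomes
a statement about sections.\<close>

lemma germ_Units_iff:
  assumes U: "openin X U" "x \<in> U" "s \<in> carrier (sections F U)"
  shows "germ X F x U s \<in> Units (stalk X F x) \<longleftrightarrow>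
    (\<exists>W. openin X W \<and> x \<in> W \<and> W \<subseteq> U \<and> restr F U W s \<in> Units (sections F W))"
proof
  assume "germ X F x U s \<in> Units (stalk X F x)"
  then obtain c where c: "c \<in> carrier (stalk X F x)" "germ X F x U s \<otimes>\<^bsub>stalk X F x\<^esub> c = \<one>\<^bsub>stalk X F x\<^esub>"
    unfolding Units_def by blast
  then obtain V t where V: "openin X V" "x \<in> V" "t \<in> carrier (sections F V)" "c = germ X F x V t"
    by (auto simp: stalk_def)
  have o: "openin X (U \<inter> V)" "x \<in> U \<inter> V" using U V by auto
  interpret UV: cring "sections F (U \<inter> V)" by (rule sections_cring[OF o(1)])
  let ?p = "restr F U (U \<inter> V) s \<otimes>\<^bsub>sections F (U \<inter> V)\<^esub> restr F V (U \<inter> V) t"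
  have car: "restr F U (U \<inter> V) s \<in> carrier (sections F (U \<inter> V))" "restr F V (U \<inter> V) t \<in> carrier (sections F (U \<inter> V))"
    using U V o by (auto intro: restr_closed)
  have "germ X F x (U \<inter> V) ?p = germ X F x (U \<inter> V) \<one>\<^bsub>sections F (U \<inter> V)\<^esub>"
    using c(2) germ_mult[OF U V(1-3)] germ_one[OF o] V(4) by simp
  then obtain W where W: "openin X W" "x \<in> W" "W \<subseteq> U \<inter> V"
    "restr F (U \<inter> V) W ?p = restr F (U \<inter> V) W \<one>\<^bsub>sections F (U \<inter> V)\<^esub>"
    using germ_eqD[OF o, of ?p "U \<inter> V" "\<one>\<^bsub>sections F (U \<inter> V)\<^esub>"] car by auto
  interpret W: cring "sections F W" by (rule sections_cring[OF W(1)])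
  have 1: "restr F U W s \<otimes>\<^bsub>sections F W\<^esub> restr F V W t = \<one>\<^bsub>sections F W\<^esub>"
    using W(4) restr_mult[OF o(1) W(1,3) car] restr_one[OF o(1) W(1,3)]
      restr_comp[OF U(1) o(1) W(1,3) _ U(3)] restr_comp[OF V(1) o(1) W(1,3) _ V(3)] by simp
  have car': "restr F U W s \<in> carrier (sections F W)" "restr F V W t \<in> carrier (sections F W)"
    using U V W by (auto intro: restr_closed)
  have "restr F V W t \<otimes>\<^bsub>sections F W\<^esub> restr F U W s = \<one>\<^bsub>sections F W\<^esub>"
    using 1 W.m_comm[OF car'] by simp
  then have "restr F U W s \<in> Units (sections F W)"
    using 1 car' unfolding Units_def by blast
  then show "\<exists>W. openin X W \<and> x \<in> W \<and> W \<subseteq> U \<and> restr F U W s \<in> Units (sections F W)"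
    using W by blast
next
  assume "\<exists>W. openin X W \<and> x \<in> W \<and> W \<subseteq> U \<and> restr F U W s \<in> Units (sections F W)"
  then obtain W where W: "openin X W" "x \<in> W" "W \<subseteq> U" "restr F U W s \<in> Units (sections F W)" by blast
  interpret W: cring "sections F W" by (rule sections_cring[OF W(1)])
  obtain t where t: "t \<in> carrier (sections F W)" "restr F U W s \<otimes>\<^bsub>sections F W\<^esub> t = \<one>\<^bsub>sections F W\<^esub>"
    "t \<otimes>\<^bsub>sections F W\<^esub> restr F U W s = \<one>\<^bsub>sections F W\<^esub>"
    using W(4) unfolding Units_def by blast
  have s: "restr F U W s \<in> carrier (sections F W)" using W(4) by blast
  have "germ X F x W (restr F U W s) \<otimes>\<^bsub>stalk X F x\<^esub> germ X F x W t = \<one>\<^bsub>stalk X F x\<^esub>"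
    "germ X F x W t \<otimes>\<^bsub>stalk X F x\<^esub> germ X F x W (restr F U W s) = \<one>\<^bsub>stalk X F x\<^esub>"
    using W(1,2) s t by (simp_all add: germ_mult restr_id germ_one)
  moreover have "germ X F x W (restr F U W s) = germ X F x U s" using germ_restr W U by blast
  moreover have "germ X F x W t \<in> carrier (stalk X F x)" "germ X F x U s \<in> carrier (stalk X F x)"
    using W t U by (auto simp: stalk_def)
  ultimately show "germ X F x U s \<in> Units (stalk X F x)" unfolding Units_def by auto
qed

end

section \<open>The space of filters\<close>

definition spec_preimage :: "('b, 'm) ring_scheme \<Rightarrow> 'b set set \<Rightarrow> 'b set set" where
  "spec_preimage B V = {P \<in> Spec B. carrier B - P \<in> V}"

context cring
begin

lemma filter_power: "F \<in> Filt R \<Longrightarrow> g \<in> F \<Longrightarrow> g [^] (n::nat) \<in> F"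
  by (induction n) (auto simp: Filt_def)

lemma basic_open_mult:
  "g \<in> carrier R \<Longrightarrow> h \<in> carrier R \<Longrightarrow> basic_open R (g \<otimes> h) = basic_open R g \<inter> basic_open R h"
  using basic_open_Int[OF is_cring] by simp

lemma openin_basic_open: "g \<in> carrier R \<Longrightarrow> openin (filt_topology R) (basic_open R g)"
  unfolding openin_filt_topology[OF is_cring] by (rule arbitrary_union_of_inc) blast

lemma basic_open_base:
  assumes "openin (filt_topology R) V" "F \<in> V"
  obtains g where "g \<in> carrier R" "F \<in> basic_open R g" "basic_open R g \<subseteq> V"
  using assms unfolding openin_filt_topology[OF is_cring] union_of_def arbitrary_def by blast

lemma prime_complement_filter: "P \<in> Spec R \<Longrightarrow> carrier R - P \<in> Filt R"
  unfolding Filt_def by (auto simp: prime_one prime_mult_iff factor_def)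

lemma spec_preimage_basic_open: "g \<in> carrier R \<Longrightarrow> spec_preimage R (basic_open R g) = spec_basic R g"
  using prime_complement_filter by (auto simp: spec_preimage_def spec_basic_def basic_open_def)

lemma spec_preimage_mono: "V \<subseteq> W \<Longrightarrow> spec_preimage R V \<subseteq> spec_preimage R W"
  by (auto simp: spec_preimage_def)

lemma spec_preimage_Filt: "spec_preimage R (Filt R) = Spec R"
  using prime_complement_filter by (auto simp: spec_preimage_def)

lemma spec_preimage_eq: "{P \<in> topspace (zariski_topology R). spec_to_filt R P \<in> V} = spec_preimage R V"
  by (simp add: topspace_zariski_topology[OF is_cring] spec_preimage_def spec_to_filt_def)

lemma openin_spec_preimage:
  assumes "openin (filt_topology R) V"
  shows "openin (zariski_topology R) (spec_preimage R V)"
proof -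
  have "\<exists>U. openin (zariski_topology R) U \<and> P \<in> U \<and> U \<subseteq> spec_preimage R V"
    if P: "P \<in> spec_preimage R V" for P
  proof -
    have PV: "carrier R - P \<in> V" using P by (simp add: spec_preimage_def)
    obtain g where g: "g \<in> carrier R" "carrier R - P \<in> basic_open R g" "basic_open R g \<subseteq> V"
      using basic_open_base[OF assms PV] .
    have "P \<in> spec_preimage R (basic_open R g)" using P g by (simp add: spec_preimage_def)
    then show ?thesis
      using openin_spec_basic[OF g(1)] spec_preimage_mono[OF g(3)] spec_preimage_basic_open[OF g(1)] by auto
  qed
  then show ?thesis by (subst openin_subopen) blast
qed

lemma continuous_spec_to_filt: "continuous_map (zariski_topology R) (filt_topology R) (spec_to_filt R)"
  unfolding continuous_map_def spec_preimage_eq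
  using openin_spec_preimage prime_complement_filter
  by (simp add: topspace_zariski_topology[OF is_cring] topspace_filt_topology[OF is_cring] spec_to_filt_def)

lemma filt_sheaf_ringed_space: "ringed_space (filt_topology R) (filt_sheaf R)"
  unfolding filt_sheaf_def
  by (rule direct_image_ringed_space[OF structure_sheaf_ringed_space continuous_spec_to_filt])

lemma filt_sheaf_restr: "restr (filt_sheaf R) V W \<sigma> = restrict \<sigma> (spec_preimage R W)"
  by (simp add: filt_sheaf_def direct_image_def structure_sheaf_def spec_preimage_eq)

lemma filt_sheaf_carrier: "carrier (sections (filt_sheaf R) V) = spec_sections R (spec_preimage R V)"
  by (simp add: filt_sheaf_def direct_image_def structure_sheaf_def spec_preimage_eq)

lemma filt_sheaf_mult:
    "\<sigma> \<otimes>\<^bsub>sections (filt_sheaf R) V\<^esub> \<tau> = (\<lambda>P\<in>spec_preimage R V. \<sigma> P \<otimes>\<^bsub>local_ring_at R P\<^esub> \<tau> P)"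
  and filt_sheaf_add:
    "\<sigma> \<oplus>\<^bsub>sections (filt_sheaf R) V\<^esub> \<tau> = (\<lambda>P\<in>spec_preimage R V. \<sigma> P \<oplus>\<^bsub>local_ring_at R P\<^esub> \<tau> P)"
  and filt_sheaf_one:
    "\<one>\<^bsub>sections (filt_sheaf R) V\<^esub> = (\<lambda>P\<in>spec_preimage R V. frac_at R P \<one> \<one>)"
  by (simp_all add: filt_sheaf_def direct_image_def structure_sheaf_def spec_preimage_eq localization_def)

lemma frac_at_mult:
  "\<lbrakk>P \<in> Spec R; a \<in> carrier R; b \<in> carrier R; s \<in> carrier R; t \<in> carrier R; s \<notin> P; t \<notin> P\<rbrakk>
    \<Longrightarrow> frac_at R P a s \<otimes>\<^bsub>local_ring_at R P\<^esub> frac_at R P b t = frac_at R P (a \<otimes> b) (s \<otimes> t)"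
  by (rule fraction_mult[OF submonoid_prime_complement]) auto

lemma frac_at_add:
  "\<lbrakk>P \<in> Spec R; a \<in> carrier R; b \<in> carrier R; s \<in> carrier R; t \<in> carrier R; s \<notin> P; t \<notin> P\<rbrakk>
    \<Longrightarrow> frac_at R P a s \<oplus>\<^bsub>local_ring_at R P\<^esub> frac_at R P b t
      = frac_at R P (a \<otimes> t \<oplus> b \<otimes> s) (s \<otimes> t)"
  by (rule fraction_add[OF submonoid_prime_complement]) auto

text \<open>The set \<open>basic_open R g\<close> of filters must lie in \<open>V\<close>, which is stronger than
\<open>spec_basic R g \<subseteq> spec_preimage R V\<close>: the numerator and denominator will be evaluated at points
whose filter need not be the complement of a prime.\<close>

definition is_fraction :: "('a set \<Rightarrow> ('a \<times> 'a) set) \<Rightarrow> 'a set set \<Rightarrow> 'a \<Rightarrow> 'a \<Rightarrow> bool" where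
  "is_fraction \<sigma> V a g \<longleftrightarrow> a \<in> carrier R \<and> g \<in> carrier R \<and> basic_open R g \<subseteq> V \<and>
     (\<forall>P\<in>spec_basic R g. \<sigma> P = frac_at R P a g)"

lemma is_fractionD:
  assumes "is_fraction \<sigma> V a g"
  shows "a \<in> carrier R" "g \<in> carrier R" "basic_open R g \<subseteq> V"
    "P \<in> spec_basic R g \<Longrightarrow> \<sigma> P = frac_at R P a g"
    "spec_basic R g \<subseteq> spec_preimage R V"
  using assms spec_preimage_mono[of "basic_open R g" V] spec_preimage_basic_open[of g]
  unfolding is_fraction_def by auto

text \<open>The set \<open>basic_open R g\<close> is a neighbourhood of every filter containing \<open>g\<close>, so a section over a
neighbourhood of a filter \<open>F\<close> is a fraction with denominator in \<open>F\<close>; this is the description of the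
stalk at \<open>F\<close> as \<open>B_F\<close> used throughout.\<close>

lemma section_is_fraction:
  assumes "openin (filt_topology R) V" "\<sigma> \<in> carrier (sections (filt_sheaf R) V)" "F \<in> V"
  obtains a g where "is_fraction \<sigma> V a g" "g \<in> F"
proof -
  obtain h where h: "h \<in> carrier R" "F \<in> basic_open R h" "basic_open R h \<subseteq> V"
    using basic_open_base[OF assms(1,3)] .
  obtain n :: nat and a where a: "a \<in> carrier R"
    "\<And>P. P \<in> spec_basic R h \<Longrightarrow> \<sigma> P = frac_at R P a (h [^] n)"
    using section_on_basic_open[of \<sigma> "spec_preimage R V" h] assms(2) h(1)
      spec_preimage_mono[OF h(3)] spec_preimage_basic_open[OF h(1)]
    unfolding filt_sheaf_carrier by metis
  \<comment> \<open>The exponent is raised by one since \<open>h ^ n\<close> would be \<open>1\<close> for \<open>n = 0\<close>, and \<open>D(1)\<close> need not lie in \<open>V\<close>.\<close>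
  define g where "g = h [^] Suc n"
  have g: "g \<in> carrier R" "g = h [^] n \<otimes> h" using h(1) by (simp_all add: g_def)
  have "basic_open R g \<subseteq> V" using basic_open_mult[of "h [^] n" h] h g by auto
  moreover have "\<sigma> P = frac_at R P (a \<otimes> h) g" if P: "P \<in> spec_basic R g" for P
  proof -
    have P': "P \<in> Spec R" "h \<notin> P" "h [^] n \<notin> P" "P \<in> spec_basic R h"
      using P h(1) unfolding g(2) by (auto simp: spec_basic_def prime_mult_iff)
    have "frac_at R P a (h [^] n) = frac_at R P (a \<otimes> h) g"
      unfolding g(2) using P' h(1) a(1) by (intro frac_at_eqI) (auto simp: prime_mult_iff m_ac)
    then show ?thesis using a(2)[OF P'(4)] by simp
  qed
  moreover have "F \<in> Filt R" "h \<in> F" using h(2) by (auto simp: basic_open_def)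
  then have "g \<in> F" unfolding g_def by (rule filter_power)
  ultimately show ?thesis using that[of "a \<otimes> h" g] g(1) h(1) a(1) by (simp add: is_fraction_def)
qed

text \<open>Restriction to a smaller open set is covered by choosing \<open>h\<close> with \<open>D(h)\<close> inside that set.\<close>

lemma is_fraction_refine:
  assumes "is_fraction \<sigma> V a g" "h \<in> carrier R" "basic_open R (g \<otimes> h) \<subseteq> W"
    "\<And>P. P \<in> spec_basic R (g \<otimes> h) \<Longrightarrow> \<tau> P = \<sigma> P"
  shows "is_fraction \<tau> W (a \<otimes> h) (g \<otimes> h)"
proof -
  note D = is_fractionD[OF assms(1)]
  have "\<tau> P = frac_at R P (a \<otimes> h) (g \<otimes> h)" if P: "P \<in> spec_basic R (g \<otimes> h)" for P
  proof -
    have P': "P \<in> Spec R" "g \<notin> P" "h \<notin> P" "P \<in> spec_basic R g"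
      using P D assms(2) by (auto simp: spec_basic_def prime_mult_iff)
    have "frac_at R P a g = frac_at R P (a \<otimes> h) (g \<otimes> h)"
      using P' D(1,2) assms(2) by (intro frac_at_eqI) (auto simp: prime_mult_iff m_ac)
    then show ?thesis using assms(4)[OF P] D(4)[OF P'(4)] by simp
  qed
  then show ?thesis using D(1,2) assms(2,3) by (simp add: is_fraction_def)
qed

lemma is_fraction_mult_add:
  assumes "is_fraction \<sigma> V a g" "is_fraction \<tau> V b h"
  shows "is_fraction (\<sigma> \<otimes>\<^bsub>sections (filt_sheaf R) V\<^esub> \<tau>) V (a \<otimes> b) (g \<otimes> h)"
    "is_fraction (\<sigma> \<oplus>\<^bsub>sections (filt_sheaf R) V\<^esub> \<tau>) V (a \<otimes> h \<oplus> b \<otimes> g) (g \<otimes> h)"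
proof -
  note D = is_fractionD[OF assms(1)] and E = is_fractionD[OF assms(2)]
  have sub: "basic_open R (g \<otimes> h) \<subseteq> V" using D(2,3) E(2,3) basic_open_mult by blast
  have P: "P \<in> Spec R" "g \<notin> P" "h \<notin> P" "P \<in> spec_preimage R V" "\<sigma> P = frac_at R P a g" "\<tau> P = frac_at R P b h"
    if "P \<in> spec_basic R (g \<otimes> h)" for P
  proof -
    have *: "P \<in> spec_basic R g" "P \<in> spec_basic R h" using that spec_basic_mult[OF D(2) E(2)] by auto
    then show "P \<in> Spec R" "g \<notin> P" "h \<notin> P" by (auto simp: spec_basic_def)
    show "P \<in> spec_preimage R V" using * D(5) by blast
    show "\<sigma> P = frac_at R P a g" "\<tau> P = frac_at R P b h" using * D(4) E(4) by auto
  qed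
  show "is_fraction (\<sigma> \<otimes>\<^bsub>sections (filt_sheaf R) V\<^esub> \<tau>) V (a \<otimes> b) (g \<otimes> h)"
    "is_fraction (\<sigma> \<oplus>\<^bsub>sections (filt_sheaf R) V\<^esub> \<tau>) V (a \<otimes> h \<oplus> b \<otimes> g) (g \<otimes> h)"
    using D(1,2) E(1,2) sub P
    by (simp_all add: is_fraction_def filt_sheaf_mult filt_sheaf_add frac_at_mult frac_at_add)
qed

lemma global_section_carrier:
  "b \<in> carrier R \<Longrightarrow> global_section R b \<in> carrier (sections (filt_sheaf R) (Filt R))"
  unfolding filt_sheaf_carrier spec_preimage_Filt global_section_def
  using openin_topspace[of "zariski_topology R"]
  by (intro fraction_section) (auto simp: topspace_zariski_topology[OF is_cring] prime_one)

lemma prime_Unit_fraction: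
  assumes "P \<in> Spec R" "b \<in> carrier R" "frac_at R P b \<one> \<otimes>\<^bsub>local_ring_at R P\<^esub> y = frac_at R P \<one> \<one>"
    "y \<in> carrier (local_ring_at R P)"
  shows "b \<notin> P"
proof
  assume bP: "b \<in> P"
  note sub = submonoid_prime_complement[OF assms(1)]
  obtain a s where y: "a \<in> carrier R" "s \<in> carrier R - P" "y = frac_at R P a s"
    using localization_cases[OF sub assms(4)] by metis
  have one: "\<one> \<in> carrier R - P" using prime_one[OF assms(1)] by simp
  have "frac_at R P (b \<otimes> a) (\<one> \<otimes> s) = frac_at R P \<one> \<one>"
    using assms(3) fraction_mult[OF sub assms(2) y(1) one y(2)] y(3) by simp
  then obtain u where u: "u \<in> carrier R - P" "u \<otimes> ((b \<otimes> a) \<otimes> \<one>) = u \<otimes> (\<one> \<otimes> (\<one> \<otimes> s))"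
    using fraction_eq_iff[OF sub, of "b \<otimes> a" \<one> "\<one> \<otimes> s" \<one>] assms(2) y one by auto
  have "u \<otimes> ((b \<otimes> a) \<otimes> \<one>) \<in> P" using bP u(1) assms(1,2) y(1) by (simp add: prime_mult_iff)
  moreover have "u \<otimes> (\<one> \<otimes> (\<one> \<otimes> s)) \<notin> P" using u(1) y assms(1) by (auto simp: prime_mult_iff)
  ultimately show False using u(2) by simp
qed

end

lemma stalk_hom_germ:
  assumes X: "ring_presheaf_on X F" and Y: "ring_presheaf_on Y G" and f: "continuous_map X Y f"
    and closed: "\<And>V s. \<lbrakk>openin Y V; s \<in> carrier (sections G V)\<rbrakk>
      \<Longrightarrow> \<theta> V s \<in> carrier (sections F {x \<in> topspace X. f x \<in> V})"
    and natural: "\<And>V W s. \<lbrakk>openin Y V; openin Y W; W \<subseteq> V; s \<in> carrier (sections G V)\<rbrakk>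
      \<Longrightarrow> \<theta> W (restr G V W s) = restr F {x \<in> topspace X. f x \<in> V} {x \<in> topspace X. f x \<in> W} (\<theta> V s)"
    and V: "openin Y V" "x \<in> topspace X" "f x \<in> V" "s \<in> carrier (sections G V)"
  shows "stalk_hom X F f \<theta> x (germ Y G (f x) V s) = germ X F x {x \<in> topspace X. f x \<in> V} (\<theta> V s)"
proof -
  interpret X: ring_presheaf_on X F by fact
  interpret Y: ring_presheaf_on Y G by fact
  have op: "openin X {x \<in> topspace X. f x \<in> V}" if "openin Y V" for V
    using openin_continuous_map_preimage[OF f that] .
  have "germ X F x {x \<in> topspace X. f x \<in> V'} (\<theta> V' s') = germ X F x {x \<in> topspace X. f x \<in> V} (\<theta> V s)"
    if "(V', s') \<in> germ Y G (f x) V s" for V' s'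
  proof -
    obtain W where V': "openin Y V'" "f x \<in> V'" "s' \<in> carrier (sections G V')"
      and W: "openin Y W" "f x \<in> W" "W \<subseteq> V \<inter> V'" "restr G V W s = restr G V' W s'"
      using \<open>(V', s') \<in> _\<close> unfolding germ_def by blast
    show ?thesis
    proof (rule X.germ_eqI[OF op[OF V'(1)] _ closed[OF V'(1,3)] op[OF V(1)] _ closed[OF V(1,4)] op[OF W(1)]])
      show "restr F {x \<in> topspace X. f x \<in> V'} {x \<in> topspace X. f x \<in> W} (\<theta> V' s')
          = restr F {x \<in> topspace X. f x \<in> V} {x \<in> topspace X. f x \<in> W} (\<theta> V s)"
        using natural[OF V'(1) W(1) _ V'(3)] natural[OF V(1) W(1) _ V(4)] W(3,4) by simp
    qed (use V V' W in auto)
  qed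
  then show ?thesis unfolding stalk_hom_def
    by (intro UN_pair_const[OF Y.germ_self[OF V(1,3,4)]])
qed

section \<open>The morphism determined by a ring homomorphism\<close>

locale hom_to_global_sections =
  ringed_space X F + B: cring B
  for X :: "'a topology" and F :: "('a, 'c) ring_presheaf" and B :: "('b, 'm) ring_scheme" +
  fixes \<phi> :: "'b \<Rightarrow> 'c"
  assumes phi_hom: "\<phi> \<in> ring_hom B (sections F (topspace X))"
begin

definition phi_on :: "'a set \<Rightarrow> 'b \<Rightarrow> 'c" where
  "phi_on W b = restr F (topspace X) W (\<phi> b)"

lemma phi_on_hom: "openin X W \<Longrightarrow> phi_on W \<in> ring_hom B (sections F W)"
  using ring_hom_trans[OF phi_hom restr_hom[of "topspace X" W]] openin_subset[of X W]
  unfolding phi_on_def comp_def by auto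

lemma phi_on_closed: "openin X W \<Longrightarrow> b \<in> carrier B \<Longrightarrow> phi_on W b \<in> carrier (sections F W)"
  using ring_hom_closed[OF phi_on_hom] .

lemma phi_on_mult: "\<lbrakk>openin X W; a \<in> carrier B; b \<in> carrier B\<rbrakk>
    \<Longrightarrow> phi_on W (a \<otimes>\<^bsub>B\<^esub> b) = phi_on W a \<otimes>\<^bsub>sections F W\<^esub> phi_on W b"
  using ring_hom_mult[OF phi_on_hom] .

lemma phi_on_add: "\<lbrakk>openin X W; a \<in> carrier B; b \<in> carrier B\<rbrakk>
    \<Longrightarrow> phi_on W (a \<oplus>\<^bsub>B\<^esub> b) = phi_on W a \<oplus>\<^bsub>sections F W\<^esub> phi_on W b"
  using ring_hom_add[OF phi_on_hom] .

lemma phi_on_one: "openin X W \<Longrightarrow> phi_on W \<one>\<^bsub>B\<^esub> = \<one>\<^bsub>sections F W\<^esub>"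
  using ring_hom_one[OF phi_on_hom] .

lemma restr_phi_on:
  "\<lbrakk>openin X W; openin X W'; W' \<subseteq> W; b \<in> carrier B\<rbrakk> \<Longrightarrow> restr F W W' (phi_on W b) = phi_on W' b"
  using restr_comp[of "topspace X" W W' "\<phi> b"] openin_subset[of X W] ring_hom_closed[OF phi_hom]
  unfolding phi_on_def by auto

lemma phi_on_Units_restrict:
  "\<lbrakk>openin X W; openin X W'; W' \<subseteq> W; b \<in> carrier B; phi_on W b \<in> Units (sections F W)\<rbrakk>
    \<Longrightarrow> phi_on W' b \<in> Units (sections F W')"
  using restr_Units[of W W' "phi_on W b"] restr_phi_on by simp

lemma phi_on_Units_mult_iff:
  assumes "openin X W" "a \<in> carrier B" "b \<in> carrier B"
  shows "phi_on W (a \<otimes>\<^bsub>B\<^esub> b) \<in> Units (sections F W) \<longleftrightarrow>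
    phi_on W a \<in> Units (sections F W) \<and> phi_on W b \<in> Units (sections F W)"
proof -
  interpret W: cring "sections F W" by (rule sections_cring[OF assms(1)])
  note c = phi_on_closed[OF assms(1,2)] phi_on_closed[OF assms(1,3)]
  have "phi_on W a \<in> Units (sections F W)" "phi_on W b \<in> Units (sections F W)"
    if "phi_on W a \<otimes>\<^bsub>sections F W\<^esub> phi_on W b \<in> Units (sections F W)"
    using W.unit_factor[OF that c] W.unit_factor[of "phi_on W b" "phi_on W a"] that c W.m_comm[OF c] by simp_all
  then show ?thesis unfolding phi_on_mult[OF assms] using W.Units_m_closed by blast
qed

lemma phi_on_Units_power:
  assumes "openin X W" "g \<in> carrier B" "phi_on W g \<in> Units (sections F W)"
  shows "phi_on W (g [^]\<^bsub>B\<^esub> (n::nat)) \<in> Units (sections F W)"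
proof -
  interpret W: cring "sections F W" by (rule sections_cring[OF assms(1)])
  show ?thesis
    by (induction n) (use assms in \<open>simp_all add: phi_on_one phi_on_Units_mult_iff\<close>)
qed

text \<open>A morphism local on stalks with global part \<open>\<phi>\<close> has to send \<open>x\<close> to the filter of all \<open>b\<close> for which
\<open>\<phi> b\<close> is a unit near \<open>x\<close>: units go to units, and non-units to non-units. As the stalk at \<open>x\<close> need
not be local, the complement of this filter may fail to be a prime ideal.\<close>

definition unit_filter :: "'a \<Rightarrow> 'b set" where
  "unit_filter = (\<lambda>x\<in>topspace X. {b \<in> carrier B. \<exists>W. openin X W \<and> x \<in> W \<and> phi_on W b \<in> Units (sections F W)})"

lemma mem_unit_filter:
  "x \<in> topspace X \<Longrightarrow>
    b \<in> unit_filter x \<longleftrightarrow> b \<in> carrier B \<and> (\<exists>W. openin X W \<and> x \<in> W \<and> phi_on W b \<in> Units (sections F W))"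
  by (simp add: unit_filter_def)

lemma unit_filter_Filt:
  assumes x: "x \<in> topspace X" shows "unit_filter x \<in> Filt B"
proof -
  have one: "\<one>\<^bsub>B\<^esub> \<in> unit_filter x"
  proof -
    interpret T: cring "sections F (topspace X)" by (rule sections_cring) simp
    show ?thesis unfolding mem_unit_filter[OF x]
      using x phi_on_one[of "topspace X"] by (intro conjI exI[of _ "topspace X"]) auto
  qed
  have mult: "a \<otimes>\<^bsub>B\<^esub> b \<in> unit_filter x" if ab: "a \<in> unit_filter x" "b \<in> unit_filter x" for a b
  proof -
    obtain W W' where W: "openin X W" "x \<in> W" "phi_on W a \<in> Units (sections F W)"
      "openin X W'" "x \<in> W'" "phi_on W' b \<in> Units (sections F W')" and c: "a \<in> carrier B" "b \<in> carrier B"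
      using ab unfolding mem_unit_filter[OF x] by blast
    have o: "openin X (W \<inter> W')" using W by blast
    have "phi_on (W \<inter> W') a \<in> Units (sections F (W \<inter> W'))" "phi_on (W \<inter> W') b \<in> Units (sections F (W \<inter> W'))"
      using phi_on_Units_restrict[OF W(1) o _ c(1) W(3)] phi_on_Units_restrict[OF W(4) o _ c(2) W(6)] by auto
    then have "phi_on (W \<inter> W') (a \<otimes>\<^bsub>B\<^esub> b) \<in> Units (sections F (W \<inter> W'))"
      using phi_on_Units_mult_iff[OF o c] by simp
    then show ?thesis unfolding mem_unit_filter[OF x] using W c o by blast
  qed
  have "b \<in> unit_filter x" if ab: "a \<in> unit_filter x" "b \<in> carrier B" "b divides\<^bsub>B\<^esub> a" for a b
  proof -
    obtain c where c: "c \<in> carrier B" "a = b \<otimes>\<^bsub>B\<^esub> c" using ab(3) unfolding factor_def by blast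
    then show ?thesis using ab(1,2) phi_on_Units_mult_iff[OF _ ab(2) c(1)] unfolding mem_unit_filter[OF x] by blast
  qed
  then show ?thesis using one mult mem_unit_filter[OF x] unfolding Filt_def by blast
qed

definition preimage :: "'b set set \<Rightarrow> 'a set" where
  "preimage V = {x \<in> topspace X. unit_filter x \<in> V}"

lemma preimage_mono: "V \<subseteq> W \<Longrightarrow> preimage V \<subseteq> preimage W"
  by (auto simp: preimage_def)

lemma mem_preimage_basic_open:
  "g \<in> carrier B \<Longrightarrow> x \<in> preimage (basic_open B g) \<longleftrightarrow>
    (\<exists>W. openin X W \<and> x \<in> W \<and> phi_on W g \<in> Units (sections F W))"
proof -
  have "x \<in> topspace X" if "openin X W" "x \<in> W" for W using that openin_subset by blast
  then show ?thesis if "g \<in> carrier B"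
    using that unit_filter_Filt[of x] mem_unit_filter[of x g] unfolding preimage_def basic_open_def by auto
qed

lemma Units_subset_preimage:
  "\<lbrakk>openin X W; g \<in> carrier B; phi_on W g \<in> Units (sections F W); basic_open B g \<subseteq> V\<rbrakk> \<Longrightarrow> W \<subseteq> preimage V"
proof
  fix x assume "openin X W" "g \<in> carrier B" "phi_on W g \<in> Units (sections F W)" "basic_open B g \<subseteq> V" "x \<in> W"
  then show "x \<in> preimage V" using preimage_mono[of "basic_open B g" V] mem_preimage_basic_open[of g x] by auto
qed

lemma openin_preimage:
  assumes "openin (filt_topology B) V" shows "openin X (preimage V)"
proof -
  have "\<exists>W. openin X W \<and> x \<in> W \<and> W \<subseteq> preimage V" if x: "x \<in> preimage V" for x
  proof -
    have xV: "unit_filter x \<in> V" using x by (simp add: preimage_def)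
    obtain g where g: "g \<in> carrier B" "unit_filter x \<in> basic_open B g" "basic_open B g \<subseteq> V"
      using B.basic_open_base[OF assms xV] .
    have "x \<in> preimage (basic_open B g)" using x g by (simp add: preimage_def)
    then obtain W where W: "openin X W" "x \<in> W" "phi_on W g \<in> Units (sections F W)"
      unfolding mem_preimage_basic_open[OF g(1)] by auto
    then show ?thesis using Units_subset_preimage[OF W(1) g(1) W(3) g(3)] by auto
  qed
  then show ?thesis by (subst openin_subopen) blast
qed

lemma continuous_unit_filter: "continuous_map X (filt_topology B) unit_filter"
  unfolding continuous_map_def using openin_preimage unit_filter_Filt
  by (auto simp: preimage_def topspace_filt_topology[OF B.is_cring])

abbreviation filt_sections :: "'b set set \<Rightarrow> ('b set \<Rightarrow> ('b \<times> 'b) set) ring" where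
  "filt_sections V \<equiv> sections (filt_sheaf B) V"

text \<open>The only possible image of a fraction \<open>a / g\<close> is \<open>\<phi>(a) / \<phi>(g)\<close>. Both fractions and open sets vary
freely here: \<open>W\<close> may be any open set on which \<open>\<phi>(g)\<close> is invertible.\<close>

definition represents :: "'b set set \<Rightarrow> ('b set \<Rightarrow> ('b \<times> 'b) set) \<Rightarrow> 'a set \<Rightarrow> 'c \<Rightarrow> bool" where
  "represents V \<sigma> W t \<longleftrightarrow> openin X W \<and> t \<in> carrier (sections F W) \<and>
     (\<exists>a g. B.is_fraction \<sigma> V a g \<and> phi_on W g \<in> Units (sections F W) \<and>
        phi_on W g \<otimes>\<^bsub>sections F W\<^esub> t = phi_on W a)"

lemma representsE:
  assumes "represents V \<sigma> W t"
  obtains a g where "openin X W" "t \<in> carrier (sections F W)" "B.is_fraction \<sigma> V a g"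
    "phi_on W g \<in> Units (sections F W)" "phi_on W g \<otimes>\<^bsub>sections F W\<^esub> t = phi_on W a"
  using assms unfolding represents_def by (elim conjE exE) (rule that)

lemma representsI:
  assumes "openin X W" "t \<in> carrier (sections F W)" "B.is_fraction \<sigma> V a g"
    "phi_on W g \<in> Units (sections F W)" "phi_on W g \<otimes>\<^bsub>sections F W\<^esub> t = phi_on W a"
  shows "represents V \<sigma> W t"
  unfolding represents_def using assms by (intro conjI exI[of _ a] exI[of _ g])

text \<open>If \<open>a / g\<close> and \<open>b / h\<close> agree at all primes of \<open>D(gh)\<close>, then \<open>(gh) ^ n (a h) = (gh) ^ n (b g)\<close> in
\<open>B\<close>, and this equation is transported by \<open>\<phi>\<close> to \<open>W\<close>, where \<open>\<phi>(gh)\<close> is a unit.\<close>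

lemma represents_unique:
  assumes "represents V \<sigma> W t" "represents V \<sigma> W u"
  shows "t = u"
proof -
  obtain a g where W: "openin X W" "t \<in> carrier (sections F W)"
    and a: "B.is_fraction \<sigma> V a g" "phi_on W g \<in> Units (sections F W)" "phi_on W g \<otimes>\<^bsub>sections F W\<^esub> t = phi_on W a"
    using assms(1) by (rule representsE)
  obtain b h where u: "u \<in> carrier (sections F W)"
    and b: "B.is_fraction \<sigma> V b h" "phi_on W h \<in> Units (sections F W)" "phi_on W h \<otimes>\<^bsub>sections F W\<^esub> u = phi_on W b"
    using assms(2) by (rule representsE)
  note A = B.is_fractionD[OF a(1)] and C = B.is_fractionD[OF b(1)]
  interpret W: cring "sections F W" by (rule sections_cring[OF W(1)])
  have "g \<notin> P \<and> h \<notin> P \<and> frac_at B P a g = frac_at B P b h" if "P \<in> spec_basic B (g \<otimes>\<^bsub>B\<^esub> h)" for P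
    using that A(4)[of P] C(4)[of P] B.spec_basic_mult[OF A(2) C(2)] by (auto simp: spec_basic_def)
  then obtain n :: nat where n: "(g \<otimes>\<^bsub>B\<^esub> h) [^]\<^bsub>B\<^esub> n \<otimes>\<^bsub>B\<^esub> (a \<otimes>\<^bsub>B\<^esub> h) = (g \<otimes>\<^bsub>B\<^esub> h) [^]\<^bsub>B\<^esub> n \<otimes>\<^bsub>B\<^esub> (b \<otimes>\<^bsub>B\<^esub> g)"
    using B.fractions_agree[OF A(1) C(1) A(2) C(2), of "g \<otimes>\<^bsub>B\<^esub> h"] A(2) C(2) by auto
  have gh: "phi_on W (g \<otimes>\<^bsub>B\<^esub> h) \<in> Units (sections F W)"
    using phi_on_Units_mult_iff[OF W(1) A(2) C(2)] a b by simp
  have un: "phi_on W ((g \<otimes>\<^bsub>B\<^esub> h) [^]\<^bsub>B\<^esub> n) \<in> Units (sections F W)"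
    using phi_on_Units_power[OF W(1) _ gh] A(2) C(2) by simp
  have "phi_on W ((g \<otimes>\<^bsub>B\<^esub> h) [^]\<^bsub>B\<^esub> n) \<otimes>\<^bsub>sections F W\<^esub> phi_on W (a \<otimes>\<^bsub>B\<^esub> h)
      = phi_on W ((g \<otimes>\<^bsub>B\<^esub> h) [^]\<^bsub>B\<^esub> n) \<otimes>\<^bsub>sections F W\<^esub> phi_on W (b \<otimes>\<^bsub>B\<^esub> g)"
    using arg_cong[OF n, of "phi_on W"] A(1,2) C(1,2) W(1) by (simp add: phi_on_mult[OF W(1), of "(g \<otimes>\<^bsub>B\<^esub> h) [^]\<^bsub>B\<^esub> n"])
  then have eq: "phi_on W (a \<otimes>\<^bsub>B\<^esub> h) = phi_on W (b \<otimes>\<^bsub>B\<^esub> g)"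
    using W.Units_l_cancel[OF un] phi_on_closed[OF W(1)] A(1,2) C(1,2) by simp
  note c = phi_on_closed[OF W(1) A(1)] phi_on_closed[OF W(1) A(2)] phi_on_closed[OF W(1) C(1)] phi_on_closed[OF W(1) C(2)] W(2) u
  have "phi_on W (g \<otimes>\<^bsub>B\<^esub> h) \<otimes>\<^bsub>sections F W\<^esub> t = (phi_on W g \<otimes>\<^bsub>sections F W\<^esub> t) \<otimes>\<^bsub>sections F W\<^esub> phi_on W h"
    unfolding phi_on_mult[OF W(1) A(2) C(2)] using c by (simp add: W.m_ac)
  also have "\<dots> = (phi_on W h \<otimes>\<^bsub>sections F W\<^esub> u) \<otimes>\<^bsub>sections F W\<^esub> phi_on W g"
    unfolding a(3) b(3) using eq phi_on_mult[OF W(1) A(1) C(2)] phi_on_mult[OF W(1) C(1) A(2)] by simp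
  also have "\<dots> = phi_on W (g \<otimes>\<^bsub>B\<^esub> h) \<otimes>\<^bsub>sections F W\<^esub> u"
    unfolding phi_on_mult[OF W(1) A(2) C(2)] using c by (simp add: W.m_ac)
  finally show ?thesis using W.Units_l_cancel[OF gh] W u by simp
qed

lemma represents_restr:
  assumes "represents V \<sigma> W t" "openin X W'" "W' \<subseteq> W"
  shows "represents V \<sigma> W' (restr F W W' t)"
proof -
  obtain a g where W: "openin X W" "t \<in> carrier (sections F W)"
    and a: "B.is_fraction \<sigma> V a g" "phi_on W g \<in> Units (sections F W)" "phi_on W g \<otimes>\<^bsub>sections F W\<^esub> t = phi_on W a"
    using assms(1) by (rule representsE)
  note A = B.is_fractionD[OF a(1)]
  have "phi_on W' g \<in> Units (sections F W')" using phi_on_Units_restrict[OF W(1) assms(2,3) A(2) a(2)] .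
  moreover have "phi_on W' g \<otimes>\<^bsub>sections F W'\<^esub> restr F W W' t = phi_on W' a"
    using restr_mult[OF W(1) assms(2,3) phi_on_closed[OF W(1) A(2)] W(2)] a(3) A(1,2)
      restr_phi_on[OF W(1) assms(2,3)] by simp
  ultimately show ?thesis
    using a(1) assms(2) restr_closed[OF W(1) assms(2,3) W(2)] by (intro representsI)
qed

lemma represents_subset: "represents V \<sigma> W t \<Longrightarrow> W \<subseteq> preimage V"
  by (erule representsE) (rule Units_subset_preimage[OF _ B.is_fractionD(2) _ B.is_fractionD(3)])

lemma represents_exists:
  assumes V: "openin (filt_topology B) V" and \<sigma>: "\<sigma> \<in> carrier (filt_sections V)" and x: "x \<in> preimage V"
  obtains W t where "x \<in> W" "represents V \<sigma> W t"
proof -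
  have x': "x \<in> topspace X" "unit_filter x \<in> V" using x by (auto simp: preimage_def)
  obtain a g where a: "B.is_fraction \<sigma> V a g" "g \<in> unit_filter x"
    using B.section_is_fraction[OF V \<sigma> x'(2)] .
  note A = B.is_fractionD[OF a(1)]
  obtain W where W: "openin X W" "x \<in> W" "phi_on W g \<in> Units (sections F W)"
    using a(2) mem_unit_filter[OF x'(1)] by blast
  interpret W: cring "sections F W" by (rule sections_cring[OF W(1)])
  let ?t = "inv\<^bsub>sections F W\<^esub> phi_on W g \<otimes>\<^bsub>sections F W\<^esub> phi_on W a"
  have "phi_on W g \<otimes>\<^bsub>sections F W\<^esub> ?t = phi_on W a" "?t \<in> carrier (sections F W)"
    using W(3) phi_on_closed[OF W(1) A(1)] phi_on_closed[OF W(1) A(2)]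
    by (simp_all add: W.m_assoc[symmetric])
  then have "represents V \<sigma> W ?t" using W a(1) by (intro representsI)
  then show ?thesis using that W(2) by blast
qed

text \<open>The fraction may depend on the point. Therefore sums, products and restrictions of images are images
again, and uniqueness of images makes the comorphism a natural family of homomorphisms.\<close>

definition is_image :: "'b set set \<Rightarrow> ('b set \<Rightarrow> ('b \<times> 'b) set) \<Rightarrow> 'c \<Rightarrow> bool" where
  "is_image V \<sigma> t \<longleftrightarrow> t \<in> carrier (sections F (preimage V)) \<and>
     (\<forall>x\<in>preimage V. \<exists>W. x \<in> W \<and> represents V \<sigma> W (restr F (preimage V) W t))"

lemma image_unique:
  assumes V: "openin (filt_topology B) V" and t: "is_image V \<sigma> t" and u: "is_image V \<sigma> u"
  shows "t = u"
proof -
  let ?\<U> = "{W. openin X W \<and> W \<subseteq> preimage V \<and> restr F (preimage V) W t = restr F (preimage V) W u}"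
  have "\<exists>W\<in>?\<U>. x \<in> W" if x: "x \<in> preimage V" for x
  proof -
    obtain W W' where W: "x \<in> W" "represents V \<sigma> W (restr F (preimage V) W t)"
      and W': "x \<in> W'" "represents V \<sigma> W' (restr F (preimage V) W' u)"
      using t u x unfolding is_image_def by blast
    have o: "openin X W" "openin X W'" "openin X (W \<inter> W')" using W W' unfolding represents_def by auto
    have s: "W \<subseteq> preimage V" "W' \<subseteq> preimage V" using W W' represents_subset by auto
    have c: "t \<in> carrier (sections F (preimage V))" "u \<in> carrier (sections F (preimage V))"
      using t u unfolding is_image_def by auto
    have "represents V \<sigma> (W \<inter> W') (restr F (preimage V) (W \<inter> W') t)"
      using represents_restr[OF W(2) o(3)] restr_comp[OF openin_preimage[OF V] o(1,3) _ s(1) c(1)] by simp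
    moreover have "represents V \<sigma> (W \<inter> W') (restr F (preimage V) (W \<inter> W') u)"
      using represents_restr[OF W'(2) o(3)] restr_comp[OF openin_preimage[OF V] o(2,3) _ s(2) c(2)] by simp
    ultimately have "restr F (preimage V) (W \<inter> W') t = restr F (preimage V) (W \<inter> W') u"
      by (rule represents_unique)
    then show ?thesis using W(1) W'(1) o s by blast
  qed
  then have "\<Union>?\<U> = preimage V" by blast
  then show ?thesis using locality[of ?\<U> t u] t u unfolding is_image_def by auto
qed

text \<open>The local values on all open sets that carry one agree on intersections by uniqueness, and the
sheaf condition glues them.\<close>

lemma image_exists:
  assumes V: "openin (filt_topology B) V" and \<sigma>: "\<sigma> \<in> carrier (filt_sections V)"
  obtains t where "is_image V \<sigma> t"
proof -
  define \<U> where "\<U> = {W. \<exists>t. represents V \<sigma> W t}"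
  define \<tau> where "\<tau> W = (SOME t. represents V \<sigma> W t)" for W
  have \<tau>: "represents V \<sigma> W (\<tau> W)" if "W \<in> \<U>" for W
    using that unfolding \<U>_def \<tau>_def mem_Collect_eq by (rule someI_ex)
  have op: "\<forall>W\<in>\<U>. openin X W" unfolding \<U>_def represents_def by auto
  have Un: "\<Union>\<U> = preimage V"
  proof
    show "\<Union>\<U> \<subseteq> preimage V" using represents_subset unfolding \<U>_def by blast
    show "preimage V \<subseteq> \<Union>\<U>"
    proof
      fix x assume "x \<in> preimage V"
      then obtain W t where "x \<in> W" "represents V \<sigma> W t" using represents_exists[OF V \<sigma>] by metis
      then show "x \<in> \<Union>\<U>" unfolding \<U>_def by blast
    qed
  qed
  have "\<exists>t\<in>carrier (sections F (\<Union>\<U>)). \<forall>W\<in>\<U>. restr F (\<Union>\<U>) W t = \<tau> W"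
  proof (rule gluing[OF op])
    show "\<forall>W\<in>\<U>. \<tau> W \<in> carrier (sections F W)" using \<tau> unfolding represents_def by auto
    show "\<forall>W\<in>\<U>. \<forall>W'\<in>\<U>. restr F W (W \<inter> W') (\<tau> W) = restr F W' (W \<inter> W') (\<tau> W')"
    proof (intro ballI)
      fix W W' assume *: "W \<in> \<U>" "W' \<in> \<U>"
      then have "openin X (W \<inter> W')" using op by blast
      then show "restr F W (W \<inter> W') (\<tau> W) = restr F W' (W \<inter> W') (\<tau> W')"
        by (intro represents_unique[OF represents_restr[OF \<tau>[OF *(1)]] represents_restr[OF \<tau>[OF *(2)]]]) auto
    qed
  qed
  then obtain t where t: "t \<in> carrier (sections F (preimage V))" "\<And>W. W \<in> \<U> \<Longrightarrow> restr F (preimage V) W t = \<tau> W"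
    unfolding Un by blast
  have "\<exists>W. x \<in> W \<and> represents V \<sigma> W (restr F (preimage V) W t)" if "x \<in> preimage V" for x
  proof -
    obtain W where "W \<in> \<U>" "x \<in> W" using \<open>x \<in> preimage V\<close> Un by blast
    then show ?thesis using t(2) \<tau> by auto
  qed
  then show ?thesis using that t(1) unfolding is_image_def by blast
qed

definition comorphism :: "'b set set \<Rightarrow> ('b set \<Rightarrow> ('b \<times> 'b) set) \<Rightarrow> 'c" where
  "comorphism = (\<lambda>V\<in>{V. openin (filt_topology B) V}. \<lambda>\<sigma>\<in>carrier (filt_sections V). THE t. is_image V \<sigma> t)"

lemma comorphism_image:
  assumes "openin (filt_topology B) V" "\<sigma> \<in> carrier (filt_sections V)"
  shows "is_image V \<sigma> (comorphism V \<sigma>)"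
proof -
  obtain t where t: "is_image V \<sigma> t" using image_exists[OF assms] .
  then have "(THE t. is_image V \<sigma> t) = t" using image_unique[OF assms(1)] by blast
  then show ?thesis using t assms by (simp add: comorphism_def)
qed

lemma comorphism_eqI:
  assumes "openin (filt_topology B) V" "\<sigma> \<in> carrier (filt_sections V)" "is_image V \<sigma> t"
  shows "comorphism V \<sigma> = t"
  using image_unique[OF assms(1) comorphism_image[OF assms(1,2)] assms(3)] .

interpretation Filt: ringed_space "filt_topology B" "filt_sheaf B"
  by (rule B.filt_sheaf_ringed_space)

lemma is_imageI:
  assumes "t \<in> carrier (sections F (preimage V))"
    and "\<And>x. x \<in> preimage V \<Longrightarrow> \<exists>W. x \<in> W \<and> represents V \<sigma> W (restr F (preimage V) W t)"
  shows "is_image V \<sigma> t"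
  using assms unfolding is_image_def by blast

lemma is_imageD:
  assumes "is_image V \<sigma> t"
  shows "t \<in> carrier (sections F (preimage V))"
    and "x \<in> preimage V \<Longrightarrow> \<exists>W. x \<in> W \<and> represents V \<sigma> W (restr F (preimage V) W t)"
  using assms unfolding is_image_def by auto

text \<open>For sums and products one restricts to a neighbourhood on which both factors are represented.\<close>

lemma is_image_op:
  assumes V: "openin (filt_topology B) V" and s: "is_image V \<sigma> s" and t: "is_image V \<tau> t"
    and car: "m s t \<in> carrier (sections F (preimage V))"
    and rep: "\<And>W. \<lbrakk>openin X W; W \<subseteq> preimage V; represents V \<sigma> W (restr F (preimage V) W s); represents V \<tau> W (restr F (preimage V) W t)\<rbrakk>
      \<Longrightarrow> represents V \<upsilon> W (restr F (preimage V) W (m s t))"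
  shows "is_image V \<upsilon> (m s t)"
proof (rule is_imageI[OF car])
  fix x assume x: "x \<in> preimage V"
  obtain W where W: "x \<in> W" "represents V \<sigma> W (restr F (preimage V) W s)" using is_imageD(2)[OF s x] by auto
  obtain W' where W': "x \<in> W'" "represents V \<tau> W' (restr F (preimage V) W' t)" using is_imageD(2)[OF t x] by auto
  have o: "openin X W" "openin X W'" using W(2) W'(2) by (auto simp: represents_def)
  then have o': "openin X (W \<inter> W')" by blast
  have sub: "W \<subseteq> preimage V" "W' \<subseteq> preimage V" using represents_subset W(2) W'(2) by auto
  have "represents V \<sigma> (W \<inter> W') (restr F (preimage V) (W \<inter> W') s)"
    using represents_restr[OF W(2) o'] restr_comp[OF openin_preimage[OF V] o(1) o' _ sub(1) is_imageD(1)[OF s]] by simp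
  moreover have "represents V \<tau> (W \<inter> W') (restr F (preimage V) (W \<inter> W') t)"
    using represents_restr[OF W'(2) o'] restr_comp[OF openin_preimage[OF V] o(2) o' _ sub(2) is_imageD(1)[OF t]] by simp
  ultimately have "represents V \<upsilon> (W \<inter> W') (restr F (preimage V) (W \<inter> W') (m s t))"
    using rep[OF o'] sub by auto
  then show "\<exists>W. x \<in> W \<and> represents V \<upsilon> W (restr F (preimage V) W (m s t))" using W(1) W'(1) by auto
qed

lemma represents_mult_add:
  assumes "represents V \<sigma> W s" "represents V \<tau> W t"
  shows "represents V (\<sigma> \<otimes>\<^bsub>filt_sections V\<^esub> \<tau>) W (s \<otimes>\<^bsub>sections F W\<^esub> t)"
    and "represents V (\<sigma> \<oplus>\<^bsub>filt_sections V\<^esub> \<tau>) W (s \<oplus>\<^bsub>sections F W\<^esub> t)"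
proof -
  obtain a g where W: "openin X W" "s \<in> carrier (sections F W)"
    and a: "B.is_fraction \<sigma> V a g" "phi_on W g \<in> Units (sections F W)" "phi_on W g \<otimes>\<^bsub>sections F W\<^esub> s = phi_on W a"
    using assms(1) by (rule representsE)
  obtain b h where t: "t \<in> carrier (sections F W)"
    and b: "B.is_fraction \<tau> V b h" "phi_on W h \<in> Units (sections F W)" "phi_on W h \<otimes>\<^bsub>sections F W\<^esub> t = phi_on W b"
    using assms(2) by (rule representsE)
  note A = B.is_fractionD(1,2)[OF a(1)] and C = B.is_fractionD(1,2)[OF b(1)]
  interpret W: cring "sections F W" by (rule sections_cring[OF W(1)])
  note c = phi_on_closed[OF W(1) A(1)] phi_on_closed[OF W(1) A(2)] phi_on_closed[OF W(1) C(1)] phi_on_closed[OF W(1) C(2)] W(2) t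
  have gh: "phi_on W (g \<otimes>\<^bsub>B\<^esub> h) \<in> Units (sections F W)"
    using phi_on_Units_mult_iff[OF W(1) A(2) C(2)] a b by simp
  have "phi_on W (g \<otimes>\<^bsub>B\<^esub> h) \<otimes>\<^bsub>sections F W\<^esub> (s \<otimes>\<^bsub>sections F W\<^esub> t)
      = (phi_on W g \<otimes>\<^bsub>sections F W\<^esub> s) \<otimes>\<^bsub>sections F W\<^esub> (phi_on W h \<otimes>\<^bsub>sections F W\<^esub> t)"
    unfolding phi_on_mult[OF W(1) A(2) C(2)] using c by (simp add: W.m_ac)
  also have "\<dots> = phi_on W (a \<otimes>\<^bsub>B\<^esub> b)" using a b phi_on_mult[OF W(1) A(1) C(1)] by simp
  finally show "represents V (\<sigma> \<otimes>\<^bsub>filt_sections V\<^esub> \<tau>) W (s \<otimes>\<^bsub>sections F W\<^esub> t)"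
    using W(1) c gh B.is_fraction_mult_add(1)[OF a(1) b(1)] by (intro representsI) auto
  have "phi_on W (g \<otimes>\<^bsub>B\<^esub> h) \<otimes>\<^bsub>sections F W\<^esub> (s \<oplus>\<^bsub>sections F W\<^esub> t)
      = (phi_on W g \<otimes>\<^bsub>sections F W\<^esub> s) \<otimes>\<^bsub>sections F W\<^esub> phi_on W h \<oplus>\<^bsub>sections F W\<^esub> (phi_on W h \<otimes>\<^bsub>sections F W\<^esub> t) \<otimes>\<^bsub>sections F W\<^esub> phi_on W g"
    unfolding phi_on_mult[OF W(1) A(2) C(2)] using c by (simp add: W.m_ac W.r_distr W.l_distr)
  also have "\<dots> = phi_on W (a \<otimes>\<^bsub>B\<^esub> h \<oplus>\<^bsub>B\<^esub> b \<otimes>\<^bsub>B\<^esub> g)" unfolding a(3) b(3) using A C W(1) by (simp add: phi_on_add phi_on_mult)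
  finally show "represents V (\<sigma> \<oplus>\<^bsub>filt_sections V\<^esub> \<tau>) W (s \<oplus>\<^bsub>sections F W\<^esub> t)"
    using W(1) c gh B.is_fraction_mult_add(2)[OF a(1) b(1)] by (intro representsI) auto
qed

text \<open>Over \<open>V\<close> the fraction \<open>1 / 1\<close> is not admissible, because \<open>D(1)\<close> is the whole space; near a point the
unit section is written as \<open>g / g\<close>.\<close>

lemma image_one:
  assumes V: "openin (filt_topology B) V"
  shows "is_image V \<one>\<^bsub>filt_sections V\<^esub> \<one>\<^bsub>sections F (preimage V)\<^esub>"
proof (rule is_imageI)
  interpret P: cring "sections F (preimage V)" by (rule sections_cring[OF openin_preimage[OF V]])
  show "\<one>\<^bsub>sections F (preimage V)\<^esub> \<in> carrier (sections F (preimage V))" by simp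
  fix x assume "x \<in> preimage V"
  then have x: "x \<in> topspace X" "unit_filter x \<in> V" by (auto simp: preimage_def)
  obtain g where g: "g \<in> carrier B" "unit_filter x \<in> basic_open B g" "basic_open B g \<subseteq> V"
    using B.basic_open_base[OF V x(2)] .
  obtain W where W: "openin X W" "x \<in> W" "phi_on W g \<in> Units (sections F W)"
    using g(2) mem_unit_filter[OF x(1)] by (auto simp: basic_open_def)
  interpret W: cring "sections F W" by (rule sections_cring[OF W(1)])
  have "frac_at B P \<one>\<^bsub>B\<^esub> \<one>\<^bsub>B\<^esub> = frac_at B P g g" if "P \<in> spec_basic B g" for P
    using that g(1) by (intro B.frac_at_eqI) (auto simp: spec_basic_def B.prime_one)
  moreover have "spec_basic B g \<subseteq> spec_preimage B V"
    using B.spec_preimage_mono[OF g(3)] B.spec_preimage_basic_open[OF g(1)] by simp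
  ultimately have fr: "B.is_fraction \<one>\<^bsub>filt_sections V\<^esub> V g g"
    using g by (auto simp: B.is_fraction_def B.filt_sheaf_one)
  have "restr F (preimage V) W \<one>\<^bsub>sections F (preimage V)\<^esub> = \<one>\<^bsub>sections F W\<^esub>"
    using restr_one[OF openin_preimage[OF V] W(1) Units_subset_preimage[OF W(1) g(1) W(3) g(3)]] .
  then have "represents V \<one>\<^bsub>filt_sections V\<^esub> W (restr F (preimage V) W \<one>\<^bsub>sections F (preimage V)\<^esub>)"
    using W fr phi_on_closed[OF W(1) g(1)] by (intro representsI) auto
  then show "\<exists>W. x \<in> W \<and> represents V \<one>\<^bsub>filt_sections V\<^esub> W (restr F (preimage V) W \<one>\<^bsub>sections F (preimage V)\<^esub>)"
    using W(2) by auto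
qed

lemma comorphism_carrier:
  "\<lbrakk>openin (filt_topology B) V; \<sigma> \<in> carrier (filt_sections V)\<rbrakk> \<Longrightarrow> comorphism V \<sigma> \<in> carrier (sections F (preimage V))"
  using is_imageD(1)[OF comorphism_image] .

lemma comorphism_ring_hom:
  assumes V: "openin (filt_topology B) V"
  shows "comorphism V \<in> ring_hom (filt_sections V) (sections F (preimage V))"
proof (rule ring_hom_memI)
  interpret P: cring "sections F (preimage V)" by (rule sections_cring[OF openin_preimage[OF V]])
  interpret Q: cring "filt_sections V" by (rule Filt.sections_cring[OF V])
  show "comorphism V \<one>\<^bsub>filt_sections V\<^esub> = \<one>\<^bsub>sections F (preimage V)\<^esub>"
    by (rule comorphism_eqI[OF V _ image_one[OF V]]) simp
  fix \<sigma> \<tau> assume s: "\<sigma> \<in> carrier (filt_sections V)" and t: "\<tau> \<in> carrier (filt_sections V)"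
  note cs = comorphism_carrier[OF V s] and ct = comorphism_carrier[OF V t]
  show "comorphism V \<sigma> \<in> carrier (sections F (preimage V))" by (rule cs)
  show "comorphism V (\<sigma> \<otimes>\<^bsub>filt_sections V\<^esub> \<tau>) = comorphism V \<sigma> \<otimes>\<^bsub>sections F (preimage V)\<^esub> comorphism V \<tau>"
  proof (rule comorphism_eqI[OF V], use s t in simp, rule is_image_op[OF V comorphism_image[OF V s] comorphism_image[OF V t]])
    fix W assume *: "openin X W" "W \<subseteq> preimage V" "represents V \<sigma> W (restr F (preimage V) W (comorphism V \<sigma>))"
      "represents V \<tau> W (restr F (preimage V) W (comorphism V \<tau>))"
    show "represents V (\<sigma> \<otimes>\<^bsub>filt_sections V\<^esub> \<tau>) W (restr F (preimage V) W (comorphism V \<sigma> \<otimes>\<^bsub>sections F (preimage V)\<^esub> comorphism V \<tau>))"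
      unfolding restr_mult[OF openin_preimage[OF V] *(1,2) cs ct] by (rule represents_mult_add[OF *(3,4)])
  qed (use cs ct in simp)
  show "comorphism V (\<sigma> \<oplus>\<^bsub>filt_sections V\<^esub> \<tau>) = comorphism V \<sigma> \<oplus>\<^bsub>sections F (preimage V)\<^esub> comorphism V \<tau>"
  proof (rule comorphism_eqI[OF V], use s t in simp, rule is_image_op[OF V comorphism_image[OF V s] comorphism_image[OF V t]])
    fix W assume *: "openin X W" "W \<subseteq> preimage V" "represents V \<sigma> W (restr F (preimage V) W (comorphism V \<sigma>))"
      "represents V \<tau> W (restr F (preimage V) W (comorphism V \<tau>))"
    show "represents V (\<sigma> \<oplus>\<^bsub>filt_sections V\<^esub> \<tau>) W (restr F (preimage V) W (comorphism V \<sigma> \<oplus>\<^bsub>sections F (preimage V)\<^esub> comorphism V \<tau>))"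
      unfolding restr_add[OF openin_preimage[OF V] *(1,2) cs ct] by (rule represents_mult_add[OF *(3,4)])
  qed (use cs ct in simp)
qed

lemma comorphism_natural:
  assumes V: "openin (filt_topology B) V" and V': "openin (filt_topology B) V'" "V' \<subseteq> V"
    and s: "\<sigma> \<in> carrier (filt_sections V)"
  shows "comorphism V' (restr (filt_sheaf B) V V' \<sigma>) = restr F (preimage V) (preimage V') (comorphism V \<sigma>)"
proof (rule comorphism_eqI[OF V'(1) Filt.restr_closed[OF V V' s]], rule is_imageI)
  let ?t = "comorphism V \<sigma>"
  note cs = comorphism_carrier[OF V s]
  show c': "restr F (preimage V) (preimage V') ?t \<in> carrier (sections F (preimage V'))"
    using restr_closed[OF openin_preimage[OF V] openin_preimage[OF V'(1)] preimage_mono[OF V'(2)] cs] .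
  fix x assume x: "x \<in> preimage V'"
  then have xV: "x \<in> preimage V" and x': "x \<in> topspace X" "unit_filter x \<in> V'"
    using preimage_mono[OF V'(2)] by (auto simp: preimage_def)
  obtain W where W: "x \<in> W" "represents V \<sigma> W (restr F (preimage V) W ?t)"
    using is_imageD(2)[OF comorphism_image[OF V s] xV] by auto
  obtain h where h: "h \<in> carrier B" "unit_filter x \<in> basic_open B h" "basic_open B h \<subseteq> V'"
    using B.basic_open_base[OF V'(1) x'(2)] .
  obtain W' where W': "openin X W'" "x \<in> W'" "phi_on W' h \<in> Units (sections F W')"
    using h(2) mem_unit_filter[OF x'(1)] by (auto simp: basic_open_def)
  have oW: "openin X W" using W(2) by (auto simp: represents_def)
  let ?U = "W \<inter> W'"
  have o: "openin X ?U" using oW W'(1) by blast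
  have sub: "W \<subseteq> preimage V" "?U \<subseteq> preimage V'"
    using represents_subset[OF W(2)] Units_subset_preimage[OF W'(1) h(1) W'(3) h(3)] by auto
  have res: "restr F (preimage V') ?U (restr F (preimage V) (preimage V') ?t) = restr F (preimage V) ?U ?t"
    using restr_comp[OF openin_preimage[OF V] openin_preimage[OF V'(1)] o sub(2) preimage_mono[OF V'(2)] cs] .
  have "represents V \<sigma> ?U (restr F (preimage V) ?U ?t)"
    using represents_restr[OF W(2) o] restr_comp[OF openin_preimage[OF V] oW o _ sub(1) cs] by simp
  then obtain a g where t: "restr F (preimage V) ?U ?t \<in> carrier (sections F ?U)" and a: "B.is_fraction \<sigma> V a g"
    "phi_on ?U g \<in> Units (sections F ?U)" "phi_on ?U g \<otimes>\<^bsub>sections F ?U\<^esub> restr F (preimage V) ?U ?t = phi_on ?U a"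
    by (rule representsE)
  note A = B.is_fractionD(1,2)[OF a(1)]
  interpret U: cring "sections F ?U" by (rule sections_cring[OF o])
  have gh: "basic_open B (g \<otimes>\<^bsub>B\<^esub> h) \<subseteq> V'" using B.basic_open_mult[OF A(2) h(1)] h(3) by auto
  have "spec_basic B (g \<otimes>\<^bsub>B\<^esub> h) \<subseteq> spec_preimage B V'"
    using B.spec_preimage_mono[OF gh] B.spec_preimage_basic_open[of "g \<otimes>\<^bsub>B\<^esub> h"] A h(1) by simp
  then have "B.is_fraction (restr (filt_sheaf B) V V' \<sigma>) V' (a \<otimes>\<^bsub>B\<^esub> h) (g \<otimes>\<^bsub>B\<^esub> h)"
    by (intro B.is_fraction_refine[OF a(1) h(1) gh]) (auto simp: B.filt_sheaf_restr)
  moreover have hU: "phi_on ?U h \<in> Units (sections F ?U)"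
    using phi_on_Units_restrict[OF W'(1) o _ h(1) W'(3)] by simp
  then have "phi_on ?U (g \<otimes>\<^bsub>B\<^esub> h) \<in> Units (sections F ?U)" using phi_on_Units_mult_iff[OF o A(2) h(1)] a by simp
  moreover have "phi_on ?U (g \<otimes>\<^bsub>B\<^esub> h) \<otimes>\<^bsub>sections F ?U\<^esub> restr F (preimage V) ?U ?t = phi_on ?U (a \<otimes>\<^bsub>B\<^esub> h)"
  proof -
    have "phi_on ?U (g \<otimes>\<^bsub>B\<^esub> h) \<otimes>\<^bsub>sections F ?U\<^esub> restr F (preimage V) ?U ?t
        = (phi_on ?U g \<otimes>\<^bsub>sections F ?U\<^esub> restr F (preimage V) ?U ?t) \<otimes>\<^bsub>sections F ?U\<^esub> phi_on ?U h"
      unfolding phi_on_mult[OF o A(2) h(1)]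
      using phi_on_closed[OF o A(2)] phi_on_closed[OF o h(1)] t by (simp add: U.m_ac)
    then show ?thesis unfolding a(3) phi_on_mult[OF o A(1) h(1)] .
  qed
  ultimately have "represents V' (restr (filt_sheaf B) V V' \<sigma>) ?U (restr F (preimage V) ?U ?t)"
    using o t by (intro representsI)
  then show "\<exists>W. x \<in> W \<and> represents V' (restr (filt_sheaf B) V V' \<sigma>) W (restr F (preimage V') W (restr F (preimage V) (preimage V') ?t))"
    using W(1) W'(2) res by (intro exI[of _ ?U]) simp
qed

lemma preimage_Filt: "preimage (Filt B) = topspace X"
  using unit_filter_Filt by (auto simp: preimage_def)

lemma global_section_is_fraction:
  "b \<in> carrier B \<Longrightarrow> B.is_fraction (global_section B b) (Filt B) b \<one>\<^bsub>B\<^esub>"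
  by (auto simp: B.is_fraction_def global_section_def basic_open_def spec_basic_def)

lemma openin_Filt: "openin (filt_topology B) (Filt B)"
  using openin_topspace[of "filt_topology B"] by (simp add: topspace_filt_topology[OF B.is_cring])

lemma comorphism_global_section:
  assumes b: "b \<in> carrier B"
  shows "comorphism (Filt B) (global_section B b) = \<phi> b"
proof (rule comorphism_eqI[OF openin_Filt B.global_section_carrier[OF b]], rule is_imageI)
  let ?T = "topspace X"
  interpret T: cring "sections F ?T" by (rule sections_cring) simp
  have c: "\<phi> b \<in> carrier (sections F ?T)" using ring_hom_closed[OF phi_hom b] .
  then show "\<phi> b \<in> carrier (sections F (preimage (Filt B)))" by (simp add: preimage_Filt)
  have phi_on: "phi_on ?T b = \<phi> b" "restr F ?T ?T (\<phi> b) = \<phi> b" using restr_id[OF openin_topspace c] by (simp_all add: phi_on_def)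
  have "represents (Filt B) (global_section B b) ?T (restr F (preimage (Filt B)) ?T (\<phi> b))"
    using c phi_on phi_on_one[of ?T] global_section_is_fraction[OF b] by (intro representsI) (auto simp: preimage_Filt)
  then show "\<exists>W. x \<in> W \<and> represents (Filt B) (global_section B b) W (restr F (preimage (Filt B)) W (\<phi> b))"
    if "x \<in> preimage (Filt B)" for x using that by (auto simp: preimage_Filt)
qed

text \<open>The inverse of \<open>a / g\<close> over \<open>D(ag)\<close> is \<open>g / a\<close>.\<close>

lemma fraction_unit:
  assumes V: "openin (filt_topology B) V" and \<sigma>: "\<sigma> \<in> carrier (filt_sections V)"
    and a: "B.is_fraction \<sigma> V a g"
  shows "restr (filt_sheaf B) V (basic_open B (a \<otimes>\<^bsub>B\<^esub> g)) \<sigma> \<in> Units (filt_sections (basic_open B (a \<otimes>\<^bsub>B\<^esub> g)))"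
proof -
  note A = B.is_fractionD[OF a]
  let ?D = "basic_open B (a \<otimes>\<^bsub>B\<^esub> g)" and ?S = "spec_basic B (a \<otimes>\<^bsub>B\<^esub> g)"
  have ag: "a \<otimes>\<^bsub>B\<^esub> g \<in> carrier B" using A by simp
  have oD: "openin (filt_topology B) ?D" using B.openin_basic_open[OF ag] .
  have preD: "spec_preimage B ?D = ?S" using B.spec_preimage_basic_open[OF ag] .
  have D: "?D \<subseteq> V" using B.basic_open_mult[OF A(1,2)] A(3) by auto
  have S: "P \<in> Spec B" "a \<notin> P" "g \<notin> P" "P \<in> spec_basic B g" if "P \<in> ?S" for P
    using that A(1,2) by (auto simp: spec_basic_def B.prime_mult_iff)
  let ?r = "restr (filt_sheaf B) V ?D \<sigma>"
  define \<tau> where "\<tau> = (\<lambda>P\<in>?S. frac_at B P g a)"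
  have \<tau>: "\<tau> \<in> carrier (filt_sections ?D)"
    unfolding B.filt_sheaf_carrier preD \<tau>_def using S(2) A(1,2)
    by (intro B.fraction_section[OF B.openin_spec_basic[OF ag]])
  have r: "?r \<in> carrier (filt_sections ?D)" using Filt.restr_closed[OF V oD D \<sigma>] .
  interpret D: cring "filt_sections ?D" by (rule Filt.sections_cring[OF oD])
  have "?r \<otimes>\<^bsub>filt_sections ?D\<^esub> \<tau> = \<one>\<^bsub>filt_sections ?D\<^esub>"
    unfolding B.filt_sheaf_mult B.filt_sheaf_one B.filt_sheaf_restr preD
  proof (rule restrict_ext)
    fix P assume P: "P \<in> ?S"
    have "frac_at B P a g \<otimes>\<^bsub>local_ring_at B P\<^esub> frac_at B P g a = frac_at B P (a \<otimes>\<^bsub>B\<^esub> g) (g \<otimes>\<^bsub>B\<^esub> a)"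
      using S[OF P] A(1,2) by (intro B.frac_at_mult)
    also have "\<dots> = frac_at B P \<one>\<^bsub>B\<^esub> \<one>\<^bsub>B\<^esub>"
      using S[OF P] A(1,2) by (intro B.frac_at_eqI) (auto simp: B.prime_mult_iff B.prime_one B.m_ac)
    finally show "restrict \<sigma> ?S P \<otimes>\<^bsub>local_ring_at B P\<^esub> \<tau> P = frac_at B P \<one>\<^bsub>B\<^esub> \<one>\<^bsub>B\<^esub>"
      using P A(4)[OF S(4)[OF P]] by (simp add: \<tau>_def)
  qed
  moreover from this have "\<tau> \<otimes>\<^bsub>filt_sections ?D\<^esub> ?r = \<one>\<^bsub>filt_sections ?D\<^esub>" using D.m_comm[OF r \<tau>] by simp
  ultimately show ?thesis unfolding Units_def using r \<tau> by blast
qed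

text \<open>Locality on stalks: if the image \<open>\<phi>(a) / \<phi>(g)\<close> of a germ \<open>a / g\<close> is a unit near \<open>x\<close>, then so is
\<open>\<phi>(a)\<close>, hence \<open>a\<close> belongs to the filter of \<open>x\<close> and \<open>a / g\<close> is already a unit at that filter.\<close>

lemma morphism: "ringed_space_morphism X F (filt_topology B) (filt_sheaf B) unit_filter comorphism"
proof (intro ringed_space_morphism.intro ringed_space_morphism_axioms.intro; (fold preimage_def)?)
  show "ringed_space X F" by (rule ringed_space_axioms)
  show "ringed_space (filt_topology B) (filt_sheaf B)" by (rule B.filt_sheaf_ringed_space)
  show "continuous_map X (filt_topology B) unit_filter" by (rule continuous_unit_filter)
  show "unit_filter \<in> extensional (topspace X)" by (simp add: unit_filter_def)
  show "comorphism \<in> extensional {V. openin (filt_topology B) V}" by (simp add: comorphism_def)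
  show "comorphism V \<in> extensional (carrier (filt_sections V))" if "openin (filt_topology B) V" for V
    using that by (simp add: comorphism_def)
  show "comorphism V \<in> ring_hom (filt_sections V) (sections F (preimage V))" if "openin (filt_topology B) V" for V
    using comorphism_ring_hom[OF that] .
  show "comorphism W (restr (filt_sheaf B) V W s) = restr F (preimage V) (preimage W) (comorphism V s)"
    if "openin (filt_topology B) V" "openin (filt_topology B) W" "W \<subseteq> V" "s \<in> carrier (filt_sections V)" for V W s
    using comorphism_natural[OF that] .
  fix x c assume x: "x \<in> topspace X" and c: "c \<in> carrier (stalk (filt_topology B) (filt_sheaf B) (unit_filter x))"
    and nonunit: "c \<notin> Units (stalk (filt_topology B) (filt_sheaf B) (unit_filter x))"
  obtain V \<sigma> where V: "openin (filt_topology B) V" "unit_filter x \<in> V" "\<sigma> \<in> carrier (filt_sections V)"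
    and c: "c = germ (filt_topology B) (filt_sheaf B) (unit_filter x) V \<sigma>" using c by (auto simp: stalk_def)
  have hom: "stalk_hom X F unit_filter comorphism x c = germ X F x (preimage V) (comorphism V \<sigma>)"
    unfolding c preimage_def
    by (rule stalk_hom_germ[OF ring_presheaf_on_axioms Filt.ring_presheaf_on_axioms continuous_unit_filter
          _ _ V(1) x V(2,3)]; fold preimage_def) (auto intro: comorphism_carrier comorphism_natural)
  have xV: "x \<in> preimage V" using x V(2) by (simp add: preimage_def)
  note cs = comorphism_carrier[OF V(1,3)]
  show "stalk_hom X F unit_filter comorphism x c \<notin> Units (stalk X F x)"
  proof
    assume "stalk_hom X F unit_filter comorphism x c \<in> Units (stalk X F x)"
    then obtain W where W: "openin X W" "x \<in> W" "W \<subseteq> preimage V"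
      "restr F (preimage V) W (comorphism V \<sigma>) \<in> Units (sections F W)"
      unfolding hom germ_Units_iff[OF openin_preimage[OF V(1)] xV cs] by auto
    obtain W' where W': "x \<in> W'" "represents V \<sigma> W' (restr F (preimage V) W' (comorphism V \<sigma>))"
      using is_imageD(2)[OF comorphism_image[OF V(1,3)] xV] by auto
    have oW': "openin X W'" using W'(2) by (auto simp: represents_def)
    let ?U = "W \<inter> W'"
    have o: "openin X ?U" using W(1) oW' by blast
    have "represents V \<sigma> ?U (restr F (preimage V) ?U (comorphism V \<sigma>))"
      using represents_restr[OF W'(2) o] restr_comp[OF openin_preimage[OF V(1)] oW' o _ represents_subset[OF W'(2)] cs] by simp
    then obtain a g where a: "B.is_fraction \<sigma> V a g" "phi_on ?U g \<in> Units (sections F ?U)"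
      "phi_on ?U g \<otimes>\<^bsub>sections F ?U\<^esub> restr F (preimage V) ?U (comorphism V \<sigma>) = phi_on ?U a"
      by (rule representsE)
    note A = B.is_fractionD(1,2)[OF a(1)]
    interpret U: cring "sections F ?U" by (rule sections_cring[OF o])
    have "restr F (preimage V) ?U (comorphism V \<sigma>) \<in> Units (sections F ?U)"
      using restr_Units[OF W(1) o _ W(4)] restr_comp[OF openin_preimage[OF V(1)] W(1) o _ W(3) cs] by simp
    from U.Units_m_closed[OF a(2) this] have "phi_on ?U a \<in> Units (sections F ?U)" unfolding a(3) .
    then have "a \<otimes>\<^bsub>B\<^esub> g \<in> unit_filter x"
      using a(2) phi_on_Units_mult_iff[OF o A] A o W(2) W'(1) mem_unit_filter[OF x] by auto
    then have xD: "unit_filter x \<in> basic_open B (a \<otimes>\<^bsub>B\<^esub> g)" using unit_filter_Filt[OF x] by (simp add: basic_open_def)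
    have "basic_open B (a \<otimes>\<^bsub>B\<^esub> g) \<subseteq> V" using B.basic_open_mult[OF A] B.is_fractionD(3)[OF a(1)] by auto
    then have "c \<in> Units (stalk (filt_topology B) (filt_sheaf B) (unit_filter x))"
      unfolding c Filt.germ_Units_iff[OF V]
      using fraction_unit[OF V(1,3) a(1)] xD B.openin_basic_open[of "a \<otimes>\<^bsub>B\<^esub> g"] A by auto
    then show False using nonunit by simp
  qed
qed

text \<open>An inverse of the germ of \<open>b\<close> at \<open>Fi\<close> lives on some \<open>D(g)\<close> with \<open>g \<in> Fi\<close>; there \<open>b\<close> is in no prime,
so it divides a power of \<open>g\<close>, and \<open>Fi\<close> is closed under powers and divisors.\<close>

lemma germ_global_section_Unit:
  assumes Fi: "Fi \<in> Filt B" and b: "b \<in> carrier B"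
    and unit: "germ (filt_topology B) (filt_sheaf B) Fi (Filt B) (global_section B b)
      \<in> Units (stalk (filt_topology B) (filt_sheaf B) Fi)"
  shows "b \<in> Fi"
proof -
  obtain V where V: "openin (filt_topology B) V" "Fi \<in> V"
    "restr (filt_sheaf B) (Filt B) V (global_section B b) \<in> Units (filt_sections V)"
    using unit unfolding Filt.germ_Units_iff[OF openin_Filt Fi B.global_section_carrier[OF b]] by auto
  obtain g where g: "g \<in> carrier B" "Fi \<in> basic_open B g" "basic_open B g \<subseteq> V"
    using B.basic_open_base[OF V(1,2)] .
  obtain \<tau> where \<tau>: "\<tau> \<in> carrier (filt_sections V)"
    "restr (filt_sheaf B) (Filt B) V (global_section B b) \<otimes>\<^bsub>filt_sections V\<^esub> \<tau> = \<one>\<^bsub>filt_sections V\<^esub>"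
    using V(3) unfolding Units_def by auto
  have "b \<notin> P" if P: "P \<in> Spec B" "g \<notin> P" for P
  proof -
    have PV: "P \<in> spec_preimage B V"
      using P B.spec_preimage_mono[OF g(3)] B.spec_preimage_basic_open[OF g(1)] by (auto simp: spec_basic_def)
    show ?thesis
    proof (rule B.prime_Unit_fraction[OF P(1) b])
      show "\<tau> P \<in> carrier (local_ring_at B P)"
        using B.spec_sections_value[OF _ PV] \<tau>(1) by (simp add: B.filt_sheaf_carrier)
      show "frac_at B P b \<one>\<^bsub>B\<^esub> \<otimes>\<^bsub>local_ring_at B P\<^esub> \<tau> P = frac_at B P \<one>\<^bsub>B\<^esub> \<one>\<^bsub>B\<^esub>"
        using fun_cong[OF \<tau>(2), of P] PV P(1)
        by (simp add: B.filt_sheaf_mult B.filt_sheaf_one B.filt_sheaf_restr global_section_def)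
    qed
  qed
  then obtain n :: nat where n: "b divides\<^bsub>B\<^esub> g [^]\<^bsub>B\<^esub> n" using B.divides_power[OF g(1) b] by blast
  have "g [^]\<^bsub>B\<^esub> n \<in> Fi" using B.filter_power[OF Fi] g(2) by (simp add: basic_open_def)
  then show ?thesis using n b Fi by (simp add: Filt_def)
qed

context
  fixes f \<theta>
  assumes mor: "ringed_space_morphism X F (filt_topology B) (filt_sheaf B) f \<theta>"
    and global: "\<And>b. b \<in> carrier B \<Longrightarrow> \<theta> (Filt B) (global_section B b) = \<phi> b"
begin

interpretation M: ringed_space_morphism X F "filt_topology B" "filt_sheaf B" f \<theta>
  by (rule mor)

lemma f_filter: "x \<in> topspace X \<Longrightarrow> f x \<in> Filt B"
  using continuous_map_funspace[OF M.continuous] by (auto simp: topspace_filt_topology[OF B.is_cring])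

lemma openin_f_preimage:
  "openin (filt_topology B) V \<Longrightarrow> openin X {x \<in> topspace X. f x \<in> V}"
  using openin_continuous_map_preimage[OF M.continuous] .

lemma global_restr:
  assumes b: "b \<in> carrier B" and V: "openin (filt_topology B) V"
  shows "\<theta> V (restr (filt_sheaf B) (Filt B) V (global_section B b)) = phi_on {x \<in> topspace X. f x \<in> V} b"
proof -
  have "{x \<in> topspace X. f x \<in> Filt B} = topspace X" using f_filter by auto
  moreover have "V \<subseteq> Filt B" using openin_subset[OF V] by (simp add: topspace_filt_topology[OF B.is_cring])
  ultimately show ?thesis
    using M.comorphism_natural[OF openin_Filt V _ B.global_section_carrier[OF b]] global[OF b] by (simp add: phi_on_def)
qed

text \<open>The section \<open>b\<close> is invertible over \<open>D(b)\<close>, and its image under the comorphism is the restriction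
of \<open>\<phi> b\<close>.\<close>

lemma phi_on_Unit_preimage_basic_open:
  assumes b: "b \<in> carrier B"
  shows "phi_on {x \<in> topspace X. f x \<in> basic_open B b} b
    \<in> Units (sections F {x \<in> topspace X. f x \<in> basic_open B b})" (is "phi_on ?W b \<in> _")
proof -
  let ?D = "basic_open B b"
  have oD: "openin (filt_topology B) ?D" using B.openin_basic_open[OF b] .
  have preD: "spec_preimage B ?D = spec_basic B b" using B.spec_preimage_basic_open[OF b] .
  have bg: "restr (filt_sheaf B) (Filt B) ?D (global_section B b) \<in> Units (filt_sections ?D)"
    using fraction_unit[OF openin_Filt B.global_section_carrier[OF b] global_section_is_fraction[OF b]] b
    by simp
  interpret S: cring "sections F ?W" by (rule sections_cring[OF openin_f_preimage[OF oD]])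
  note \<theta>_hom = M.comorphism_hom[OF oD]
  obtain \<tau> where \<tau>: "\<tau> \<in> carrier (filt_sections ?D)"
    "restr (filt_sheaf B) (Filt B) ?D (global_section B b) \<otimes>\<^bsub>filt_sections ?D\<^esub> \<tau> = \<one>\<^bsub>filt_sections ?D\<^esub>"
    and r: "restr (filt_sheaf B) (Filt B) ?D (global_section B b) \<in> carrier (filt_sections ?D)"
    using bg unfolding Units_def by auto
  have "phi_on ?W b \<otimes>\<^bsub>sections F ?W\<^esub> \<theta> ?D \<tau> = \<one>\<^bsub>sections F ?W\<^esub>"
    using ring_hom_mult[OF \<theta>_hom r \<tau>(1)] \<tau>(2) ring_hom_one[OF \<theta>_hom] global_restr[OF b oD] by simp
  moreover have c: "phi_on ?W b \<in> carrier (sections F ?W)" "\<theta> ?D \<tau> \<in> carrier (sections F ?W)"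
    using phi_on_closed[OF openin_f_preimage[OF oD] b] ring_hom_closed[OF \<theta>_hom \<tau>(1)] by auto
  ultimately have "phi_on ?W b \<otimes>\<^bsub>sections F ?W\<^esub> \<theta> ?D \<tau> = \<one>\<^bsub>sections F ?W\<^esub>"
    "\<theta> ?D \<tau> \<otimes>\<^bsub>sections F ?W\<^esub> phi_on ?W b = \<one>\<^bsub>sections F ?W\<^esub>" using S.m_comm[OF c] by auto
  then show ?thesis unfolding Units_def using c by blast
qed

text \<open>One inclusion follows from the invertibility of \<open>b\<close> over \<open>D(b)\<close>. The other one is where locality
on stalks enters: if \<open>\<phi> b\<close> is a unit near \<open>x\<close>, the germ of \<open>b\<close> at \<open>f x\<close> must be a unit.\<close>

lemma morphism_map_unique: "f = unit_filter"
proof (rule extensionalityI[OF M.map_extensional])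
  show "unit_filter \<in> extensional (topspace X)" by (simp add: unit_filter_def)
  fix x assume x: "x \<in> topspace X"
  have fx: "f x \<in> Filt B" using f_filter[OF x] .
  have "b \<in> f x \<longleftrightarrow> b \<in> unit_filter x" if b: "b \<in> carrier B" for b
  proof
    assume "b \<in> f x"
    then have "x \<in> {x \<in> topspace X. f x \<in> basic_open B b}" using x fx by (simp add: basic_open_def)
    then show "b \<in> unit_filter x" unfolding mem_unit_filter[OF x]
      using b phi_on_Unit_preimage_basic_open[OF b] openin_f_preimage[OF B.openin_basic_open[OF b]]
      by (intro conjI exI[of _ "{x \<in> topspace X. f x \<in> basic_open B b}"])
  next
    assume bpt: "b \<in> unit_filter x"
    let ?c = "germ (filt_topology B) (filt_sheaf B) (f x) (Filt B) (global_section B b)"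
    have T: "{x \<in> topspace X. f x \<in> Filt B} = topspace X" using f_filter by auto
    have hom: "stalk_hom X F f \<theta> x ?c = germ X F x (topspace X) (\<phi> b)"
    proof -
      have "stalk_hom X F f \<theta> x ?c
          = germ X F x {x \<in> topspace X. f x \<in> Filt B} (\<theta> (Filt B) (global_section B b))"
      proof (rule stalk_hom_germ[OF ring_presheaf_on_axioms Filt.ring_presheaf_on_axioms M.continuous
            _ _ openin_Filt x fx B.global_section_carrier[OF b]])
        show "\<theta> V s \<in> carrier (sections F {x \<in> topspace X. f x \<in> V})"
          if "openin (filt_topology B) V" "s \<in> carrier (filt_sections V)" for V s
          using ring_hom_closed[OF M.comorphism_hom[OF that(1)] that(2)] .
      qed (rule M.comorphism_natural)
      then show ?thesis using global[OF b] T by simp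
    qed
    obtain W where "openin X W" "x \<in> W" "phi_on W b \<in> Units (sections F W)" using bpt mem_unit_filter[OF x] by auto
    then have "germ X F x (topspace X) (\<phi> b) \<in> Units (stalk X F x)"
      unfolding germ_Units_iff[OF openin_topspace x ring_hom_closed[OF phi_hom b]]
      using openin_subset[of X W] by (auto simp: phi_on_def)
    moreover have "?c \<in> carrier (stalk (filt_topology B) (filt_sheaf B) (f x))"
      using openin_Filt fx B.global_section_carrier[OF b] by (auto simp: stalk_def)
    ultimately have "?c \<in> Units (stalk (filt_topology B) (filt_sheaf B) (f x))"
      using M.local_on_stalks[OF x, of ?c] hom by auto
    then show "b \<in> f x" by (rule germ_global_section_Unit[OF fx b])
  qed
  moreover have "f x \<subseteq> carrier B" "unit_filter x \<subseteq> carrier B" using fx unit_filter_Filt[OF x] by (auto simp: Filt_def)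
  ultimately show "f x = unit_filter x" by blast
qed

text \<open>If \<open>\<sigma> = a / g\<close> over \<open>D(g)\<close>, then \<open>g \<sigma> = a\<close> there, and applying \<open>\<theta>\<close> shows that the restriction of
\<open>\<theta> V \<sigma>\<close> is \<open>\<phi>(a) / \<phi>(g)\<close>.\<close>

lemma morphism_is_image:
  assumes V: "openin (filt_topology B) V" and \<sigma>: "\<sigma> \<in> carrier (filt_sections V)"
  shows "is_image V \<sigma> (\<theta> V \<sigma>)"
proof (rule is_imageI)
  have preimage: "{x \<in> topspace X. f x \<in> V} = preimage V" for V by (simp add: morphism_map_unique preimage_def)
  show car: "\<theta> V \<sigma> \<in> carrier (sections F (preimage V))"
    using ring_hom_closed[OF M.comorphism_hom[OF V] \<sigma>] by (simp add: preimage)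
  fix x assume "x \<in> preimage V"
  then have x: "x \<in> topspace X" "unit_filter x \<in> V" by (auto simp: preimage_def)
  obtain a g where a: "B.is_fraction \<sigma> V a g" "g \<in> unit_filter x"
    using B.section_is_fraction[OF V \<sigma> x(2)] .
  note A = B.is_fractionD[OF a(1)]
  let ?D = "basic_open B g" and ?W = "preimage (basic_open B g)"
  have oD: "openin (filt_topology B) ?D" using B.openin_basic_open[OF A(2)] .
  have preD: "spec_preimage B ?D = spec_basic B g" using B.spec_preimage_basic_open[OF A(2)] .
  have oW: "openin X ?W" using openin_preimage[OF oD] .
  have D: "?D \<subseteq> V" by (rule A(3))
  have DF: "?D \<subseteq> Filt B" by (auto simp: basic_open_def)
  let ?s = "restr (filt_sheaf B) V ?D \<sigma>"
  let ?g = "restr (filt_sheaf B) (Filt B) ?D (global_section B g)"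
  let ?a = "restr (filt_sheaf B) (Filt B) ?D (global_section B a)"
  have c: "?s \<in> carrier (filt_sections ?D)" "?g \<in> carrier (filt_sections ?D)"
    using Filt.restr_closed[OF V oD D \<sigma>] Filt.restr_closed[OF openin_Filt oD DF B.global_section_carrier[OF A(2)]] by auto
  have "?g \<otimes>\<^bsub>filt_sections ?D\<^esub> ?s = ?a"
    unfolding B.filt_sheaf_mult B.filt_sheaf_restr preD
  proof (rule restrict_ext)
    fix P assume P: "P \<in> spec_basic B g"
    then have P': "P \<in> Spec B" "g \<notin> P" by (auto simp: spec_basic_def)
    have "frac_at B P g \<one>\<^bsub>B\<^esub> \<otimes>\<^bsub>local_ring_at B P\<^esub> frac_at B P a g = frac_at B P (g \<otimes>\<^bsub>B\<^esub> a) (\<one>\<^bsub>B\<^esub> \<otimes>\<^bsub>B\<^esub> g)"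
      using P' A(1,2) B.prime_one by (intro B.frac_at_mult) auto
    also have "\<dots> = frac_at B P a \<one>\<^bsub>B\<^esub>"
      using P' A(1,2) B.prime_one by (intro B.frac_at_eqI) (auto simp: B.m_ac)
    finally show "restrict (global_section B g) (spec_basic B g) P \<otimes>\<^bsub>local_ring_at B P\<^esub> restrict \<sigma> (spec_basic B g) P
        = global_section B a P"
      using P P' A(4)[OF P] by (simp add: global_section_def)
  qed
  then have "phi_on ?W g \<otimes>\<^bsub>sections F ?W\<^esub> \<theta> ?D ?s = phi_on ?W a"
    using ring_hom_mult[OF M.comorphism_hom[OF oD] c(2,1)] global_restr[OF A(2) oD] global_restr[OF A(1) oD]
    by (simp add: preimage)
  moreover have eq: "\<theta> ?D ?s = restr F (preimage V) ?W (\<theta> V \<sigma>)"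
    using M.comorphism_natural[OF V oD D \<sigma>] by (simp add: preimage)
  moreover have "phi_on ?W g \<in> Units (sections F ?W)" using phi_on_Unit_preimage_basic_open[OF A(2)] by (simp add: preimage)
  moreover have "restr F (preimage V) ?W (\<theta> V \<sigma>) \<in> carrier (sections F ?W)"
    using restr_closed[OF openin_preimage[OF V] oW preimage_mono[OF D] car] .
  ultimately have "represents V \<sigma> ?W (restr F (preimage V) ?W (\<theta> V \<sigma>))"
    using a(1) oW by (intro representsI) auto
  moreover have "x \<in> ?W" using x a(2) unit_filter_Filt by (simp add: preimage_def basic_open_def)
  ultimately show "\<exists>W. x \<in> W \<and> represents V \<sigma> W (restr F (preimage V) W (\<theta> V \<sigma>))" by blast
qed

lemma morphism_comorphism_unique: "\<theta> = comorphism"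
proof (rule extensionalityI[OF M.comorphism_extensional(1)])
  show "comorphism \<in> extensional {V. openin (filt_topology B) V}" by (simp add: comorphism_def)
  fix V assume "V \<in> {V. openin (filt_topology B) V}"
  then have V: "openin (filt_topology B) V" by simp
  show "\<theta> V = comorphism V"
  proof (rule extensionalityI[OF M.comorphism_extensional(2)[OF V]])
    show "comorphism V \<in> extensional (carrier (filt_sections V))" using V by (simp add: comorphism_def)
    fix \<sigma> assume \<sigma>: "\<sigma> \<in> carrier (filt_sections V)"
    show "\<theta> V \<sigma> = comorphism V \<sigma>" using comorphism_eqI[OF V \<sigma> morphism_is_image[OF V \<sigma>]] by simp
  qed
qed

end

end

theorem mainTheorem4:
  fixes X :: "'a topology" and OX :: "('a, 'c) ring_presheaf" and A :: "'c ring"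
    and B :: "('b, 'm) ring_scheme" and \<phi> :: "'b \<Rightarrow> 'c"
  assumes "ringed_space X OX"
    and "sections OX (topspace X) = A"
    and "cring B"
    and "\<phi> \<in> ring_hom B A"
  shows "\<exists>!(f, \<theta>). ringed_space_morphism X OX (filt_topology B) (filt_sheaf B) f \<theta> \<and>
           (\<forall>b\<in>carrier B. \<theta> (topspace (filt_topology B)) (global_section B b) = \<phi> b)"
proof -
  interpret hom_to_global_sections X OX B \<phi>
    using assms by (intro hom_to_global_sections.intro hom_to_global_sections_axioms.intro) auto
  show ?thesis
  proof (rule ex1I[of _ "(unit_filter, comorphism)"])
    show "case (unit_filter, comorphism) of (f, \<theta>) \<Rightarrow> ringed_space_morphism X OX (filt_topology B) (filt_sheaf B) f \<theta> \<and>
        (\<forall>b\<in>carrier B. \<theta> (topspace (filt_topology B)) (global_section B b) = \<phi> b)"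
      using morphism comorphism_global_section by (simp add: topspace_filt_topology[OF assms(3)])
    fix p assume "case p of (f, \<theta>) \<Rightarrow> ringed_space_morphism X OX (filt_topology B) (filt_sheaf B) f \<theta> \<and>
        (\<forall>b\<in>carrier B. \<theta> (topspace (filt_topology B)) (global_section B b) = \<phi> b)"
    then have "ringed_space_morphism X OX (filt_topology B) (filt_sheaf B) (fst p) (snd p)"
      "\<And>b. b \<in> carrier B \<Longrightarrow> snd p (Filt B) (global_section B b) = \<phi> b"
      by (auto simp: topspace_filt_topology[OF assms(3)] case_prod_beta)
    then show "p = (unit_filter, comorphism)" using morphism_map_unique[of "fst p" "snd p"] morphism_comorphism_unique[of "fst p" "snd p"] by (simp add: prod_eq_iff)
  qed
qed

end
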